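(* Let $n\ge 1$ and let $W:\mathbb{R}^n\setminus\{0\}\to\mathbb{R}$ satisfy the following three assumptions: (W1) $W\in C^1(\mathbb{R}^n\setminus\{0\})\cap L^1_{loc}(\mathbb{R}^n)$ is radially symmetric, $W(x)=w(|x|)$ for some $w:(0,\infty)\to\mathbb{R}$; (W2) $w'(r)<0$ for all $r>0$; (W3) there exists $c>0$ such that $w'(r)\le -cr$ for all $r\in(0,1)$. (i) Suppose $n\ge 2$. For every $R_*\in(0,\infty)$ there is a constant $c(n,W,R_* )>0$, depending only on $n$, $W$ and $R_*$, such that for every $\rho\in L^1_+(\mathbb{R}^n)\cap L^\infty(\mathbb{R}^n)$, not identically zero (a.e.), with $\mathrm{supp}\,\rho^*\subset B(0,R_* )$, $$\mathcal{E}_W[\rho^*]-\mathcal{E}_W[\rho]\ \ge\ c(n,W,R_* )\,\|\rho\|_1^{2+\frac2n}\,\|\rho\|_\infty^{-\frac2n}\,\delta(\rho)^2 .$$ (ii) Suppose $n=1$. For every $R_*\in(0,\infty)$ there is a constant $c(1,W,R_* )>0$, depending only on $W$ and $R_*$, such that for every $\rho\in L^1_+(\mathbb{R})\cap L^\infty(\mathbb{R})$, not identically zero, with $\mathrm{supp}\,\rho^*\subset B(0,R_* )$: the inequality in (i) (with $n=1$) holds if $\rho$ is a constant multiple of a characteristic function $1_D$; and for general such $\rho$ the inequality in (i) (with $n=1$) holds with $\delta(\rho)^2$ replaced by $\delta(\rho)^3$. (iii) In particular, for the power-law potentials $W=W_k$ with $k\in(-n,2]$, the constant can be taken to be $c(n,W_k,R_*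 )=c(n)R_*^{k-2}$, where $c(n)>0$ depends only on $n$.
   Context: $L^1_+(\mathbb{R}^n)$ is the set of nonnegative functions in $L^1(\mathbb{R}^n)$; $\|\cdot\|_p$ is the $L^p(\mathbb{R}^n)$ norm; $B(a,r)$ is the ball in $\mathbb{R}^n$ centered at $a$ with radius $r$. The interaction energy is $$\mathcal{E}_W[\rho]:=\int_{\mathbb{R}^n}\int_{\mathbb{R}^n}\rho(x)\rho(y)W(x-y)\,dx\,dy$$ (it may equal $-\infty$ when $\rho$ is not compactly supported). $\rho^*$ denotes the radially symmetric decreasing rearrangement of $\rho$: $\rho^*(x)=\int_0^\infty 1_{D_h^*}(x)\,dh$ with $D_h=\{\rho>h\}$, where for a set $D$ of finite measure $D^*$ is the ball centered at the origin with $|D^*|=|D|$. For $a\in\mathbb{R}^n$, $T_a\rho:=\rho(\cdot+a)$. The $L^1$ asymmetry is $$\delta(\rho):=\inf_{a\in\mathbb{R}^n}\frac{\|T_a\rho-\rho^*\|_{L^1(\mathbb{R}^n)}}{2\|\rho\|_{L^1(\mathbb{R}^n)}} .$$ The power-law potentials are $W_k(x):=-\frac{|x|^k}{k}$ for $k\ne0$ and $W_0(x):=-\log|x|$; for $k\in(-n,2]$ they satisfy (W1)-(W3). *)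

theory Defs
  imports "HOL-Probability.Essential_Supremum"
begin

text \<open>
  \<open>\<real>\<^sup>n\<close> is an arbitrary Euclidean space \<open>'a\<close> with \<open>n = DIM('a)\<close>. Elements of
  \<open>L\<^sup>1\<close> and \<open>L\<^sup>\<infinity>\<close> are represented by Lebesgue measurable functions.
\<close>

definition L1_norm :: "('a::euclidean_space \<Rightarrow> real) \<Rightarrow> real" where
  "L1_norm f = (LINT x|lebesgue. \<bar>f x\<bar>)"

definition ess_bounded :: "('a::euclidean_space \<Rightarrow> real) \<Rightarrow> bool" where
  "ess_bounded f \<longleftrightarrow> f \<in> borel_measurable lebesgue \<and> esssup lebesgue (\<lambda>x. ereal \<bar>f x\<bar>) < \<infinity>"

definition Linf_norm :: "('a::euclidean_space \<Rightarrow> real) \<Rightarrow> real" where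
  "Linf_norm f = real_of_ereal (esssup lebesgue (\<lambda>x. ereal \<bar>f x\<bar>))"

text \<open>
  The energy is extended-real-valued: the difference of the integrals of the positive and the
  negative part of the integrand. For nonnegative \<open>\<rho> \<in> L\<^sup>1 \<inter> L\<^sup>\<infinity>\<close> and \<open>W\<close> as below the
  first integral is finite, so the value lies in \<open>[-\<infinity>, \<infinity>)\<close> and no \<open>\<infinity> - \<infinity>\<close> arises.
  The value \<open>W 0\<close>, which is arbitrary, enters only on the null set \<open>x = y\<close>.
\<close>

definition interaction_energy :: "('a::euclidean_space \<Rightarrow> real) \<Rightarrow> ('a \<Rightarrow> real) \<Rightarrow> ereal" where
  "interaction_energy W \<rho> =
     enn2ereal (\<integral>\<^sup>+x. \<integral>\<^sup>+y. ennreal (\<rho> x * \<rho> y * W (x - y)) \<partial>lebesgue \<partial>lebesgue)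
   - enn2ereal (\<integral>\<^sup>+x. \<integral>\<^sup>+y. ennreal (- (\<rho> x * \<rho> y * W (x - y))) \<partial>lebesgue \<partial>lebesgue)"

definition symm_ball :: "'a::euclidean_space set \<Rightarrow> 'a set" where
  "symm_ball D = ball 0 (THE r. 0 \<le> r \<and> emeasure lebesgue (ball (0::'a) r) = emeasure lebesgue D)"

definition rearrangement :: "('a::euclidean_space \<Rightarrow> real) \<Rightarrow> 'a \<Rightarrow> real" where
  "rearrangement \<rho> x = (LINT h:{0<..}|lborel. indicator (symm_ball {y. \<rho> y > h}) x)"

definition asymmetry :: "('a::euclidean_space \<Rightarrow> real) \<Rightarrow> real" where
  "asymmetry \<rho> =
     (INF a. L1_norm (\<lambda>x. \<rho> (x + a) - rearrangement \<rho> x) / (2 * L1_norm \<rho>))"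

definition topological_support :: "('a::euclidean_space \<Rightarrow> real) \<Rightarrow> 'a set" where
  "topological_support f = closure {x. f x \<noteq> 0}"

text \<open>
  The support is closed, so the ball containing it is taken closed: in this way indicator
  functions of balls of radius exactly \<open>R\<close> are included.
\<close>

definition density_class :: "real \<Rightarrow> ('a::euclidean_space \<Rightarrow> real) set" where
  "density_class R = {\<rho>. integrable lebesgue \<rho> \<and> (AE x in lebesgue. 0 \<le> \<rho> x) \<and> ess_bounded \<rho>
     \<and> \<not> (AE x in lebesgue. \<rho> x = 0)
     \<and> topological_support (rearrangement \<rho>) \<subseteq> cball 0 R}"

definition multiple_of_indicator :: "('a::euclidean_space \<Rightarrow> real) \<Rightarrow> bool" where
  "multiple_of_indicator \<rho> \<longleftrightarrow>
     (\<exists>a. \<exists>D\<in>sets lebesgue. AE x in lebesgue. \<rho> x = a * indicator D x)"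

definition C1_on :: "'a::euclidean_space set \<Rightarrow> ('a \<Rightarrow> real) \<Rightarrow> bool" where
  "C1_on S f \<longleftrightarrow> (\<exists>f' :: 'a \<Rightarrow> 'a \<Rightarrow>\<^sub>L real.
     (\<forall>x\<in>S. (f has_derivative blinfun_apply (f' x)) (at x)) \<and> continuous_on S f')"

definition locally_integrable :: "('a::euclidean_space \<Rightarrow> real) \<Rightarrow> bool" where
  "locally_integrable f \<longleftrightarrow> (\<forall>K. compact K \<longrightarrow> set_integrable lebesgue K f)"

text \<open>
  The conditions under the quantifier concern the radial profile \<open>w\<close>; it is differentiable
  on \<open>(0,\<infinity>)\<close> because \<open>W\<close> is \<open>C\<^sup>1\<close> away from the origin, so \<open>deriv w\<close> is its derivative there.
\<close>

definition admissible_potential :: "('a::euclidean_space \<Rightarrow> real) \<Rightarrow> bool" where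
  "admissible_potential W \<longleftrightarrow> C1_on (- {0}) W \<and> locally_integrable W \<and>
     (\<exists>w :: real \<Rightarrow> real.
        (\<forall>x. x \<noteq> 0 \<longrightarrow> W x = w (norm x)) \<and>
        (\<forall>r>0. deriv w r < 0) \<and>
        (\<exists>c>0. \<forall>r\<in>{0<..<1}. deriv w r \<le> - c * r))"

definition power_potential :: "real \<Rightarrow> 'a::euclidean_space \<Rightarrow> real" where
  "power_potential k x = (if k = 0 then - ln (norm x) else - (norm x powr k) / k)"

definition energy_deficit_bound ::
    "('a::euclidean_space \<Rightarrow> real) \<Rightarrow> real \<Rightarrow> nat \<Rightarrow> ('a \<Rightarrow> real) \<Rightarrow> bool" where
  "energy_deficit_bound W c p \<rho> \<longleftrightarrow>
     interaction_energy W (rearrangement \<rho>) - interaction_energy W \<rho>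
       \<ge> ereal (c * L1_norm \<rho> powr (2 + 2 / real DIM('a))
                  * Linf_norm \<rho> powr (- 2 / real DIM('a)) * asymmetry \<rho> ^ p)"

end

theory Submission
  imports Defs
begin

text \<open>
  On \<open>(0, M)\<close> with \<open>M = 18 R\<close> the profile satisfies \<open>w' r \<le> - c r\<close>, so the truncation
  \<open>(w r - w M)\<^sub>+\<close> is the sum of a nonnegative decreasing kernel and \<open>c / 2\<close> times the quadratic kernel
  \<open>(M\<^sup>2 - r\<^sup>2)\<^sub>+\<close>. The first summand is handled by the Riesz rearrangement inequality, which follows from
  polarization: among the functions reachable from a Lipschitz function by polarizations, one with
  almost minimal second moment is almost radially decreasing. For the quadratic kernel, either no
  ball of radius \<open>3 R\<close> carries half of the mass, and then the energy of \<open>\<rho>\<close> is far below that of \<open>\<rho>\<^sup>*\<close>,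
  or the interaction is the exact quadratic \<open>M\<^sup>2 - |x - y|\<^sup>2\<close> on a ball carrying most of the mass, and
  centring at the barycentre reduces the deficit to the difference of the second moments of \<open>\<rho>\<close> and \<open>\<rho>\<^sup>*\<close>.
  Slicing by superlevel sets, a quantitative bathtub principle bounds that difference below
  by \<open>\<integral> s\<^sup>2 \<beta>\<^sup>2 / (4 n a)\<close> over the levels, where \<open>a\<close> is the volume of the superlevel set, \<open>s\<close> the radius of
  its symmetrization and \<open>2 \<beta>\<close> the volume of their symmetric difference; an application
  of \<open>2 l \<beta> \<le> P \<beta>\<^sup>2 + l\<^sup>2 / P\<close> with the right slope \<open>l\<close> turns it into a power of the asymmetry.
\<close>

text \<open>Stability for a general decreasing kernel is a two-body problem. The quadratic kernel is
  split off because \<open>|x - y|^2\<close>, integrated against the product of a density with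
  itself, is twice the mass times the second moment about the barycentre: a one-body quantity, for
  which comparing superlevel sets with balls suffices. The obstacle is that \<open>\<rho>\<close>
  need not have bounded support, so it may have neither a barycentre nor a finite second moment.
  Hence the truncation at \<open>M\<close>, the barycentre of an inner part only, and the capped
  moment \<open>min (norm x^2) (4 * R^2)\<close>. This barycentre cannot be prescribed; therefore
  the moment gap is proved for all translates of \<open>\<rho>\<close>, and the infimum over
  translations in the asymmetry provides exactly that. The number 18 is 6 times 3: the radius
  \<open>r = 3 R\<close> has \<open>r^2 = 9 R^2\<close>, above the \<open>8 R^2\<close> that both
  cases of the mass dichotomy require, and the ball of radius \<open>3 r\<close> on which the kernel
  must be untruncated has diameter \<open>6 r\<close>.\<close>

section \<open>Uniqueness of translation invariant measures\<close>

text \<open>Integrating \<open>indicator A x * indicator B (y - x)\<close> against both measures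
  gives the product of \<open>lborel A\<close> and \<open>M B\<close> when \<open>y\<close> is
  integrated first. Substituting \<open>y + x\<close> for \<open>x\<close> and integrating in the
  other order gives \<open>M A\<close> times \<open>lborel B\<close>, because the ball
  \<open>B\<close> is symmetric. The common finite positive value on \<open>B\<close> cancels. The
  result serves to show that reflections preserve Lebesgue measure.\<close>

lemma lborel_eqI_translation_invariant:
  fixes M :: "'a::euclidean_space measure"
  assumes sets: "sets M = sets borel" and sf: "sigma_finite_measure M"
    and tr: "\<And>c. distr M borel ((+) c) = M"
    and norm: "emeasure M (ball 0 1) = emeasure lborel (ball (0::'a) 1)"
  shows "M = lborel"
proof (rule measure_eqI)
  show "sets M = sets lborel" using sets by simp
  fix A assume "A \<in> sets M"
  then have A[measurable]: "A \<in> sets borel" using sets by simp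
  interpret M: sigma_finite_measure M by fact
  interpret pair_sigma_finite lborel M ..
  have [measurable_cong]: "sets M = sets borel" by fact
  define B where "B = ball (0::'a) 1"
  have [measurable]: "B \<in> sets borel" by (simp add: B_def)
  have trM: "(\<integral>\<^sup>+x. f (c + x) \<partial>M) = (\<integral>\<^sup>+x. f x \<partial>M)" if [measurable]: "f \<in> borel_measurable borel" for f :: "'a \<Rightarrow> ennreal" and c
  proof -
    have "(\<integral>\<^sup>+x. f x \<partial>M) = (\<integral>\<^sup>+x. f x \<partial>distr M borel ((+) c))" by (simp add: tr)
    also have "\<dots> = (\<integral>\<^sup>+x. f (c + x) \<partial>M)" by (subst nn_integral_distr) auto
    finally show ?thesis by simp
  qed
  have trl: "(\<integral>\<^sup>+x. f (c + x) \<partial>lborel) = (\<integral>\<^sup>+x. f x \<partial>lborel)" if [measurable]: "f \<in> borel_measurable borel" for f :: "'a \<Rightarrow> ennreal" and c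
  proof -
    have "(\<integral>\<^sup>+x. f x \<partial>lborel) = (\<integral>\<^sup>+x. f x \<partial>distr lborel borel ((+) c))" by (simp add: lborel_distr_plus)
    also have "\<dots> = (\<integral>\<^sup>+x. f (c + x) \<partial>lborel)" by (subst nn_integral_distr) auto
    finally show ?thesis by simp
  qed
  have tB: "(\<integral>\<^sup>+y. indicator B (-x + y) \<partial>M) = (\<integral>\<^sup>+y. indicator B y \<partial>M)" for x
    by (rule trM) measurable
  have tA: "(\<integral>\<^sup>+y. indicator A (x + y) \<partial>M) = (\<integral>\<^sup>+y. indicator A y \<partial>M)" for x
    by (rule trM) measurable
  have "emeasure lborel A * emeasure M B
      = (\<integral>\<^sup>+x. indicator A x * (\<integral>\<^sup>+y. indicator B y \<partial>M) \<partial>lborel)"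
    by (simp add: nn_integral_multc sets)
  also have "\<dots> = (\<integral>\<^sup>+x. indicator A x * (\<integral>\<^sup>+y. indicator B (-x + y) \<partial>M) \<partial>lborel)"
    by (simp only: tB)
  also have "\<dots> = (\<integral>\<^sup>+x. (\<integral>\<^sup>+y. indicator A x * indicator B (-x + y) \<partial>M) \<partial>lborel)"
    by (intro nn_integral_cong nn_integral_cmult[symmetric]) measurable
  also have "\<dots> = (\<integral>\<^sup>+y. (\<integral>\<^sup>+x. indicator A x * indicator B (-x + y) \<partial>lborel) \<partial>M)"
    by (rule Fubini'[symmetric]) measurable
  also have "\<dots> = (\<integral>\<^sup>+y. (\<integral>\<^sup>+x. indicator A (y + x) * indicator B (-x) \<partial>lborel) \<partial>M)"
  proof (rule nn_integral_cong)
    fix y :: 'a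
    have "(\<integral>\<^sup>+x. indicator A (y + x) * indicator B (-(y + x) + y) \<partial>lborel)
      = (\<integral>\<^sup>+x. indicator A x * indicator B (-x + y) \<partial>lborel)"
      by (rule trl[where f="\<lambda>x. indicator A x * indicator B (-x + y)"]) measurable
    then show "(\<integral>\<^sup>+x. indicator A x * indicator B (-x + y) \<partial>lborel) = (\<integral>\<^sup>+x. indicator A (y + x) * indicator B (-x) \<partial>lborel)"
      by simp
  qed
  also have "\<dots> = (\<integral>\<^sup>+x. (\<integral>\<^sup>+y. indicator A (y + x) * indicator B (-x) \<partial>M) \<partial>lborel)"
    by (rule Fubini') measurable
  also have "\<dots> = (\<integral>\<^sup>+x. (\<integral>\<^sup>+y. indicator A (x + y) * indicator B x \<partial>M) \<partial>lborel)"
    by (intro nn_integral_cong) (auto simp: indicator_def add.commute B_def)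
  also have "\<dots> = (\<integral>\<^sup>+x. (\<integral>\<^sup>+y. indicator A (x + y) \<partial>M) * indicator B x  \<partial>lborel)"
    by (intro nn_integral_cong nn_integral_multc) measurable
  also have "\<dots> = (\<integral>\<^sup>+x. (\<integral>\<^sup>+y. indicator A y \<partial>M) * indicator B x  \<partial>lborel)"
    by (simp only: tA)
  also have "\<dots> = emeasure M A * emeasure lborel B"
    by (simp add: nn_integral_cmult sets)
  finally have "emeasure lborel B * emeasure lborel A = emeasure lborel B * emeasure M A"
    by (simp add: norm[folded B_def] mult.commute)
  moreover have "emeasure lborel B \<noteq> 0" "emeasure lborel B \<noteq> \<infinity>"
    using unit_ball_vol_pos[of "real DIM('a)"] by (auto simp: emeasure_ball B_def simp del: unit_ball_vol_pos)
  ultimately show "emeasure M A = emeasure lborel A"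
    by (auto simp: ennreal_mult_cancel_left)
qed

section \<open>Reflections and polarization\<close>

definition reflection :: "'a::euclidean_space \<Rightarrow> real \<Rightarrow> 'a \<Rightarrow> 'a" where
  "reflection e t x = x + (2 * (t - x \<bullet> e)) *\<^sub>R e"

lemma continuous_reflection: "continuous_on S (reflection e t)"
  unfolding reflection_def by (intro continuous_intros)

lemma borel_measurable_reflection[measurable]: "reflection e t \<in> borel_measurable borel"
  by (intro borel_measurable_continuous_onI continuous_reflection)

lemma inner_reflection: "norm e = 1 \<Longrightarrow> reflection e t x \<bullet> e = 2 * t - x \<bullet> e"
  by (simp add: reflection_def inner_add_left dot_square_norm)

lemma reflection_involution[simp]: "norm e = 1 \<Longrightarrow> reflection e t (reflection e t x) = x"
  by (subst reflection_def, subst inner_reflection) (auto simp: reflection_def algebra_simps)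

lemma norm_reflection_diff:
  assumes "norm e = 1"
  shows "norm (reflection e t x - reflection e t y) = norm (x - y)"
proof -
  have e: "e \<bullet> e = 1" using assms by (simp add: dot_square_norm)
  have "reflection e t x - reflection e t y = (x - y) - (2 * ((x - y) \<bullet> e)) *\<^sub>R e"
    by (simp add: reflection_def algebra_simps inner_diff_left)
  moreover have "norm (z - (2 * (z \<bullet> e)) *\<^sub>R e) = norm z" for z
    unfolding norm_eq_sqrt_inner
    by (simp add: e inner_diff_left inner_diff_right inner_commute algebra_simps)
  ultimately show ?thesis by simp
qed

lemma norm_reflection_diff_swap:
  assumes "norm e = 1"
  shows "norm (reflection e t x - y) = norm (x - reflection e t y)"
  using norm_reflection_diff[OF assms, of t x "reflection e t y"] by (simp add: assms)

text \<open>The added product is nonnegative exactly when \<open>x\<close> and \<open>y\<close> lie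
  on a common closed side of the mirror. So reflecting one of two points moves them apart if they
  are on the same side and together if they are on opposite sides; every comparison under
  polarization rests on this sign.\<close>

lemma norm_diff_reflection_sq:
  assumes "norm e = 1"
  shows "norm (x - reflection e t y)^2 = norm (x - y)^2 + 4 * (t - x \<bullet> e) * (t - y \<bullet> e)"
proof -
  have e: "e \<bullet> e = 1" using assms by (simp add: dot_square_norm)
  show ?thesis
    unfolding power2_norm_eq_inner reflection_def
    by (simp add: e inner_add_left inner_add_right inner_diff_left inner_diff_right inner_commute algebra_simps)
qed

text \<open>The image measure is translation invariant because translating by \<open>c\<close> after
  reflecting is the same as reflecting after translating by \<open>reflection e 0 c\<close>, the
  image of \<open>c\<close> under the linear part. Balls go to balls of the same radius, which gives
  the normalization.\<close>

lemma lborel_distr_reflection: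
  assumes e: "norm e = 1"
  shows "distr lborel borel (reflection e t) = lborel"
proof (rule lborel_eqI_translation_invariant)
  let ?s = "reflection e t"
  have vim: "?s -` ball c r = ball (?s c) r" for c r
    by (auto simp: dist_norm norm_reflection_diff_swap[OF e, symmetric])
  have em: "emeasure (distr lborel borel ?s) (ball 0 r) = emeasure lborel (ball (?s 0) r)" for r
    by (subst emeasure_distr) (auto simp: vim)
  show "emeasure (distr lborel borel ?s) (ball 0 1) = emeasure lborel (ball (0::'a) 1)"
    unfolding em by (simp add: emeasure_ball)
  show "sigma_finite_measure (distr lborel borel ?s)"
  proof (unfold_locales, intro exI conjI ballI)
    show "countable (range (\<lambda>k::nat. ball (0::'a) (real k)))" by simp
    show "range (\<lambda>k::nat. ball (0::'a) (real k)) \<subseteq> sets (distr lborel borel ?s)" by auto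
    have "\<exists>k::nat. norm x < real k" for x :: 'a by (rule reals_Archimedean2)
    then show "\<Union> (range (\<lambda>k::nat. ball (0::'a) (real k))) = space (distr lborel borel ?s)" by auto
    fix a assume "a \<in> range (\<lambda>k::nat. ball (0::'a) (real k))"
    then show "emeasure (distr lborel borel ?s) a \<noteq> \<infinity>" using em by (auto simp: emeasure_ball)
  qed
  fix c
  define d where "d = reflection e 0 c"
  have d: "c + ?s x = ?s (d + x)" for x
    using e by (simp add: d_def reflection_def inner_add_left inner_diff_left dot_square_norm algebra_simps)
  have "distr (distr lborel borel ?s) borel ((+) c) = distr lborel borel (\<lambda>x. ?s (d + x))"
    by (subst distr_distr) (auto simp: comp_def d)
  also have "\<dots> = distr (distr lborel borel ((+) d)) borel ?s"
    by (subst distr_distr) (auto simp: comp_def)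
  finally show "distr (distr lborel borel ?s) borel ((+) c) = distr lborel borel ?s"
    by (simp add: lborel_distr_plus)
qed simp

lemma nn_integral_reflection:
  assumes "norm e = 1" and [measurable]: "f \<in> borel_measurable borel"
  shows "(\<integral>\<^sup>+x. f (reflection e t x) \<partial>lborel) = (\<integral>\<^sup>+x. f x \<partial>lborel)"
proof -
  have "(\<integral>\<^sup>+x. f x \<partial>lborel) = (\<integral>\<^sup>+x. f x \<partial>distr lborel borel (reflection e t))"
    by (simp add: lborel_distr_reflection assms)
  also have "\<dots> = (\<integral>\<^sup>+x. f (reflection e t x) \<partial>lborel)" by (subst nn_integral_distr) auto
  finally show ?thesis by simp
qed

lemma nn_integral_translation:
  assumes [measurable]: "f \<in> borel_measurable borel"
  shows "(\<integral>\<^sup>+x. f (c + x) \<partial>lborel) = (\<integral>\<^sup>+x. f x \<partial>(lborel :: 'a::euclidean_space measure))"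
proof -
  have "(\<integral>\<^sup>+x. f x \<partial>lborel) = (\<integral>\<^sup>+x. f x \<partial>distr lborel borel ((+) c))" by (simp add: lborel_distr_plus)
  also have "\<dots> = (\<integral>\<^sup>+x. f (c + x) \<partial>lborel)" by (subst nn_integral_distr) auto
  finally show ?thesis by simp
qed

text \<open>Integrals are compared pointwise after adding the reflected integrand, which avoids
  splitting the domain along the mirror.\<close>

lemma nn_integral_fold:
  assumes e: "norm e = 1" and [measurable]: "f \<in> borel_measurable borel"
  shows "2 * (\<integral>\<^sup>+x. f x \<partial>lborel) = (\<integral>\<^sup>+x. f x + f (reflection e t x) \<partial>lborel)"
  by (subst nn_integral_add) (simp_all add: nn_integral_reflection[OF e] mult_2)

lemma nn_integral_fold_le:
  assumes e: "norm e = 1" and [measurable]: "f \<in> borel_measurable borel" "g \<in> borel_measurable borel"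
    and le: "\<And>x. f x + f (reflection e t x) \<le> g x + g (reflection e t x)"
  shows "(\<integral>\<^sup>+x. f x \<partial>lborel) \<le> (\<integral>\<^sup>+x. g x \<partial>lborel)"
proof -
  have "2 * (\<integral>\<^sup>+x. f x \<partial>lborel) \<le> 2 * (\<integral>\<^sup>+x. g x \<partial>lborel)"
    unfolding nn_integral_fold[OF e assms(2), of t] nn_integral_fold[OF e assms(3), of t]
    by (intro nn_integral_mono le)
  then show ?thesis by (subst (asm) ennreal_mult_le_mult_iff) auto
qed

lemma nn_integral_fold_eq:
  assumes e: "norm e = 1" and [measurable]: "f \<in> borel_measurable borel" "g \<in> borel_measurable borel"
    and eq: "\<And>x. f x + f (reflection e t x) = g x + g (reflection e t x)"
  shows "(\<integral>\<^sup>+x. f x \<partial>lborel) = (\<integral>\<^sup>+x. g x \<partial>lborel)"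
  by (intro antisym nn_integral_fold_le[OF e, of _ _ t]) (auto simp: eq)

text \<open>Two-point symmetrization in the mirror \<open>x \<bullet> e = t\<close>. For
  \<open>t \<ge> 0\<close> the larger value goes to the half-space containing the origin, which is
  why \<open>t \<ge> 0\<close> is required when moments or supports are concerned.\<close>

definition polarize :: "'a::euclidean_space \<Rightarrow> real \<Rightarrow> ('a \<Rightarrow> real) \<Rightarrow> 'a \<Rightarrow> real" where
  "polarize e t u x = (if x \<bullet> e \<le> t then max (u x) (u (reflection e t x)) else min (u x) (u (reflection e t x)))"

lemma borel_measurable_polarize[measurable]:
  assumes [measurable]: "u \<in> borel_measurable borel"
  shows "polarize e t u \<in> borel_measurable borel"
  unfolding polarize_def[abs_def] by measurable

lemma polarize_cases:
  assumes e: "norm e = 1"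
  obtains "x \<bullet> e \<le> t" "polarize e t u x = max (u x) (u (reflection e t x))"
      "polarize e t u (reflection e t x) = min (u x) (u (reflection e t x))"
  | "x \<bullet> e > t" "polarize e t u x = min (u x) (u (reflection e t x))"
      "polarize e t u (reflection e t x) = max (u x) (u (reflection e t x))"
proof -
  consider "x \<bullet> e < t" | "x \<bullet> e = t" | "x \<bullet> e > t" by linarith
  then show ?thesis
  proof cases
    case 2
    then have "reflection e t x = x" by (simp add: reflection_def)
    then show ?thesis using that(1) 2 by (simp add: polarize_def)
  next
    case 1 then show ?thesis using that(1) by (simp add: polarize_def inner_reflection e min.commute)
  next
    case 3 then show ?thesis using that(2) by (simp add: polarize_def inner_reflection e max.commute)
  qed
qed

lemma nn_integral_polarize:
  assumes e: "norm e = 1" and [measurable]: "u \<in> borel_measurable borel" "\<phi> \<in> borel_measurable borel"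
  shows "(\<integral>\<^sup>+x. \<phi> (polarize e t u x) \<partial>lborel) = (\<integral>\<^sup>+x. \<phi> (u x) \<partial>lborel)"
proof (rule nn_integral_fold_eq[OF e])
  fix x
  show "\<phi> (polarize e t u x) + \<phi> (polarize e t u (reflection e t x)) = \<phi> (u x) + \<phi> (u (reflection e t x))"
    by (cases rule: polarize_cases[OF e, where u=u and x=x and t=t]) (auto simp: max_def min_def add.commute)
qed measurable

lemma emeasure_superlevel_polarize:
  assumes e: "norm e = 1" and [measurable]: "u \<in> borel_measurable borel"
  shows "emeasure lborel {x. h < polarize e t u x} = emeasure lborel {x. h < u x}"
proof -
  have "emeasure lborel {x. h < v x} = (\<integral>\<^sup>+x. indicator {h<..} (v x) \<partial>lborel)"
    if [measurable]: "v \<in> borel_measurable borel" for v :: "'a \<Rightarrow> real"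
  proof -
    have "(\<integral>\<^sup>+x. indicator {h<..} (v x) \<partial>lborel) = (\<integral>\<^sup>+x. indicator {x. h < v x} x \<partial>lborel)"
      by (intro nn_integral_cong) (auto simp: indicator_def)
    then show ?thesis by simp
  qed
  then show ?thesis using nn_integral_polarize[OF e assms(2), of "indicator {h<..}" t] by simp
qed

definition interaction :: "(real \<Rightarrow> ennreal) \<Rightarrow> ('a::euclidean_space \<Rightarrow> real) \<Rightarrow> ennreal" where
  "interaction k u = (\<integral>\<^sup>+x. \<integral>\<^sup>+y. ennreal (u x * u y) * k (norm (x - y)) \<partial>lborel \<partial>lborel)"

lemma two_weights_le:
  fixes K1 K2 :: ennreal
  assumes "K2 \<le> K1" "0 \<le> s1" "0 \<le> s2'" "s1 \<le> s1'" "s1 + s2 = s1' + s2'"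
  shows "ennreal s1 * K1 + ennreal s2 * K2 \<le> ennreal s1' * K1 + ennreal s2' * K2"
proof -
  define d where "d = s1' - s1"
  have d: "0 \<le> d" "s1' = s1 + d" "s2 = s2' + d" using assms by (auto simp: d_def)
  have "ennreal s1 * K1 + ennreal s2 * K2 = ennreal s1 * K1 + ennreal s2' * K2 + ennreal d * K2"
    using assms d by (simp add: ennreal_plus distrib_right add.assoc)
  also have "\<dots> \<le> ennreal s1 * K1 + ennreal s2' * K2 + ennreal d * K1"
    using assms(1) by (intro add_left_mono mult_left_mono) auto
  also have "\<dots> = ennreal s1' * K1 + ennreal s2' * K2"
    using assms d by (simp add: ennreal_plus distrib_left distrib_right ac_simps)
  finally show ?thesis .
qed

text \<open>Sorting both pairs keeps the total weight \<open>(a + a') * (b + b')\<close> and, by the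
  rearrangement inequality for two numbers, increases the part that multiplies the larger value
  \<open>K1\<close>. The kernel values may be infinite, so a finite amount of weight is moved and
  nothing is subtracted from them.\<close>

lemma four_point_le:
  fixes K1 K2 :: ennreal
  assumes "K2 \<le> K1" and nn: "0 \<le> a" "0 \<le> a'" "0 \<le> b" "0 \<le> b'"
  shows "ennreal (a * b + a' * b') * K1 + ennreal (a' * b + a * b') * K2
    \<le> ennreal (max a a' * max b b' + min a a' * min b b') * K1 + ennreal (min a a' * max b b' + max a a' * min b b') * K2"
proof (rule two_weights_le[OF assms(1)])
  have *: "a * b + a' * b' \<ge> a' * b + a * b'" if "a' \<le> a" "b' \<le> b" for a a' b b' :: real
    using mult_nonneg_nonneg[of "a - a'" "b - b'"] that by (simp add: algebra_simps)
  show "a * b + a' * b' \<le> max a a' * max b b' + min a a' * min b b'"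
    using *[of a' a b' b] *[of a a' b' b] *[of a' a b b'] *[of a a' b b']
    by (auto simp: max_def min_def)
qed (use nn in \<open>auto simp: max_def min_def algebra_simps\<close>)

text \<open>Folding in both variables reduces the claim to the four pairs formed by
  \<open>x\<close>, \<open>y\<close> and their mirror images, on which only two kernel values occur.
  On the same side the unreflected distance is the shorter one and \<open>four_point_le\<close>
  applies; on opposite sides the two values exchange roles, which amounts to exchanging
  \<open>u x\<close> and \<open>u (reflection e t x)\<close>.\<close>

lemma interaction_polarize_le:
  assumes e: "norm e = 1" and [measurable]: "u \<in> borel_measurable borel" "k \<in> borel_measurable borel"
    and k: "antimono k" and u: "\<And>x. 0 \<le> u x"
  shows "interaction k u \<le> interaction k (polarize e t u)"
proof -
  let ?s = "reflection e t" and ?p = "polarize e t u"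
  define F where "F v x y = ennreal (v x * v y) * k (norm (x - y))" for v :: "'a \<Rightarrow> real" and x y
  have [measurable]: "(\<lambda>(x,y). F v x y) \<in> borel_measurable (borel \<Otimes>\<^sub>M borel)"
    if [measurable]: "v \<in> borel_measurable borel" for v
    unfolding F_def by measurable
  have p: "0 \<le> ?p x" for x using u by (auto simp: polarize_def min_def max_def)
  have sum4: "F v x y + F v (?s x) y + (F v x (?s y) + F v (?s x) (?s y))
     = ennreal (v x * v y + v (?s x) * v (?s y)) * k (norm (x - y))
     + ennreal (v (?s x) * v y + v x * v (?s y)) * k (norm (x - ?s y))"
    if v: "\<And>x. 0 \<le> v x" for v x y
  proof -
    have 1: "norm (?s x - ?s y) = norm (x - y)" by (rule norm_reflection_diff[OF e])
    have 2: "norm (?s x - y) = norm (x - ?s y)" by (rule norm_reflection_diff_swap[OF e])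
    show ?thesis
      unfolding F_def 1 2 by (simp add: v distrib_left distrib_right ac_simps)
  qed
  have pt: "F u x y + F u (?s x) y + (F u x (?s y) + F u (?s x) (?s y))
     \<le> F ?p x y + F ?p (?s x) y + (F ?p x (?s y) + F ?p (?s x) (?s y))" for x y
  proof -
    let ?a = "u x" and ?a' = "u (?s x)" and ?b = "u y" and ?b' = "u (?s y)"
    let ?K1 = "k (norm (x - y))" and ?K2 = "k (norm (x - ?s y))"
    have sq: "norm (x - ?s y)^2 = norm (x - y)^2 + 4 * ((t - x \<bullet> e) * (t - y \<bullet> e))"
      using norm_diff_reflection_sq[OF e, of x t y] by simp
    have same: "?K2 \<le> ?K1" if "(t - x \<bullet> e) * (t - y \<bullet> e) \<ge> 0"
      by (rule antimonoD[OF k], rule power2_le_imp_le) (use sq that in auto)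
    have opp: "?K1 \<le> ?K2" if "(t - x \<bullet> e) * (t - y \<bullet> e) \<le> 0"
      by (rule antimonoD[OF k], rule power2_le_imp_le) (use sq that in auto)
    note f = four_point_le[OF _ u[of x] u[of "?s x"] u[of y] u[of "?s y"]]
    note f' = four_point_le[OF _ u[of "?s x"] u[of "x"] u[of y] u[of "?s y"]]
    show ?thesis
      unfolding sum4[OF u] sum4[OF p]
    proof (cases rule: polarize_cases[OF e, where u=u and x=x and t=t]; cases rule: polarize_cases[OF e, where u=u and x=y and t=t])
      assume 1: "x \<bullet> e \<le> t" "?p x = max ?a ?a'" "?p (?s x) = min ?a ?a'"
        "y \<bullet> e \<le> t" "?p y = max ?b ?b'" "?p (?s y) = min ?b ?b'"
      then have "?K2 \<le> ?K1" by (intro same mult_nonneg_nonneg) auto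
      from f[OF this] show "ennreal (?a * ?b + ?a' * ?b') * ?K1 + ennreal (?a' * ?b + ?a * ?b') * ?K2
        \<le> ennreal (?p x * ?p y + ?p (?s x) * ?p (?s y)) * ?K1 + ennreal (?p (?s x) * ?p y + ?p x * ?p (?s y)) * ?K2"
        unfolding 1 by (simp add: ac_simps)
    next
      assume 1: "x \<bullet> e > t" "?p x = min ?a ?a'" "?p (?s x) = max ?a ?a'"
        "y \<bullet> e > t" "?p y = min ?b ?b'" "?p (?s y) = max ?b ?b'"
      then have "?K2 \<le> ?K1" by (intro same mult_nonpos_nonpos) auto
      from f[OF this] show "ennreal (?a * ?b + ?a' * ?b') * ?K1 + ennreal (?a' * ?b + ?a * ?b') * ?K2
        \<le> ennreal (?p x * ?p y + ?p (?s x) * ?p (?s y)) * ?K1 + ennreal (?p (?s x) * ?p y + ?p x * ?p (?s y)) * ?K2"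
        unfolding 1 by (simp add: ac_simps)
    next
      assume 1: "x \<bullet> e \<le> t" "?p x = max ?a ?a'" "?p (?s x) = min ?a ?a'"
        "y \<bullet> e > t" "?p y = min ?b ?b'" "?p (?s y) = max ?b ?b'"
      then have "?K1 \<le> ?K2" by (intro opp mult_nonneg_nonpos) auto
      from f'[OF this] show "ennreal (?a * ?b + ?a' * ?b') * ?K1 + ennreal (?a' * ?b + ?a * ?b') * ?K2
        \<le> ennreal (?p x * ?p y + ?p (?s x) * ?p (?s y)) * ?K1 + ennreal (?p (?s x) * ?p y + ?p x * ?p (?s y)) * ?K2"
        unfolding 1 by (simp add: ac_simps max.commute min.commute)
    next
      assume 1: "x \<bullet> e > t" "?p x = min ?a ?a'" "?p (?s x) = max ?a ?a'"
        "y \<bullet> e \<le> t" "?p y = max ?b ?b'" "?p (?s y) = min ?b ?b'"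
      then have "?K1 \<le> ?K2" by (intro opp mult_nonpos_nonneg) auto
      from f'[OF this] show "ennreal (?a * ?b + ?a' * ?b') * ?K1 + ennreal (?a' * ?b + ?a * ?b') * ?K2
        \<le> ennreal (?p x * ?p y + ?p (?s x) * ?p (?s y)) * ?K1 + ennreal (?p (?s x) * ?p y + ?p x * ?p (?s y)) * ?K2"
        unfolding 1 by (simp add: ac_simps max.commute min.commute)
    qed
  qed
  have add: "(\<integral>\<^sup>+y. F v x y \<partial>lborel) + (\<integral>\<^sup>+y. F v x' y \<partial>lborel) = (\<integral>\<^sup>+y. F v x y + F v x' y \<partial>lborel)"
    if [measurable]: "v \<in> borel_measurable borel" for v x x'
    by (rule nn_integral_add[symmetric]) measurable
  show ?thesis
    unfolding interaction_def F_def[symmetric]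
  proof (rule nn_integral_fold_le[OF e, where t=t])
    fix x
    show "(\<integral>\<^sup>+y. F u x y \<partial>lborel) + (\<integral>\<^sup>+y. F u (?s x) y \<partial>lborel)
      \<le> (\<integral>\<^sup>+y. F ?p x y \<partial>lborel) + (\<integral>\<^sup>+y. F ?p (?s x) y \<partial>lborel)"
      unfolding add[OF assms(2)] add[OF borel_measurable_polarize[OF assms(2)]]
      by (rule nn_integral_fold_le[OF e, where t=t]) (measurable, rule pt)
  qed measurable
qed

definition lipschitz_const :: "real \<Rightarrow> ('a::real_normed_vector \<Rightarrow> real) \<Rightarrow> bool" where
  "lipschitz_const L u \<longleftrightarrow> (\<forall>x y. \<bar>u x - u y\<bar> \<le> L * norm (x - y))"

text \<open>On one side of the mirror \<open>max\<close> and \<open>min\<close> inherit the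
  constant. On opposite sides the reflected distance is the shorter one, so each difference between
  a value at \<open>x\<close> or its image and a value at \<open>y\<close> or its image is bounded
  by \<open>L * norm (x - y)\<close>.\<close>

lemma lipschitz_const_polarize:
  assumes e: "norm e = 1" and u: "lipschitz_const L u" and L: "0 \<le> L"
  shows "lipschitz_const L (polarize e t u)"
  unfolding lipschitz_const_def
proof (intro allI)
  fix x y
  let ?s = "reflection e t" and ?p = "polarize e t u"
  let ?a = "u x" and ?a' = "u (?s x)" and ?b = "u y" and ?b' = "u (?s y)"
  let ?d = "L * norm (x - y)" and ?d' = "L * norm (x - ?s y)"
  have le: "\<bar>u x - u y\<bar> \<le> L * norm (x - y)" for x y using u by (simp add: lipschitz_const_def)
  have D: "\<bar>?a - ?b\<bar> \<le> ?d" "\<bar>?a' - ?b'\<bar> \<le> ?d" "\<bar>?a - ?b'\<bar> \<le> ?d'" "\<bar>?a' - ?b\<bar> \<le> ?d'"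
    using le[of x y] le[of "?s x" "?s y"] le[of x "?s y"] le[of "?s x" y]
    by (simp_all only: norm_reflection_diff[OF e] norm_reflection_diff_swap[OF e, of t x y])
  have opp: "?d' \<le> ?d" if "(t - x \<bullet> e) * (t - y \<bullet> e) \<le> 0"
  proof (intro mult_left_mono L, rule power2_le_imp_le)
    show "norm (x - ?s y)^2 \<le> norm (x - y)^2"
      using norm_diff_reflection_sq[OF e, of x t y] that unfolding mult.assoc by linarith
  qed simp
  consider "x \<bullet> e \<le> t" "y \<bullet> e \<le> t" | "x \<bullet> e > t" "y \<bullet> e > t" | "x \<bullet> e \<le> t" "y \<bullet> e > t" | "x \<bullet> e > t" "y \<bullet> e \<le> t"
    by linarith
  then show "\<bar>?p x - ?p y\<bar> \<le> ?d"
  proof cases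
    case 3
    then have "?d' \<le> ?d" by (intro opp mult_nonneg_nonpos) auto
    with 3 D show ?thesis by (simp add: polarize_def max_def min_def split: if_splits; linarith)
  next
    case 4
    then have "?d' \<le> ?d" by (intro opp mult_nonpos_nonneg) auto
    with 4 D show ?thesis by (simp add: polarize_def max_def min_def split: if_splits; linarith)
  next
    case 1
    with D show ?thesis by (simp add: polarize_def max_def min_def split: if_splits; linarith)
  next
    case 2
    with D show ?thesis by (simp add: polarize_def max_def min_def split: if_splits; linarith)
  qed
qed

lemma norm_reflection_sq: "norm e = 1 \<Longrightarrow> norm (reflection e t x)^2 = norm x^2 + 4 * t * (t - x \<bullet> e)"
  using norm_diff_reflection_sq[of e 0 t x] by simp

text \<open>On each mirror pair the excess of the far value over the near one is moved to the near
  point, and \<open>4 * t * (t - x \<bullet> e)\<close> is the difference of the two squared norms.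
  The identity is written as a sum because the moments may be infinite.\<close>

lemma second_moment_polarize:
  assumes e: "norm e = 1" and [measurable]: "u \<in> borel_measurable borel"
    and u: "\<And>x. 0 \<le> u x" and t: "0 \<le> t"
  shows "(\<integral>\<^sup>+x. ennreal (norm x^2 * polarize e t u x) \<partial>lborel)
     + (\<integral>\<^sup>+x. ennreal (if x \<bullet> e \<le> t then 4 * t * (t - x \<bullet> e) * max 0 (u (reflection e t x) - u x) else 0) \<partial>lborel)
     = (\<integral>\<^sup>+x. ennreal (norm x^2 * u x) \<partial>lborel)" (is "?A + ?B = ?C")
proof -
  let ?s = "reflection e t" and ?p = "polarize e t u"
  define g where "g x = (if x \<bullet> e \<le> t then 4 * t * (t - x \<bullet> e) * max 0 (u (?s x) - u x) else 0)" for x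
  have [measurable]: "g \<in> borel_measurable borel" unfolding g_def[abs_def] by measurable
  have g: "0 \<le> g x" for x using t by (auto simp: g_def)
  have p: "0 \<le> ?p x" for x using u by (auto simp: polarize_def min_def max_def)
  have "?A + (\<integral>\<^sup>+x. ennreal (g x) \<partial>lborel) = (\<integral>\<^sup>+x. ennreal (norm x^2 * ?p x + g x) \<partial>lborel)"
    by (subst nn_integral_add[symmetric]) (auto simp: p g)
  also have "\<dots> = ?C"
  proof (rule nn_integral_fold_eq[OF e, where t=t])
    fix x
    have "norm x^2 * ?p x + g x + (norm (?s x)^2 * ?p (?s x) + g (?s x)) = norm x^2 * u x + norm (?s x)^2 * u (?s x)"
    proof (cases rule: polarize_cases[OF e, where u=u and x=x and t=t])
      case 1
      show ?thesis
      proof (cases "x \<bullet> e = t")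
        case True
        then have "?s x = x" by (simp add: reflection_def)
        then show ?thesis using 1 True by (simp add: g_def)
      next
        case False
        then have "g (?s x) = 0" using 1 by (simp add: g_def inner_reflection e)
        then show ?thesis using 1
          by (auto simp: g_def norm_reflection_sq[OF e] max_def min_def algebra_simps)
      qed
    next
      case 2
      then show ?thesis
        by (auto simp: g_def norm_reflection_sq[OF e] inner_reflection e max_def min_def algebra_simps)
    qed
    then show "ennreal (norm x^2 * ?p x + g x) + ennreal (norm (?s x)^2 * ?p (?s x) + g (?s x))
      = ennreal (norm x^2 * u x) + ennreal (norm (?s x)^2 * u (?s x))"
      by (subst (1 2) ennreal_plus[symmetric]) (auto simp: p g u)
  qed measurable
  finally show ?thesis by (simp add: g_def)
qed

section \<open>The rearrangement as a superposition of balls\<close>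

text \<open>Volume of the centred ball with \<open>x\<close> on its boundary. Membership in a
  symmetrized set becomes a comparison of volumes, which is jointly measurable in point and
  level.\<close>

definition ball_volume :: "'a::euclidean_space \<Rightarrow> real" where
  "ball_volume x = unit_ball_vol DIM('a) * norm x ^ DIM('a)"

lemma unit_ball_vol_DIM_pos[simp]: "0 < unit_ball_vol DIM('a::euclidean_space)"
  by (rule unit_ball_vol_pos) simp

lemma unit_ball_vol_DIM_neq_0[simp]: "unit_ball_vol DIM('a::euclidean_space) \<noteq> 0"
  using unit_ball_vol_DIM_pos[where 'a='a] by linarith

lemma borel_measurable_ball_volume[measurable]: "ball_volume \<in> borel_measurable borel"
  unfolding ball_volume_def[abs_def] by measurable

lemma ball_volume_nonneg[simp]: "0 \<le> ball_volume (x::'a::euclidean_space)"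
  unfolding ball_volume_def using unit_ball_vol_DIM_pos[where 'a='a]
  by (intro mult_nonneg_nonneg) auto

definition radius_of_volume :: "'a::euclidean_space itself \<Rightarrow> real \<Rightarrow> real" where
  "radius_of_volume _ a = root DIM('a) (a / unit_ball_vol DIM('a))"

lemma radius_of_volume:
  assumes "0 \<le> a"
  shows "0 \<le> radius_of_volume TYPE('a::euclidean_space) a"
    "unit_ball_vol DIM('a) * radius_of_volume TYPE('a) a ^ DIM('a) = a"
proof -
  have "0 \<le> a / unit_ball_vol DIM('a)" using assms unit_ball_vol_DIM_pos[where 'a='a] by (intro divide_nonneg_pos)
  then show "0 \<le> radius_of_volume TYPE('a) a"
    "unit_ball_vol DIM('a) * radius_of_volume TYPE('a) a ^ DIM('a) = a"
    unfolding radius_of_volume_def by (simp_all add: real_root_pow_pos2)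
qed

lemma ball_volume_less_iff:
  fixes x :: "'a::euclidean_space"
  assumes "0 \<le> a"
  shows "ball_volume x < a \<longleftrightarrow> norm x < radius_of_volume TYPE('a) a"
proof -
  let ?r = "radius_of_volume TYPE('a) a"
  have "ball_volume x < a \<longleftrightarrow> norm x ^ DIM('a) < ?r ^ DIM('a)"
    using mult_less_cancel_left_pos[OF unit_ball_vol_DIM_pos[where 'a='a], of "norm x ^ DIM('a)" "?r ^ DIM('a)"]
    unfolding ball_volume_def radius_of_volume(2)[OF assms, where 'a='a] .
  also have "\<dots> \<longleftrightarrow> norm x < ?r"
    using power_mono_iff[OF radius_of_volume(1)[OF assms, where 'a='a] norm_ge_zero[of x] DIM_positive[where 'a='a]]
    by (simp add: not_le[symmetric])
  finally show ?thesis .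
qed

lemma ball_volume_sublevel:
  assumes "0 \<le> a"
  shows "{x. ball_volume x < a} = ball (0::'a::euclidean_space) (radius_of_volume TYPE('a) a)"
  by (simp add: set_eq_iff ball_volume_less_iff[OF assms])

lemma emeasure_ball_radius_of_volume:
  assumes "0 \<le> a"
  shows "emeasure lborel (ball (c::'a::euclidean_space) (radius_of_volume TYPE('a) a)) = ennreal a"
  by (subst emeasure_ball) (simp_all add: radius_of_volume[OF assms, where 'a='a])

lemma emeasure_ball_volume_sublevel:
  assumes "0 \<le> a"
  shows "emeasure lborel {x::'a::euclidean_space. ball_volume x < a} = ennreal a"
  by (simp add: ball_volume_sublevel[OF assms] emeasure_ball_radius_of_volume[OF assms])

text \<open>The volume of a ball is strictly increasing in the radius, so the definite description
  in \<open>symm_ball\<close> denotes a unique radius as soon as the volume is finite.\<close>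

lemma mem_symm_ball_iff:
  fixes D :: "'a::euclidean_space set"
  assumes "emeasure lebesgue D = ennreal a" "0 \<le> a"
  shows "x \<in> symm_ball D \<longleftrightarrow> ball_volume x < a"
proof -
  let ?r = "radius_of_volume TYPE('a) a"
  have lb: "emeasure lebesgue (ball (0::'a) r) = emeasure lborel (ball (0::'a) r)" for r
    by simp
  have "(THE r. 0 \<le> r \<and> emeasure lebesgue (ball (0::'a) r) = emeasure lebesgue D) = ?r"
  proof (rule the_equality)
    show "0 \<le> ?r \<and> emeasure lebesgue (ball (0::'a) ?r) = emeasure lebesgue D"
      using radius_of_volume(1)[OF assms(2), where 'a='a] emeasure_ball_radius_of_volume[OF assms(2), of "0::'a"]
      unfolding assms(1) lb by blast
    fix r assume r: "0 \<le> r \<and> emeasure lebesgue (ball (0::'a) r) = emeasure lebesgue D"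
    then have "ennreal (unit_ball_vol DIM('a) * r ^ DIM('a)) = ennreal a"
      using emeasure_ball[of r "0::'a"] unfolding assms(1) lb by simp
    then have "unit_ball_vol DIM('a) * r ^ DIM('a) = a"
      using assms r unit_ball_vol_DIM_pos[where 'a='a] by (subst (asm) ennreal_inj) (auto intro!: mult_nonneg_nonneg)
    then have "unit_ball_vol DIM('a) * r ^ DIM('a) = unit_ball_vol DIM('a) * ?r ^ DIM('a)"
      by (simp only: radius_of_volume(2)[OF assms(2), where 'a='a])
    then have "r ^ DIM('a) = ?r ^ DIM('a)" by simp
    then show "r = ?r" using r radius_of_volume(1)[OF assms(2), where 'a='a] by (metis DIM_positive power_eq_imp_eq_base)
  qed
  then show ?thesis by (simp add: symm_ball_def ball_volume_less_iff[OF assms(2)])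
qed

definition bounded_density :: "real \<Rightarrow> ('a::euclidean_space \<Rightarrow> real) \<Rightarrow> bool" where
  "bounded_density A f \<longleftrightarrow> f \<in> borel_measurable borel \<and> integrable lborel f \<and> (\<forall>x. 0 \<le> f x \<and> f x \<le> A)"

lemma bounded_densityD:
  assumes "bounded_density A f"
  shows "f \<in> borel_measurable borel" "integrable lborel f" "0 \<le> f x" "f x \<le> A" "0 \<le> A"
proof -
  show "f \<in> borel_measurable borel" "integrable lborel f" and *: "0 \<le> f x" "f x \<le> A" for x
    using assms by (auto simp: bounded_density_def)
  show "0 \<le> A" using *[of undefined] by linarith
qed

definition superlevel :: "('a::euclidean_space \<Rightarrow> real) \<Rightarrow> real \<Rightarrow> real" where
  "superlevel f h = measure lborel {x. h < f x}"

lemma superlevel_nonneg[simp]: "0 \<le> superlevel f h" by (simp add: superlevel_def)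

lemma emeasure_superlevel:
  assumes f: "bounded_density A f" and h: "0 < h"
  shows "emeasure lborel {x. h < f x} = ennreal (superlevel f h)"
proof -
  note [measurable] = bounded_densityD(1)[OF f]
  have "emeasure lborel {x. h < f x} \<le> emeasure lborel {x\<in>UNIV. 1 \<le> ennreal (1/h) * ennreal (f x)}"
  proof (rule emeasure_mono)
    show "{x. h < f x} \<subseteq> {x \<in> UNIV. 1 \<le> ennreal (1 / h) * ennreal (f x)}"
    proof
      fix x assume "x \<in> {x. h < f x}"
      then have "1 \<le> 1 / h * f x" using h by (simp add: field_simps)
      then have "1 \<le> ennreal (1 / h * f x)" by simp
      also have "\<dots> = ennreal (1 / h) * ennreal (f x)" using h bounded_densityD(3)[OF f] by (intro ennreal_mult) auto
      finally show "x \<in> {x \<in> UNIV. 1 \<le> ennreal (1 / h) * ennreal (f x)}" by simp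
    qed
  qed measurable
  also have "\<dots> \<le> ennreal (1/h) * (\<integral>\<^sup>+x. ennreal (f x) * indicator UNIV x \<partial>lborel)"
    using nn_integral_Markov_inequality[of "\<lambda>x. ennreal (f x)" UNIV lborel "ennreal (1/h)"] by simp
  also have "\<dots> < \<infinity>"
    using bounded_densityD(2,3)[OF f] by (simp add: nn_integral_eq_integral ennreal_mult_less_top)
  finally show ?thesis by (simp add: superlevel_def emeasure_eq_ennreal_measure less_top)
qed

lemma borel_measurable_superlevel:
  assumes [measurable]: "f \<in> borel_measurable borel"
  shows "superlevel f \<in> borel_measurable borel"
proof -
  have "superlevel f h = enn2real (\<integral>\<^sup>+x. indicator {p. fst p < f (snd p)} (h, x) \<partial>lborel)" for h
  proof -
    have "(\<integral>\<^sup>+x. indicator {p. fst p < f (snd p)} (h, x) \<partial>lborel) = (\<integral>\<^sup>+x. indicator {x. h < f x} x \<partial>lborel)"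
      by (intro nn_integral_cong) (auto simp: indicator_def)
    then show ?thesis by (simp add: superlevel_def measure_def)
  qed
  moreover have "(\<lambda>h. enn2real (\<integral>\<^sup>+x. indicator {p. fst p < f (snd p)} (h, x) \<partial>lborel)) \<in> borel_measurable borel"
    by measurable
  ultimately show ?thesis by (simp cong: measurable_cong)
qed

lemma superlevel_eq_0: "bounded_density A f \<Longrightarrow> A \<le> h \<Longrightarrow> superlevel f h = 0"
proof -
  assume "bounded_density A f" "A \<le> h"
  then have "{x. h < f x} = {}" using bounded_densityD(4)[of A f] by (auto simp: not_less intro: order_trans)
  then show ?thesis by (simp add: superlevel_def)
qed

text \<open>The slice over \<open>x\<close> of the set of pairs whose slices over \<open>h\<close>
  are the symmetrized superlevel sets. The rearrangement is the length of this slice, so Fubini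
  moves between points and levels.\<close>

definition star_levels :: "('a::euclidean_space \<Rightarrow> real) \<Rightarrow> 'a \<Rightarrow> real set" where
  "star_levels f x = {h. 0 < h \<and> ball_volume x < superlevel f h}"

lemma sets_star_levels[measurable]:
  "f \<in> borel_measurable borel \<Longrightarrow> star_levels f x \<in> sets borel"
  using borel_measurable_superlevel[of f] unfolding star_levels_def by measurable

lemma star_levels_subset: "bounded_density A f \<Longrightarrow> star_levels f x \<subseteq> {0..A}"
proof
  fix h assume f: "bounded_density A f" and "h \<in> star_levels f x"
  then have h: "0 < h" "ball_volume x < superlevel f h" by (auto simp: star_levels_def)
  have "\<not> A \<le> h" using superlevel_eq_0[OF f, of h] h ball_volume_nonneg[of x] by linarith
  then show "h \<in> {0..A}" using h by auto
qed

lemma emeasure_star_levels_finite: "bounded_density A f \<Longrightarrow> emeasure lborel (star_levels f x) < \<infinity>"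
proof -
  assume f: "bounded_density A f"
  have "emeasure lborel (star_levels f x) \<le> emeasure lborel {0..A}"
    by (rule emeasure_mono[OF star_levels_subset[OF f]]) simp
  also have "\<dots> < \<infinity>" using bounded_densityD(5)[OF f] by simp
  finally show ?thesis .
qed

lemma rearrangement_eq_measure:
  assumes f: "bounded_density A f"
  shows "rearrangement f x = measure lborel (star_levels f x)"
proof -
  have "indicator {0<..} h *\<^sub>R indicator (symm_ball {y. h < f y}) x = (indicator (star_levels f x) h :: real)" for h
  proof (cases "0 < h")
    case True
    have "{y. h < f y} \<in> sets borel" using bounded_densityD(1)[OF f] by measurable
    then have "emeasure lebesgue {y. h < f y} = ennreal (superlevel f h)"
      using emeasure_superlevel[OF f True] by simp
    then show ?thesis using True
      by (auto simp: indicator_def star_levels_def mem_symm_ball_iff[OF _ superlevel_nonneg])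
  qed (auto simp: star_levels_def)
  then show ?thesis
    by (simp add: rearrangement_def set_lebesgue_integral_def sets_star_levels[OF bounded_densityD(1)[OF f]])
qed

lemma ennreal_rearrangement:
  assumes f: "bounded_density A f"
  shows "ennreal (rearrangement f x) = (\<integral>\<^sup>+h. indicator (star_levels f x) h \<partial>lborel)"
  using emeasure_star_levels_finite[OF f, of x] sets_star_levels[OF bounded_densityD(1)[OF f], of x]
  by (simp add: rearrangement_eq_measure[OF f] emeasure_eq_ennreal_measure less_top)

lemma star_levels_measurable2[measurable]:
  assumes [measurable]: "f \<in> borel_measurable borel"
  shows "(\<lambda>p. indicator (star_levels f (fst p)) (snd p) :: 'b::{zero_neq_one,topological_space}) \<in> borel_measurable (borel \<Otimes>\<^sub>M borel)"
proof -
  note [measurable] = borel_measurable_superlevel[OF assms]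
  have "Measurable.pred (borel \<Otimes>\<^sub>M borel) (\<lambda>p. 0 < snd p \<and> ball_volume (fst p :: 'a) < superlevel f (snd p))"
    by measurable
  then have "{p. 0 < snd p \<and> ball_volume (fst p :: 'a) < superlevel f (snd p)} \<in> sets (borel \<Otimes>\<^sub>M borel)"
    by (simp add: pred_def space_pair_measure)
  then have "(indicator {p. 0 < snd p \<and> ball_volume (fst p :: 'a) < superlevel f (snd p)} :: _ \<Rightarrow> 'b) \<in> borel_measurable (borel \<Otimes>\<^sub>M borel)"
    by (rule borel_measurable_indicator)
  then show ?thesis by (simp add: star_levels_def indicator_def cong: measurable_cong)
qed

lemma borel_measurable_rearrangement:
  assumes f: "bounded_density A f"
  shows "rearrangement f \<in> borel_measurable borel"
proof -
  note [measurable] = bounded_densityD(1)[OF f]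
  have "rearrangement f x = enn2real (\<integral>\<^sup>+h. indicator (star_levels f (fst (x, h))) (snd (x, h)) \<partial>lborel)" for x
    using ennreal_rearrangement[OF f, of x] by (simp add: rearrangement_eq_measure[OF f] measure_def)
  moreover have "(\<lambda>x. enn2real (\<integral>\<^sup>+h. indicator (star_levels f (fst (x, h))) (snd (x, h)) \<partial>lborel)) \<in> borel_measurable borel"
    using star_levels_measurable2[of f, where 'b=ennreal] by measurable
  ultimately show ?thesis by (simp cong: measurable_cong)
qed

lemma rearrangement_nonneg: "bounded_density A f \<Longrightarrow> 0 \<le> rearrangement f x"
  by (simp add: rearrangement_eq_measure)

lemma rearrangement_le:
  assumes f: "bounded_density A f" shows "rearrangement f x \<le> A"
proof -
  have "measure lborel (star_levels f x) \<le> measure lborel {0..A}"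
    by (rule measure_mono_fmeasurable[OF star_levels_subset[OF f]])
      (use sets_star_levels[OF bounded_densityD(1)[OF f]] in \<open>auto simp: fmeasurable_def emeasure_lborel_Icc_eq\<close>)
  then show ?thesis using bounded_densityD(5)[OF f] by (simp add: rearrangement_eq_measure[OF f])
qed

lemma rearrangement_cong:
  assumes "\<And>h. 0 < h \<Longrightarrow> emeasure lebesgue {x. h < f x} = emeasure lebesgue {x. h < g x}"
  shows "rearrangement f = rearrangement g"
  unfolding rearrangement_def symm_ball_def set_lebesgue_integral_def
  by (intro ext Bochner_Integration.integral_cong) (auto simp: indicator_def assms)

lemma rearrangement_ge:
  assumes f: "bounded_density A f" and h: "\<And>h. 0 < h \<Longrightarrow> h < c \<Longrightarrow> ball_volume x < superlevel f h"
  shows "c \<le> rearrangement f x"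
proof (cases "0 \<le> c")
  case True
  have "measure lborel {0<..<c} \<le> measure lborel (star_levels f x)"
  proof (rule measure_mono_fmeasurable)
    show "{0<..<c} \<subseteq> star_levels f x" using h by (auto simp: star_levels_def)
  qed (use sets_star_levels[OF bounded_densityD(1)[OF f]] emeasure_star_levels_finite[OF f] in \<open>auto simp: fmeasurable_def\<close>)
  then show ?thesis using True by (simp add: rearrangement_eq_measure[OF f])
qed (use rearrangement_nonneg[OF f, of x] in linarith)

lemma nn_integral_layer_cake_diff:
  assumes "0 \<le> (a::real)" "0 \<le> b"
  shows "(\<integral>\<^sup>+h. ennreal \<bar>indicator {0<..<a} h - indicator {0<..<b} h\<bar> \<partial>lborel) = ennreal \<bar>a - b\<bar>"
proof -
  have *: "(\<integral>\<^sup>+h. ennreal \<bar>indicator {0<..<a} h - indicator {0<..<b} h\<bar> \<partial>lborel) = ennreal (b - a)"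
    "(\<integral>\<^sup>+h. ennreal \<bar>indicator {0<..<b} h - indicator {0<..<a} h\<bar> \<partial>lborel) = ennreal (b - a)"
    if "0 \<le> a" "a \<le> b" for a b :: real
  proof -
    have "(\<integral>\<^sup>+h. ennreal \<bar>indicator {0<..<a} h - indicator {0<..<b} h\<bar> \<partial>lborel) = (\<integral>\<^sup>+h. indicator {a..<b} h \<partial>lborel)"
    proof (rule nn_integral_cong_AE)
      \<comment> \<open>For \<open>a = 0\<close> the set \<open>{a..<b}\<close> may contain 0, which
        lies in neither open interval; hence equality holds only almost everywhere.\<close>
      have "AE h in lborel. h \<noteq> 0" by (rule AE_lborel_singleton)
      then show "AE h in lborel. ennreal \<bar>indicator {0<..<a} h - indicator {0<..<b} h\<bar> = indicator {a..<b} h"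
        by eventually_elim (use that in \<open>auto simp: indicator_def\<close>)
    qed
    then show "(\<integral>\<^sup>+h. ennreal \<bar>indicator {0<..<a} h - indicator {0<..<b} h\<bar> \<partial>lborel) = ennreal (b - a)" using that by simp
    then show "(\<integral>\<^sup>+h. ennreal \<bar>indicator {0<..<b} h - indicator {0<..<a} h\<bar> \<partial>lborel) = ennreal (b - a)"
      by (simp add: abs_minus_commute)
  qed
  show ?thesis using *(1)[of a b] *(2)[of b a] assms by (cases "a \<le> b") auto
qed

lemma borel_measurable_layer[measurable]:
  fixes f :: "'a::euclidean_space \<Rightarrow> real"
  assumes [measurable]: "f \<in> borel_measurable borel"
  shows "(\<lambda>p. indicator {0<..<f (fst p)} (snd p) :: real) \<in> borel_measurable (borel \<Otimes>\<^sub>M borel)"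
    "(\<lambda>p. indicator {0<..<f (fst p)} (snd p) :: ennreal) \<in> borel_measurable (borel \<Otimes>\<^sub>M borel)"
proof -
  have "Measurable.pred (borel \<Otimes>\<^sub>M borel) (\<lambda>p. 0 < snd p \<and> snd p < f (fst p))" by measurable
  then have "{p. 0 < snd p \<and> snd p < f (fst p)} \<in> sets (borel \<Otimes>\<^sub>M borel)"
    by (simp add: pred_def space_pair_measure)
  note * = borel_measurable_indicator[OF this]
  show "(\<lambda>p. indicator {0<..<f (fst p)} (snd p) :: real) \<in> borel_measurable (borel \<Otimes>\<^sub>M borel)"
    using *[where 'b=real] by (simp add: indicator_def cong: measurable_cong)
  show "(\<lambda>p. indicator {0<..<f (fst p)} (snd p) :: ennreal) \<in> borel_measurable (borel \<Otimes>\<^sub>M borel)"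
    using *[where 'b=ennreal] by (simp add: indicator_def cong: measurable_cong)
qed

lemma nn_integral_ball_volume_diff:
  assumes "0 \<le> (a::real)" "0 \<le> b"
  shows "(\<integral>\<^sup>+x. ennreal \<bar>indicator {x. ball_volume x < a} x - indicator {x. ball_volume x < b} x\<bar>
     \<partial>(lborel :: 'a::euclidean_space measure)) = ennreal \<bar>a - b\<bar>"
proof -
  have *: "(\<integral>\<^sup>+x. ennreal \<bar>indicator {x. ball_volume x < a} x - indicator {x. ball_volume x < b} x\<bar> \<partial>(lborel :: 'a measure)) = ennreal (b - a)"
    if "0 \<le> a" "a \<le> b" for a b :: real
  proof -
    let ?S = "\<lambda>a. {x::'a. ball_volume x < a}"
    have "(\<integral>\<^sup>+x. ennreal \<bar>indicator (?S a) x - indicator (?S b) x\<bar> \<partial>lborel) = (\<integral>\<^sup>+x. indicator (?S b - ?S a) x \<partial>lborel)"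
      by (rule nn_integral_cong) (use that in \<open>auto simp: indicator_def\<close>)
    also have "\<dots> = emeasure lborel (?S b - ?S a)" by (intro nn_integral_indicator) measurable
    also have "\<dots> = emeasure lborel (?S b) - emeasure lborel (?S a)"
      by (rule emeasure_Diff) (use that in \<open>auto simp: emeasure_ball_volume_sublevel\<close>)
    finally show ?thesis using that by (simp add: emeasure_ball_volume_sublevel ennreal_minus)
  qed
  show ?thesis using *[of a b] *[of b a] assms by (cases "a \<le> b") (auto simp: abs_minus_commute)
qed

lemma abs_superlevel_diff_le:
  assumes f: "bounded_density A f" and g: "bounded_density A g" and h: "0 < h"
  shows "ennreal \<bar>superlevel f h - superlevel g h\<bar>
    \<le> (\<integral>\<^sup>+x. ennreal \<bar>indicator {0<..<f x} h - indicator {0<..<g x} h\<bar> \<partial>lborel)"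
proof -
  note [measurable] = bounded_densityD(1)[OF f] bounded_densityD(1)[OF g]
  let ?F = "{x. h < f x}" and ?G = "{x. h < g x}"
  have i: "integrable lborel (indicator ?F :: _ \<Rightarrow> real)" "integrable lborel (indicator ?G :: _ \<Rightarrow> real)"
    using emeasure_superlevel[OF f h] emeasure_superlevel[OF g h] by auto
  have "superlevel f h - superlevel g h = (LINT x|lborel. indicator ?F x - indicator ?G x)"
    by (subst Bochner_Integration.integral_diff[OF i]) (simp add: superlevel_def)
  also have "ennreal (norm \<dots>) \<le> (\<integral>\<^sup>+x. ennreal (norm (indicator ?F x - indicator ?G x :: real)) \<partial>lborel)"
    by (rule integral_norm_bound_ennreal[OF Bochner_Integration.integrable_diff[OF i]])
  also have "\<dots> = (\<integral>\<^sup>+x. ennreal \<bar>indicator {0<..<f x} h - indicator {0<..<g x} h\<bar> \<partial>lborel)"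
    by (rule nn_integral_cong) (use h in \<open>auto simp: indicator_def\<close>)
  finally show ?thesis by simp
qed

lemma abs_rearrangement_diff_le:
  assumes f: "bounded_density A f" and g: "bounded_density A g"
  shows "ennreal \<bar>rearrangement f x - rearrangement g x\<bar>
    \<le> (\<integral>\<^sup>+h. ennreal \<bar>indicator (star_levels f x) h - indicator (star_levels g x) h\<bar> \<partial>lborel)"
proof -
  have i: "integrable lborel (indicator (star_levels f x) :: _ \<Rightarrow> real)" "integrable lborel (indicator (star_levels g x) :: _ \<Rightarrow> real)"
    using emeasure_star_levels_finite[OF f, of x] emeasure_star_levels_finite[OF g, of x]
      sets_star_levels[OF bounded_densityD(1)[OF f], of x] sets_star_levels[OF bounded_densityD(1)[OF g], of x] by auto
  have "rearrangement f x - rearrangement g x = (LINT h|lborel. indicator (star_levels f x) h - indicator (star_levels g x) h)"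
    by (subst Bochner_Integration.integral_diff[OF i]) (simp add: rearrangement_eq_measure[OF f] rearrangement_eq_measure[OF g])
  also have "ennreal (norm \<dots>) \<le> (\<integral>\<^sup>+h. ennreal (norm (indicator (star_levels f x) h - indicator (star_levels g x) h :: real)) \<partial>lborel)"
    by (rule integral_norm_bound_ennreal[OF Bochner_Integration.integrable_diff[OF i]])
  finally show ?thesis by simp
qed

lemma abs_diff_rearrangement_le:
  assumes f: "bounded_density A f"
  shows "ennreal \<bar>f y - rearrangement f x\<bar>
    \<le> (\<integral>\<^sup>+h. ennreal \<bar>indicator {0<..<f y} h - indicator (star_levels f x) h\<bar> \<partial>lborel)"
proof -
  have i: "integrable lborel (indicator {0<..<f y} :: _ \<Rightarrow> real)" "integrable lborel (indicator (star_levels f x) :: _ \<Rightarrow> real)"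
    using emeasure_star_levels_finite[OF f, of x]
      sets_star_levels[OF bounded_densityD(1)[OF f], of x] bounded_densityD(3)[OF f, of y] by auto
  have "f y - rearrangement f x = (LINT h|lborel. indicator {0<..<f y} h - indicator (star_levels f x) h)"
    using bounded_densityD(3)[OF f, of y]
    by (subst Bochner_Integration.integral_diff[OF i]) (simp add: rearrangement_eq_measure[OF f])
  also have "ennreal (norm \<dots>) \<le> (\<integral>\<^sup>+h. ennreal (norm (indicator {0<..<f y} h - indicator (star_levels f x) h :: real)) \<partial>lborel)"
    by (rule integral_norm_bound_ennreal[OF Bochner_Integration.integrable_diff[OF i]])
  finally show ?thesis by simp
qed

lemma indicator_star_levels:
  "0 < h \<Longrightarrow> indicator (star_levels f x) h = indicator {x. ball_volume x < superlevel f h} x"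
  "h \<le> 0 \<Longrightarrow> indicator (star_levels f x) h = 0"
  by (auto simp: star_levels_def indicator_def)

text \<open>Level by level: two concentric balls differ by exactly the difference of their volumes,
  and this is at most the volume of the symmetric difference of the original superlevel sets.
  Integrating over the levels gives \<open>L^1\<close> distances.\<close>

lemma rearrangement_contraction:
  fixes f g :: "'a::euclidean_space \<Rightarrow> real"
  assumes f: "bounded_density A f" and g: "bounded_density A g"
  shows "(\<integral>\<^sup>+x. ennreal \<bar>rearrangement f x - rearrangement g x\<bar> \<partial>lborel) \<le> (\<integral>\<^sup>+x. ennreal \<bar>f x - g x\<bar> \<partial>lborel)"
proof -
  note [measurable] = bounded_densityD(1)[OF f] bounded_densityD(1)[OF g]
  note [measurable] = star_levels_measurable2[OF bounded_densityD(1)[OF f], where 'b=real]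
    star_levels_measurable2[OF bounded_densityD(1)[OF g], where 'b=real]
    borel_measurable_layer(1)[OF bounded_densityD(1)[OF f]] borel_measurable_layer(1)[OF bounded_densityD(1)[OF g]]
  let ?s = "\<lambda>x h. ennreal \<bar>indicator (star_levels f x) h - indicator (star_levels g x) h\<bar>"
  let ?l = "\<lambda>x h. ennreal \<bar>indicator {0<..<f x} h - indicator {0<..<g x} h\<bar>"
  have ms: "(\<lambda>(x, h). ?s x h) \<in> borel_measurable (borel \<Otimes>\<^sub>M borel)"
    unfolding case_prod_beta by measurable
  have ml: "(\<lambda>(x, h). ?l x h) \<in> borel_measurable (borel \<Otimes>\<^sub>M borel)"
    unfolding case_prod_beta by measurable
  have "(\<integral>\<^sup>+x. ennreal \<bar>rearrangement f x - rearrangement g x\<bar> \<partial>lborel) \<le> (\<integral>\<^sup>+x. \<integral>\<^sup>+h. ?s x h \<partial>lborel \<partial>lborel)"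
    by (intro nn_integral_mono abs_rearrangement_diff_le[OF f g])
  also have "\<dots> = (\<integral>\<^sup>+h. \<integral>\<^sup>+x. ?s x h \<partial>lborel \<partial>lborel)"
    using ms by (intro lborel_pair.Fubini'[symmetric]) simp
  also have "\<dots> \<le> (\<integral>\<^sup>+h. \<integral>\<^sup>+x. ?l x h \<partial>lborel \<partial>lborel)"
  proof (rule nn_integral_mono)
    fix h :: real
    show "(\<integral>\<^sup>+x. ?s x h \<partial>lborel) \<le> (\<integral>\<^sup>+x. ?l x h \<partial>lborel)"
    proof (cases "0 < h")
      case True
      have "(\<integral>\<^sup>+x. ?s x h \<partial>lborel) = ennreal \<bar>superlevel f h - superlevel g h\<bar>"
        using nn_integral_ball_volume_diff[where 'a='a, of "superlevel f h" "superlevel g h"]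
        by (simp add: indicator_star_levels(1)[OF True])
      then show ?thesis using abs_superlevel_diff_le[OF f g True] by simp
    qed (simp add: indicator_star_levels)
  qed
  also have "\<dots> = (\<integral>\<^sup>+x. \<integral>\<^sup>+h. ?l x h \<partial>lborel \<partial>lborel)"
    using ml by (intro lborel_pair.Fubini') simp
  also have "\<dots> = (\<integral>\<^sup>+x. ennreal \<bar>f x - g x\<bar> \<partial>lborel)"
    by (intro nn_integral_cong nn_integral_layer_cake_diff bounded_densityD(3)[OF f] bounded_densityD(3)[OF g])
  finally show ?thesis .
qed

lemma nn_integral_layer_cake:
  assumes f: "bounded_density A f" and [measurable]: "q \<in> borel_measurable borel"
  shows "(\<integral>\<^sup>+x. q x * ennreal (f x) \<partial>lborel) = (\<integral>\<^sup>+h. \<integral>\<^sup>+x. q x * indicator {0<..<f x} h \<partial>lborel \<partial>lborel)"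
proof -
  note [measurable] = bounded_densityD(1)[OF f] borel_measurable_layer(2)[OF bounded_densityD(1)[OF f]]
  have "(\<lambda>(x, h). q x * indicator {0<..<f x} h) \<in> borel_measurable (borel \<Otimes>\<^sub>M borel)"
    unfolding case_prod_beta by measurable
  then have "(\<integral>\<^sup>+h. \<integral>\<^sup>+x. q x * indicator {0<..<f x} h \<partial>lborel \<partial>lborel) = (\<integral>\<^sup>+x. \<integral>\<^sup>+h. q x * indicator {0<..<f x} h \<partial>lborel \<partial>lborel)"
    by (intro lborel_pair.Fubini') simp
  also have "\<dots> = (\<integral>\<^sup>+x. q x * ennreal (f x) \<partial>lborel)"
    by (intro nn_integral_cong, subst nn_integral_cmult) (simp_all add: bounded_densityD(3)[OF f])
  finally show ?thesis by simp
qed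

lemma nn_integral_rearrangement_layers:
  assumes f: "bounded_density A f" and [measurable]: "q \<in> borel_measurable borel"
  shows "(\<integral>\<^sup>+x. q x * ennreal (rearrangement f x) \<partial>lborel)
    = (\<integral>\<^sup>+h. \<integral>\<^sup>+x. q x * indicator (star_levels f x) h \<partial>lborel \<partial>lborel)"
proof -
  note [measurable] = bounded_densityD(1)[OF f] sets_star_levels[OF bounded_densityD(1)[OF f]]
    star_levels_measurable2[OF bounded_densityD(1)[OF f], where 'b=ennreal]
  have "(\<lambda>(x, h). q x * indicator (star_levels f x) h) \<in> borel_measurable (borel \<Otimes>\<^sub>M borel)"
    unfolding case_prod_beta by measurable
  then have "(\<integral>\<^sup>+h. \<integral>\<^sup>+x. q x * indicator (star_levels f x) h \<partial>lborel \<partial>lborel) = (\<integral>\<^sup>+x. \<integral>\<^sup>+h. q x * indicator (star_levels f x) h \<partial>lborel \<partial>lborel)"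
    by (intro lborel_pair.Fubini') simp
  also have "\<dots> = (\<integral>\<^sup>+x. q x * ennreal (rearrangement f x) \<partial>lborel)"
    by (intro nn_integral_cong, subst nn_integral_cmult) (simp_all add: ennreal_rearrangement[OF f])
  finally show ?thesis by simp
qed

lemma nn_integral_superlevel:
  assumes f: "bounded_density A f" and h: "0 < h"
  shows "(\<integral>\<^sup>+x. indicator {0<..<f x} h \<partial>lborel) = ennreal (superlevel f h)"
proof -
  note [measurable] = bounded_densityD(1)[OF f]
  have "(\<integral>\<^sup>+x. indicator {0<..<f x} h \<partial>lborel) = (\<integral>\<^sup>+x. indicator {x. h < f x} x \<partial>lborel)"
    by (rule nn_integral_cong) (use h in \<open>auto simp: indicator_def\<close>)
  then show ?thesis using emeasure_superlevel[OF f h] by simp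
qed

lemma nn_integral_star_superlevel:
  fixes f :: "'a::euclidean_space \<Rightarrow> real"
  assumes h: "0 < h"
  shows "(\<integral>\<^sup>+x. indicator (star_levels f x) h \<partial>lborel) = ennreal (superlevel f h)"
  by (simp add: indicator_star_levels(1)[OF h] emeasure_ball_volume_sublevel)

lemma nn_integral_rearrangement:
  assumes f: "bounded_density A f"
  shows "(\<integral>\<^sup>+x. ennreal (rearrangement f x) \<partial>lborel) = (\<integral>\<^sup>+x. ennreal (f x) \<partial>lborel)"
proof -
  have "(\<integral>\<^sup>+x. indicator (star_levels f x) h \<partial>lborel) = (\<integral>\<^sup>+x. indicator {0<..<f x} h \<partial>lborel :: ennreal)" for h
    by (cases "0 < h") (simp_all add: nn_integral_superlevel[OF f] nn_integral_star_superlevel indicator_star_levels(2))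
  then show ?thesis
    using nn_integral_layer_cake[OF f, of "\<lambda>_. 1"] nn_integral_rearrangement_layers[OF f, of "\<lambda>_. 1"] by simp
qed

lemma bounded_density_rearrangement:
  assumes f: "bounded_density A f"
  shows "bounded_density A (rearrangement f)"
  unfolding bounded_density_def
proof (intro conjI allI)
  show m: "rearrangement f \<in> borel_measurable borel" by (rule borel_measurable_rearrangement[OF f])
  show "integrable lborel (rearrangement f)"
  proof (rule integrableI_nonneg)
    show "(\<integral>\<^sup>+x. ennreal (rearrangement f x) \<partial>lborel) < \<infinity>"
      unfolding nn_integral_rearrangement[OF f]
      using bounded_densityD(2,3)[OF f] by (simp add: nn_integral_eq_integral)
  qed (use m rearrangement_nonneg[OF f] in auto)
qed (use rearrangement_nonneg[OF f] rearrangement_le[OF f] in auto)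

text \<open>In the expansion of \<open>(g x + e x) * (g y + e y)\<close> only the products
  containing \<open>e\<close> are paid for with the bound \<open>N\<close>. For bounded kernels this
  is continuity of the interaction with respect to \<open>L^1\<close>.\<close>

lemma interaction_le_add:
  fixes f g e :: "'a::euclidean_space \<Rightarrow> real"
  assumes [measurable]: "g \<in> borel_measurable borel" "e \<in> borel_measurable borel" "k \<in> borel_measurable borel"
    and f: "\<And>x. 0 \<le> f x" and g: "\<And>x. 0 \<le> g x" and e: "\<And>x. 0 \<le> e x" and le: "\<And>x. f x \<le> g x + e x"
    and k: "\<And>r. k r \<le> N"
  shows "interaction k f \<le> interaction k g
     + N * (2 * (\<integral>\<^sup>+x. ennreal (g x) \<partial>lborel) * (\<integral>\<^sup>+x. ennreal (e x) \<partial>lborel) + (\<integral>\<^sup>+x. ennreal (e x) \<partial>lborel)^2)"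
proof -
  let ?G = "\<integral>\<^sup>+x. ennreal (g x) \<partial>lborel" and ?E = "\<integral>\<^sup>+x. ennreal (e x) \<partial>lborel"
  have prod: "(\<integral>\<^sup>+x. \<integral>\<^sup>+y. N * (ennreal (a x) * ennreal (b y)) \<partial>lborel \<partial>lborel)
      = N * ((\<integral>\<^sup>+x. ennreal (a x) \<partial>lborel) * (\<integral>\<^sup>+x. ennreal (b x) \<partial>lborel))"
    if [measurable]: "a \<in> borel_measurable borel" "b \<in> borel_measurable borel" for a b :: "'a \<Rightarrow> real"
    by (simp add: nn_integral_cmult nn_integral_multc)
  have "interaction k f \<le> (\<integral>\<^sup>+x. \<integral>\<^sup>+y. (ennreal (g x * g y) * k (norm (x - y))
     + N * (ennreal (g x) * ennreal (e y))) + (N * (ennreal (e x) * ennreal (g y)) + N * (ennreal (e x) * ennreal (e y))) \<partial>lborel \<partial>lborel)"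
    unfolding interaction_def
  proof (intro nn_integral_mono)
    fix x y
    have "f x * f y \<le> (g x + e x) * (g y + e y)" by (intro mult_mono le f add_nonneg_nonneg g e)
    then have "ennreal (f x * f y) \<le> ennreal (g x * g y + (g x * e y + (e x * g y + e x * e y)))"
      by (intro ennreal_leI) (simp add: algebra_simps)
    also have "\<dots> = ennreal (g x * g y) + (ennreal (g x) * ennreal (e y) + (ennreal (e x) * ennreal (g y) + ennreal (e x) * ennreal (e y)))"
      using f g e by (simp add: ennreal_plus ennreal_mult)
    finally have "ennreal (f x * f y) * k (norm (x - y)) \<le>
      (ennreal (g x * g y) + (ennreal (g x) * ennreal (e y) + (ennreal (e x) * ennreal (g y) + ennreal (e x) * ennreal (e y)))) * k (norm (x - y))"
      by (intro mult_right_mono) auto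
    also have "\<dots> = ennreal (g x * g y) * k (norm (x - y)) + (ennreal (g x) * ennreal (e y) + (ennreal (e x) * ennreal (g y) + ennreal (e x) * ennreal (e y))) * k (norm (x - y))"
      by (rule distrib_right)
    also have "\<dots> \<le> ennreal (g x * g y) * k (norm (x - y)) + (ennreal (g x) * ennreal (e y) + (ennreal (e x) * ennreal (g y) + ennreal (e x) * ennreal (e y))) * N"
      by (intro add_left_mono mult_left_mono k) auto
    finally show "ennreal (f x * f y) * k (norm (x - y)) \<le> (ennreal (g x * g y) * k (norm (x - y))
     + N * (ennreal (g x) * ennreal (e y))) + (N * (ennreal (e x) * ennreal (g y)) + N * (ennreal (e x) * ennreal (e y)))"
      by (simp add: distrib_left distrib_right ac_simps)
  qed
  also have "\<dots> = (interaction k g + N * (?G * ?E)) + (N * (?E * ?G) + N * (?E * ?E))"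
    unfolding interaction_def prod[OF assms(1,2), symmetric] prod[OF assms(2,1), symmetric] prod[OF assms(2,2), symmetric]
    by (simp add: nn_integral_add)
  also have "\<dots> = interaction k g + N * (2 * ?G * ?E + ?E^2)"
    by (simp add: distrib_left power2_eq_square mult_2 distrib_right ac_simps)
  finally show ?thesis .
qed

section \<open>The Riesz rearrangement inequality\<close>

lemma ennreal_le_of_quadratic_slack:
  assumes "\<And>s::real. 0 < s \<Longrightarrow> s \<le> 1 \<Longrightarrow> a \<le> b + ennreal N * (2 * ennreal g * ennreal s + (ennreal s)^2)" "0 \<le> N" "0 \<le> g"
  shows "a \<le> b"
proof (rule ennreal_le_epsilon)
  fix \<epsilon> :: real assume \<epsilon>: "0 < \<epsilon>"
  \<comment> \<open>For \<open>s \<le> 1\<close> the slack is at most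
    \<open>N * (2 * g + 1) * s\<close>; the added 1 keeps the denominator positive when
    \<open>N = 0\<close>.\<close>
  define s where "s = min 1 (\<epsilon> / (N * (2 * g + 1) + 1))"
  have p: "0 < N * (2 * g + 1) + 1" using assms(2,3) by (intro add_nonneg_pos mult_nonneg_nonneg) auto
  have s: "0 < s" "s \<le> 1" using \<epsilon> p by (auto simp: s_def)
  have "N * (2 * g * s + s^2) \<le> N * ((2 * g + 1) * s)"
    using s assms(2,3) by (intro mult_left_mono) (auto simp: algebra_simps power2_eq_square mult_left_le)
  also have "\<dots> \<le> (N * (2 * g + 1) + 1) * s" using s by (simp add: algebra_simps)
  also have "\<dots> \<le> (N * (2 * g + 1) + 1) * (\<epsilon> / (N * (2 * g + 1) + 1))"
    using p by (intro mult_left_mono) (auto simp: s_def)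
  also have "\<dots> = \<epsilon>" using p by simp
  finally have *: "N * (2 * g * s + s^2) \<le> \<epsilon>" .
  have "a \<le> b + ennreal N * (2 * ennreal g * ennreal s + (ennreal s)^2)" by (rule assms(1)[OF s])
  also have "\<dots> = b + ennreal (N * (2 * g * s + s^2))"
    using assms(2,3) s by (simp add: ennreal_mult ennreal_plus ennreal_power)
  also have "\<dots> \<le> b + ennreal \<epsilon>" by (intro add_left_mono ennreal_leI *)
  finally show "a \<le> b + ennreal \<epsilon>" .
qed

text \<open>The mirror is the perpendicular bisector of \<open>x\<close> and \<open>y\<close>, with
  \<open>e\<close> pointing towards the point of larger norm and \<open>t\<close> the distance from
  the origin. The last estimate follows from \<open>norm (y - x) \<le> norm y + norm x\<close>: a
  gap between the norms keeps the mirror away from the origin.\<close>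

lemma polarize_swap:
  fixes x y :: "'a::euclidean_space"
  assumes "x \<noteq> y" and "norm x \<le> norm y"
  defines "e \<equiv> (y - x) /\<^sub>R norm (y - x)" and "t \<equiv> (norm y^2 - norm x^2) / (2 * norm (y - x))"
  shows "norm e = 1" "t - x \<bullet> e = norm (y - x) / 2" "reflection e t x = y" "norm y - norm x \<le> 2 * t"
proof -
  let ?d = "norm (y - x)"
  have d: "0 < ?d" using assms by simp
  show e: "norm e = 1" using assms by (simp add: e_def)
  have d2: "?d * ?d = norm y^2 - 2 * (x \<bullet> y) + norm x^2"
    using dot_square_norm[of "y - x"]
    by (simp add: power2_eq_square[symmetric] power2_norm_eq_inner inner_diff_left inner_diff_right inner_commute)
  have "x \<bullet> e = (x \<bullet> y - norm x^2) / ?d"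
    by (simp add: e_def inner_diff_right power2_norm_eq_inner divide_inverse)
  then have "t - x \<bullet> e = (?d * ?d) / (2 * ?d)"
    using d by (simp add: t_def d2 field_simps)
  then show te: "t - x \<bullet> e = ?d / 2" using d by simp
  show "reflection e t x = y" using d by (simp add: reflection_def te) (simp add: e_def)
  have "(norm y - norm x) * ?d \<le> (norm y - norm x) * (norm y + norm x)"
    using norm_triangle_ineq4[of y x] assms by (intro mult_left_mono) auto
  also have "\<dots> = norm y^2 - norm x^2" by (simp add: power2_eq_square algebra_simps)
  also have "\<dots> = 2 * t * ?d" using d by (simp add: t_def)
  finally show "norm y - norm x \<le> 2 * t" using d by simp
qed

definition second_moment :: "('a::euclidean_space \<Rightarrow> real) \<Rightarrow> ennreal" where
  "second_moment u = (\<integral>\<^sup>+x. ennreal (norm x^2 * u x) \<partial>lborel)"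

text \<open>
  The gain does not depend on \<open>v\<close> but only on its Lipschitz constant, which polarization preserves;
  this replaces a compactness argument.
\<close>

lemma second_moment_polarize_gain:
  fixes x y :: "'a::euclidean_space"
  assumes v: "v \<in> borel_measurable borel" "\<And>x. 0 \<le> v x" and lip: "lipschitz_const L v" and L: "1 \<le> L"
    and \<eta>: "0 < \<eta>" and xy: "norm x + \<eta> \<le> norm y" "v x + \<eta> < v y"
  obtains e t where "norm e = 1" "0 \<le> t"
    "second_moment (polarize e t v) + ennreal (\<eta>^3 / 4 * measure lborel (ball (0::'a) (\<eta> / (4 * L)))) \<le> second_moment v"
proof -
  define e where "e = (y - x) /\<^sub>R norm (y - x)"
  define t where "t = (norm y^2 - norm x^2) / (2 * norm (y - x))"
  \<comment> \<open>Within \<open>\<eta> / (4 * L)\<close> of \<open>x\<close> the values at a point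
    and at its image each vary by at most \<open>\<eta> / 4\<close>, so half of the jump
    \<open>\<eta>\<close> survives; as \<open>L \<ge> 1\<close>, the distance to the mirror stays at
    least \<open>\<eta> / 4\<close>. Together with \<open>t \<ge> \<eta> / 2\<close> and the factor
    4 this gives \<open>\<eta>^3 / 4\<close>.\<close>
  let ?d = "norm (y - x)" and ?\<delta> = "\<eta> / (4 * L)"
  have \<delta>: "0 < ?\<delta>" "?\<delta> \<le> \<eta> / 4" "L * ?\<delta> = \<eta> / 4" using \<eta> L by (auto simp: field_simps)
  have ne: "x \<noteq> y" "norm x \<le> norm y" using xy \<eta> by auto
  note P = polarize_swap[OF ne, folded e_def, folded t_def]
  have t: "\<eta> / 2 \<le> t" using P(4) xy by linarith
  have d: "\<eta> \<le> ?d" using xy norm_triangle_ineq2[of y x] by linarith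
  define g where "g z = (if z \<bullet> e \<le> t then 4 * t * (t - z \<bullet> e) * max 0 (v (reflection e t z) - v z) else 0)" for z
  have g: "\<eta>^3 / 4 \<le> g z" if z: "z \<in> ball x ?\<delta>" for z
  proof -
    have zx: "norm (z - x) < ?\<delta>" using z by (simp add: dist_norm norm_minus_commute)
    have "\<bar>(z - x) \<bullet> e\<bar> \<le> norm (z - x)" using Cauchy_Schwarz_ineq2[of "z - x" e] P(1) by simp
    then have "z \<bullet> e \<le> x \<bullet> e + ?\<delta>" using zx by (simp add: inner_diff_left)
    then have tz: "\<eta> / 4 \<le> t - z \<bullet> e" using P(2) d \<delta>(2) by linarith
    have "\<bar>v (reflection e t z) - v (reflection e t x)\<bar> \<le> L * norm (z - x)"
      using lip[unfolded lipschitz_const_def, rule_format, of "reflection e t z" "reflection e t x"]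
      by (simp only: norm_reflection_diff[OF P(1)])
    also have "\<dots> \<le> L * ?\<delta>" using zx L by (intro mult_left_mono) auto
    finally have 1: "\<bar>v (reflection e t z) - v y\<bar> \<le> \<eta> / 4" using P(3) \<delta>(3) by simp
    have "\<bar>v z - v x\<bar> \<le> L * norm (z - x)" using lip by (simp add: lipschitz_const_def)
    also have "\<dots> \<le> L * ?\<delta>" using zx L by (intro mult_left_mono) auto
    finally have 2: "\<bar>v z - v x\<bar> \<le> \<eta> / 4" using \<delta>(3) by simp
    have vd: "\<eta> / 2 \<le> v (reflection e t z) - v z" using 1 2 xy by linarith
    have "\<eta>^3 / 4 = 4 * (\<eta> / 2) * (\<eta> / 4) * (\<eta> / 2)" by (simp add: power3_eq_cube)
    also have "\<dots> \<le> 4 * t * (t - z \<bullet> e) * max 0 (v (reflection e t z) - v z)"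
      using t tz vd \<eta> by (intro mult_mono) auto
    also have "\<dots> = g z" using tz \<eta> by (simp add: g_def)
    finally show ?thesis .
  qed
  have g0: "0 \<le> g z" for z using t \<eta> by (auto simp: g_def)
  have "ennreal (\<eta>^3 / 4 * measure lborel (ball (0::'a) ?\<delta>)) = ennreal (\<eta>^3 / 4) * emeasure lborel (ball x ?\<delta>)"
  proof -
    have "emeasure lborel (ball x ?\<delta>) = ennreal (measure lborel (ball (0::'a) ?\<delta>))"
      using \<delta>(1) by (simp only: emeasure_ball content_ball less_imp_le)
    moreover have "ennreal (\<eta>^3 / 4 * measure lborel (ball (0::'a) ?\<delta>)) = ennreal (\<eta>^3 / 4) * ennreal (measure lborel (ball (0::'a) ?\<delta>))"
      using \<eta> by (intro ennreal_mult) auto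
    ultimately show ?thesis by simp
  qed
  also have "\<dots> = (\<integral>\<^sup>+z. ennreal (\<eta>^3 / 4) * indicator (ball x ?\<delta>) z \<partial>lborel)"
    by (subst nn_integral_cmult_indicator) auto
  also have "\<dots> \<le> (\<integral>\<^sup>+z. ennreal (g z) \<partial>lborel)"
    by (rule nn_integral_mono) (use g in \<open>auto simp: indicator_def intro!: ennreal_leI\<close>)
  finally have "ennreal (\<eta>^3 / 4 * measure lborel (ball (0::'a) ?\<delta>)) \<le> (\<integral>\<^sup>+z. ennreal (g z) \<partial>lborel)" .
  moreover have "second_moment (polarize e t v) + (\<integral>\<^sup>+z. ennreal (g z) \<partial>lborel) = second_moment v"
    unfolding second_moment_def g_def using t \<eta> by (intro second_moment_polarize P(1) v) auto
  ultimately have "second_moment (polarize e t v) + ennreal (\<eta>^3 / 4 * measure lborel (ball (0::'a) ?\<delta>)) \<le> second_moment v"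
    by (metis add_left_mono)
  then show ?thesis using P(1) t \<eta> by (intro that) auto
qed

text \<open>Take \<open>x\<close> of norm \<open>norm z + 2 * \<eta>\<close> in the direction of
  \<open>z\<close>. All points of norm below \<open>norm z + \<eta>\<close> have values at least
  \<open>v x - \<eta>\<close>, so the superlevel sets below this height contain a ball larger than
  the one through \<open>z\<close>, and the rearrangement at \<open>z\<close> reaches this height.
  Passing from \<open>v x\<close> back to \<open>v z\<close> costs
  \<open>2 * L * \<eta>\<close>.\<close>

lemma le_rearrangement_of_almost_decreasing:
  fixes v :: "'a::euclidean_space \<Rightarrow> real"
  assumes v: "bounded_density A v" and lip: "lipschitz_const L v" and L: "0 \<le> L" and \<eta>: "0 < \<eta>"
    and dec: "\<And>x y. norm x + \<eta> \<le> norm y \<Longrightarrow> v y \<le> v x + \<eta>"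
  shows "v z \<le> rearrangement v z + (2 * L + 1) * \<eta>"
proof -
  obtain b :: 'a where b: "norm b = 1" using vector_choose_size[of 1] by auto
  \<comment> \<open>The origin determines no direction, hence the auxiliary unit vector
    \<open>b\<close>.\<close>
  define x where "x = (if z = 0 then (2 * \<eta>) *\<^sub>R b else (1 + 2 * \<eta> / norm z) *\<^sub>R z)"
  have nx: "norm x = norm z + 2 * \<eta>" using b \<eta> by (simp add: x_def field_simps)
  have "norm (z - x) = 2 * \<eta>"
  proof (cases "z = 0")
    case False
    then have "z - x = - (2 * \<eta> / norm z) *\<^sub>R z" by (simp add: x_def algebra_simps)
    then show ?thesis using False \<eta> by simp
  qed (use b \<eta> in \<open>simp add: x_def\<close>)
  then have vz: "v z \<le> v x + 2 * L * \<eta>"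
    using lip[unfolded lipschitz_const_def, rule_format, of z x] by (simp add: algebra_simps)
  define c where "c = v x - \<eta>"
  have "c \<le> rearrangement v z"
  proof (rule rearrangement_ge[OF v])
    fix h :: real assume h: "0 < h" "h < c"
    have "ball 0 (norm z + \<eta>) \<subseteq> {w. h < v w}"
    proof
      fix w assume "w \<in> ball (0::'a) (norm z + \<eta>)"
      then have "norm w + \<eta> \<le> norm x" using nx by simp
      from dec[OF this] show "w \<in> {w. h < v w}" using h by (simp add: c_def)
    qed
    moreover have "{w. h < v w} \<in> fmeasurable lborel"
      using emeasure_superlevel[OF v h(1)] bounded_densityD(1)[OF v] by (auto simp: fmeasurable_def)
    ultimately have "measure lborel (ball (0::'a) (norm z + \<eta>)) \<le> superlevel v h"
      unfolding superlevel_def by (intro measure_mono_fmeasurable) auto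
    moreover have "ball_volume z < measure lborel (ball (0::'a) (norm z + \<eta>))"
      using \<eta> by (simp add: content_ball ball_volume_def power_strict_mono)
    ultimately show "ball_volume z < superlevel v h" by linarith
  qed
  then show ?thesis using vz by (simp add: c_def algebra_simps)
qed


lemma riesz_rearrangement_lipschitz:
  fixes u :: "'a::euclidean_space \<Rightarrow> real"
  assumes u: "bounded_density A u" and lip: "lipschitz_const L u" and L: "1 \<le> L"
    and supp: "\<And>x. R < norm x \<Longrightarrow> u x = 0" and R: "0 < R"
    and k: "antimono k" "k \<in> borel_measurable borel" "\<And>r. k r \<le> ennreal N" and N: "0 \<le> N"
  shows "interaction k u \<le> interaction k (rearrangement u)"
proof -
  \<comment> \<open>Instead of the orbit of \<open>u\<close> under polarizations, the set of
    functions sharing the invariants that matter: equal superlevel volumes fix the rearrangement,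
    the Lipschitz constant makes the gain uniform, and the common ball of radius \<open>R\<close>
    bounds the error in \<open>L^1\<close>.\<close>
  define C where "C = {v::'a \<Rightarrow> real. bounded_density A v \<and> lipschitz_const L v \<and> (\<forall>x. R < norm x \<longrightarrow> v x = 0)
    \<and> (\<forall>h. emeasure lborel {x. h < v x} = emeasure lborel {x. h < u x}) \<and> interaction k u \<le> interaction k v}"
  have uC: "u \<in> C" using u lip supp by (auto simp: C_def)
  have step: "polarize e t v \<in> C" if vC: "v \<in> C" and e: "norm e = 1" and t: "0 \<le> t" for e t v
  proof -
    have v: "bounded_density A v" and lv: "lipschitz_const L v" and sv: "\<And>x. R < norm x \<Longrightarrow> v x = 0"
      and hv: "\<And>h. emeasure lborel {x. h < v x} = emeasure lborel {x. h < u x}" and Iv: "interaction k u \<le> interaction k v"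
      using vC by (auto simp: C_def)
    note [measurable] = bounded_densityD(1)[OF v]
    have b: "0 \<le> polarize e t v x \<and> polarize e t v x \<le> A" for x
      using bounded_densityD(3,4)[OF v] by (auto simp: polarize_def max_def min_def)
    have "integrable lborel (polarize e t v)"
    proof (rule integrableI_nonneg)
      show "(\<integral>\<^sup>+x. ennreal (polarize e t v x) \<partial>lborel) < \<infinity>"
        using nn_integral_polarize[OF e, of v ennreal t] bounded_densityD(2,3)[OF v] by (simp add: nn_integral_eq_integral)
    qed (use b in auto)
    then have 1: "bounded_density A (polarize e t v)" using b by (auto simp: bounded_density_def)
    have 2: "polarize e t v x = 0" if x: "R < norm x" for x
    proof (cases rule: polarize_cases[OF e, where u=v and x=x and t=t])
      case 1
      have "norm x^2 \<le> norm (reflection e t x)^2" using 1 t by (simp add: norm_reflection_sq[OF e])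
      then have "norm x \<le> norm (reflection e t x)" by (rule power2_le_imp_le) simp
      then have "v (reflection e t x) = 0" using x by (intro sv) auto
      then show ?thesis using 1 sv[OF x] by simp
    next
      case 2 then show ?thesis using sv[OF x] bounded_densityD(3)[OF v, of "reflection e t x"] by simp
    qed
    have 3: "interaction k u \<le> interaction k (polarize e t v)"
      using interaction_polarize_le[OF e bounded_densityD(1)[OF v] k(2,1) bounded_densityD(3)[OF v], of t] Iv by (rule order_trans[rotated])
    show ?thesis
      using 1 2 3 lipschitz_const_polarize[OF e lv] L emeasure_superlevel_polarize[OF e bounded_densityD(1)[OF v]] hv
      by (auto simp: C_def)
  qed
  define I where "I = (INF v\<in>C. second_moment v)"
  have "second_moment u \<le> (\<integral>\<^sup>+x. ennreal (R^2) * ennreal (u x) \<partial>lborel)"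
    unfolding second_moment_def
  proof (intro nn_integral_mono)
    fix x
    have "norm x^2 * u x \<le> R^2 * u x"
    proof (cases "R < norm x")
      case False
      then show ?thesis using bounded_densityD(3)[OF u] by (intro mult_right_mono power_mono) auto
    qed (simp add: supp)
    then show "ennreal (norm x^2 * u x) \<le> ennreal (R^2) * ennreal (u x)"
      using bounded_densityD(3)[OF u, of x] by (subst ennreal_mult[symmetric]) (auto intro: ennreal_leI)
  qed
  also have "\<dots> < \<infinity>"
    using bounded_densityD(1-3)[OF u] by (simp add: nn_integral_cmult nn_integral_eq_integral ennreal_mult_less_top)
  finally have If: "I < \<infinity>" unfolding I_def using uC by (auto intro: INF_lower le_less_trans)
  define G where "G = (LINT x|lborel. u x)"
  have G: "(\<integral>\<^sup>+x. ennreal (rearrangement u x) \<partial>lborel) = ennreal G" "0 \<le> G"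
    unfolding nn_integral_rearrangement[OF u] G_def
    using bounded_densityD(2,3)[OF u] by (auto simp: nn_integral_eq_integral)
  define V where "V = measure lborel (cball (0::'a) R)"
  have V: "0 < V" using R by (simp add: V_def content_cball_pos)
  show ?thesis
  proof (rule ennreal_le_of_quadratic_slack[OF _ N G(2)])
    fix s :: real assume s: "0 < s" "s \<le> 1"
    \<comment> \<open>Chosen so that the pointwise error \<open>(2 * L + 1) * \<eta>\<close> on the
      ball of volume \<open>V\<close> has integral \<open>s\<close>.\<close>
    define \<eta> where "\<eta> = s / ((2 * L + 1) * V)"
    have \<eta>: "0 < \<eta>" "(2 * L + 1) * \<eta> * V = s" using s L V by (auto simp: \<eta>_def)
    define \<epsilon> where "\<epsilon> = \<eta>^3 / 4 * measure lborel (ball (0::'a) (\<eta> / (4 * L)))"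
    have \<epsilon>: "0 < \<epsilon>" using \<eta> L by (simp add: \<epsilon>_def)
    \<comment> \<open>A pair of points that violates almost monotonicity allows a polarization
      lowering the moment by \<open>\<epsilon>\<close>, which is impossible within
      \<open>\<epsilon>\<close> of the infimum. Finiteness of \<open>I\<close> makes the inequality
      strict, so that such a \<open>v\<close> exists.\<close>
    have "I < I + ennreal \<epsilon>" using If \<epsilon> by (cases I) (auto simp: ennreal_plus[symmetric] ennreal_less_iff simp del: ennreal_plus)
    then obtain v where vC: "v \<in> C" and Fv: "second_moment v < I + ennreal \<epsilon>"
      unfolding I_def by (auto simp: INF_less_iff)
    have v: "bounded_density A v" and lv: "lipschitz_const L v" and sv: "\<And>x. R < norm x \<Longrightarrow> v x = 0"
      and hv: "\<And>h. emeasure lborel {x. h < v x} = emeasure lborel {x. h < u x}" and Iv: "interaction k u \<le> interaction k v"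
      using vC by (auto simp: C_def)
    have dec: "v y \<le> v x + \<eta>" if xy: "norm x + \<eta> \<le> norm y" for x y
    proof (rule ccontr)
      assume "\<not> v y \<le> v x + \<eta>"
      then have "v x + \<eta> < v y" by simp
      then obtain e t where et: "norm e = 1" "0 \<le> t" and gain: "second_moment (polarize e t v) + ennreal \<epsilon> \<le> second_moment v"
        using second_moment_polarize_gain[OF bounded_densityD(1)[OF v] bounded_densityD(3)[OF v] lv L \<eta>(1) xy]
        unfolding \<epsilon>_def by blast
      have "I \<le> second_moment (polarize e t v)" unfolding I_def by (intro INF_lower step vC et)
      then have "I + ennreal \<epsilon> \<le> second_moment v" using gain by (meson add_right_mono order_trans)
      then show False using Fv by simp
    qed
    have req: "rearrangement v = rearrangement u"
    proof (rule rearrangement_cong)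
      fix h :: real
      have "{x. h < v x} \<in> sets lborel" "{x. h < u x} \<in> sets lborel"
        using bounded_densityD(1)[OF v] bounded_densityD(1)[OF u] by measurable
      then show "emeasure lebesgue {x. h < v x} = emeasure lebesgue {x. h < u x}"
        using hv by simp
    qed
    define e where "e x = (2 * L + 1) * \<eta> * indicator (cball (0::'a) R) x" for x
    have le: "v x \<le> rearrangement u x + e x" for x
    proof (cases "R < norm x")
      case False
      then show ?thesis
        using le_rearrangement_of_almost_decreasing[OF v lv _ \<eta>(1) dec, of x] L by (simp add: e_def req)
    qed (use sv rearrangement_nonneg[OF u, of x] in \<open>simp add: e_def\<close>)
    have e0: "0 \<le> e x" for x using L \<eta> by (simp add: e_def)
    have [measurable]: "e \<in> borel_measurable borel" unfolding e_def[abs_def]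
      by (intro borel_measurable_times borel_measurable_indicator borel_measurable_const) auto
    have "(\<integral>\<^sup>+x. ennreal (e x) \<partial>lborel) = (\<integral>\<^sup>+x. ennreal ((2 * L + 1) * \<eta>) * indicator (cball (0::'a) R) x \<partial>lborel)"
      by (rule nn_integral_cong) (auto simp: e_def indicator_def)
    also have "\<dots> = ennreal ((2 * L + 1) * \<eta>) * ennreal V"
      using emeasure_eq_ennreal_measure[of lborel "cball (0::'a) R"] emeasure_lborel_cball_finite[of "0::'a" R]
      by (subst nn_integral_cmult_indicator) (auto simp: V_def less_top)
    also have "\<dots> = ennreal s" using \<eta> L V by (subst ennreal_mult[symmetric]) auto
    finally have E: "(\<integral>\<^sup>+x. ennreal (e x) \<partial>lborel) = ennreal s" .
    have "interaction k v \<le> interaction k (rearrangement u) + ennreal N * (2 * ennreal G * ennreal s + (ennreal s)^2)"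
      using interaction_le_add[OF borel_measurable_rearrangement[OF u] _ k(2) bounded_densityD(3)[OF v] rearrangement_nonneg[OF u] e0 le k(3)]
      by (simp add: G E)
    then show "interaction k u \<le> interaction k (rearrangement u) + ennreal N * (2 * ennreal G * ennreal s + (ennreal s)^2)"
      using Iv by (rule order_trans[rotated])
  qed
qed

section \<open>The Riesz inequality: from Lipschitz functions to bounded densities and unbounded
  kernels\<close>

definition compact_lipschitz :: "('a::euclidean_space \<Rightarrow> real) \<Rightarrow> bool" where
  "compact_lipschitz u \<longleftrightarrow> (\<exists>L\<ge>1. lipschitz_const L u) \<and> (\<exists>R>0. \<forall>x. R < norm x \<longrightarrow> u x = 0)"

lemma borel_measurable_lipschitz_const:
  fixes u :: "'a::euclidean_space \<Rightarrow> real"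
  assumes "lipschitz_const L u"
  shows "u \<in> borel_measurable borel"
proof (rule borel_measurable_continuous_onI)
  have "(max L 0)-lipschitz_on UNIV u"
  proof (rule lipschitz_onI)
    fix x y
    have "\<bar>u x - u y\<bar> \<le> L * norm (x - y)" using assms by (simp add: lipschitz_const_def)
    also have "\<dots> \<le> max L 0 * norm (x - y)" by (intro mult_right_mono) auto
    finally show "dist (u x) (u y) \<le> max L 0 * dist x y" by (simp add: dist_norm)
  qed simp
  then show "continuous_on UNIV u" by (rule lipschitz_on_continuous_on)
qed

lemma lipschitz_const_mono: "lipschitz_const L u \<Longrightarrow> L \<le> L' \<Longrightarrow> lipschitz_const L' u"
  unfolding lipschitz_const_def by (meson mult_right_mono norm_ge_zero order_trans)

lemma compact_lipschitzI:
  assumes "lipschitz_const L u" "\<And>x. R < norm x \<Longrightarrow> u x = 0"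
  shows "compact_lipschitz u"
  unfolding compact_lipschitz_def
proof
  show "\<exists>L\<ge>1. lipschitz_const L u" using lipschitz_const_mono[OF assms(1), of "max 1 L"] by (intro exI[of _ "max 1 L"]) auto
  show "\<exists>R>0. \<forall>x. R < norm x \<longrightarrow> u x = 0" using assms(2) by (intro exI[of _ "max 1 R"]) auto
qed

lemma compact_lipschitz_add:
  assumes "compact_lipschitz u" "compact_lipschitz v"
  shows "compact_lipschitz (\<lambda>x. u x + v x)"
proof -
  from assms obtain L L' R R' where 1: "lipschitz_const L u" "lipschitz_const L' v"
    and 2: "\<And>x. R < norm x \<Longrightarrow> u x = 0" "\<And>x. R' < norm x \<Longrightarrow> v x = 0"
    unfolding compact_lipschitz_def by metis
  show ?thesis
  proof (rule compact_lipschitzI)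
    show "lipschitz_const (L + L') (\<lambda>x. u x + v x)"
      unfolding lipschitz_const_def
    proof (intro allI)
      fix x y
      have "\<bar>u x - u y\<bar> \<le> L * norm (x - y)" "\<bar>v x - v y\<bar> \<le> L' * norm (x - y)"
        using 1 by (auto simp: lipschitz_const_def)
      then show "\<bar>u x + v x - (u y + v y)\<bar> \<le> (L + L') * norm (x - y)"
        unfolding distrib_right by linarith
    qed
    show "u x + v x = 0" if "max R R' < norm x" for x using 2[of x] that by simp
  qed
qed

lemma compact_lipschitz_cmult:
  assumes "compact_lipschitz u"
  shows "compact_lipschitz (\<lambda>x. c * u x)"
proof -
  from assms obtain L R where 1: "lipschitz_const L u" and 2: "\<And>x. R < norm x \<Longrightarrow> u x = 0"
    unfolding compact_lipschitz_def by metis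
  show ?thesis
  proof (rule compact_lipschitzI)
    show "lipschitz_const (\<bar>c\<bar> * L) (\<lambda>x. c * u x)"
      unfolding lipschitz_const_def
    proof (intro allI)
      fix x y
      have "\<bar>c\<bar> * \<bar>u x - u y\<bar> \<le> \<bar>c\<bar> * (L * norm (x - y))"
        using 1 by (intro mult_left_mono) (auto simp: lipschitz_const_def)
      then show "\<bar>c * u x - c * u y\<bar> \<le> \<bar>c\<bar> * L * norm (x - y)"
        by (simp add: abs_mult[symmetric] right_diff_distrib mult.assoc)
    qed
    show "c * u x = 0" if "R < norm x" for x using 2[of x] that by simp
  qed
qed

lemma compact_lipschitz_clamp:
  assumes "compact_lipschitz u" "0 \<le> A"
  shows "compact_lipschitz (\<lambda>x. max 0 (min A (u x)))"
proof -
  from assms obtain L R where 1: "lipschitz_const L u" and 2: "\<And>x. R < norm x \<Longrightarrow> u x = 0"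
    unfolding compact_lipschitz_def by metis
  show ?thesis
  proof (rule compact_lipschitzI)
    show "lipschitz_const L (\<lambda>x. max 0 (min A (u x)))"
      unfolding lipschitz_const_def
    proof (intro allI)
      fix x y
      have "\<bar>u x - u y\<bar> \<le> L * norm (x - y)"
        using 1 by (auto simp: lipschitz_const_def)
      then show "\<bar>max 0 (min A (u x)) - max 0 (min A (u y))\<bar> \<le> L * norm (x - y)"
        by linarith
    qed
    show "max 0 (min A (u x)) = 0" if "R < norm x" for x using 2[of x] that assms by simp
  qed
qed

text \<open>Inner regularity gives a closed subset, cutting with a large ball a compact set
  \<open>K\<close>, and outer regularity an open \<open>U\<close> around \<open>K\<close>. The
  positive part of \<open>1 - infdist x K / d\<close> falls from 1 on \<open>K\<close> to 0 outside
  \<open>U\<close>, because \<open>d\<close> separates \<open>K\<close> from the complement of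
  \<open>U\<close>.\<close>

lemma compact_lipschitz_approx_indicator:
  fixes D :: "'a::euclidean_space set"
  assumes D: "D \<in> sets borel" "emeasure lborel D < \<infinity>" and \<epsilon>: "0 < \<epsilon>"
  obtains u where "compact_lipschitz u" "(\<integral>\<^sup>+x. ennreal \<bar>indicator D x - u x\<bar> \<partial>lborel) \<le> ennreal \<epsilon>"
proof -
  have DS: "D \<in> sets lebesgue" using D(1) by simp
  have e: "0 < \<epsilon>/4" "0 < \<epsilon>/2" using \<epsilon> by auto
  obtain F where F: "closed F" "F \<subseteq> D" "emeasure lebesgue (D - F) < ennreal (\<epsilon>/4)"
    using sets_lebesgue_inner_closed[OF DS e(1)] by metis
  have Fb: "F \<in> sets borel" using F(1) by auto
  have cb: "cball (0::'a) r \<in> sets borel" for r by simp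
  have "(\<lambda>n::nat. emeasure lborel (F - cball 0 (real n))) \<longlonglongrightarrow> emeasure lborel (\<Inter>n. F - cball 0 (real n))"
  proof (rule Lim_emeasure_decseq)
    show "range (\<lambda>n. F - cball 0 (real n)) \<subseteq> sets lborel" using Fb cb by auto
    show "decseq (\<lambda>n. F - cball 0 (real n))" by (auto simp: decseq_def)
    show "emeasure lborel (F - cball 0 (real n)) \<noteq> \<infinity>" for n
    proof -
      have "emeasure lborel (F - cball 0 (real n)) \<le> emeasure lborel D" using F(2) D by (intro emeasure_mono) auto
      then show ?thesis using D(2) by (auto simp: top_unique)
    qed
  qed
  also have "(\<Inter>n. F - cball 0 (real n)) = {}"
    using real_arch_simple by (auto simp: not_le[symmetric])
  finally have "eventually (\<lambda>n. emeasure lborel (F - cball 0 (real n)) < ennreal (\<epsilon>/4)) sequentially"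
    using \<epsilon> by (intro order_tendstoD(2)) auto
  then obtain n where n: "emeasure lborel (F - cball 0 (real n)) < ennreal (\<epsilon>/4)"
    by (auto simp: eventually_sequentially)
  define K where "K = F \<inter> cball 0 (real n)"
  have K: "compact K" "K \<subseteq> D" using F by (auto simp: K_def intro: closed_Int_compact)
  have KS: "K \<in> sets lebesgue" using borel_compact[OF K(1)] by simp
  obtain U where U: "open U" "K \<subseteq> U" "emeasure lebesgue (U - K) < ennreal (\<epsilon>/2)"
    using sets_lebesgue_outer_open[OF KS e(2)] by metis
  have b: "K \<in> sets borel" "U \<in> sets borel" using K(1) U(1) by (auto intro: borel_compact)
  have "emeasure lborel (D - K) \<le> emeasure lborel ((D - F) \<union> (F - cball 0 (real n)))"
    using D(1) Fb cb by (intro emeasure_mono) (auto simp: K_def)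
  also have "\<dots> \<le> emeasure lborel (D - F) + emeasure lborel (F - cball 0 (real n))"
    using D(1) Fb cb by (intro emeasure_subadditive) auto
  also have "\<dots> \<le> ennreal (\<epsilon>/4) + ennreal (\<epsilon>/4)"
    using F(3) n D(1) Fb by (intro add_mono) (auto simp: sets.Diff)
  also have "\<dots> = ennreal (\<epsilon>/2)" using \<epsilon> by (simp add: ennreal_plus[symmetric] del: ennreal_plus)
  finally have m: "emeasure lborel (D - K) \<le> ennreal (\<epsilon>/2)" "emeasure lborel (U - K) \<le> ennreal (\<epsilon>/2)"
    using U(3) b by (auto simp: sets.Diff)
  have "\<exists>u. compact_lipschitz u \<and> (\<forall>x. \<bar>indicator K x - u x\<bar> \<le> indicator (U - K) x)"
  proof (cases "K = {}")
    case True
    then show ?thesis by (intro exI[of _ "\<lambda>_. 0"]) (auto intro!: compact_lipschitzI[where L=1 and R=1] simp: lipschitz_const_def)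
  next
    case False
    obtain d where d: "0 < d" "\<And>x y. x \<in> K \<Longrightarrow> y \<in> - U \<Longrightarrow> d \<le> dist x y"
    proof -
      have "closed (- U)" "K \<inter> - U = {}" using U(1,2) by auto
      from separate_compact_closed[OF K(1) this] show ?thesis using that by blast
    qed
    define u where "u x = max 0 (1 - infdist x K / d)" for x
    obtain R where R: "\<And>x. x \<in> K \<Longrightarrow> norm x \<le> R" using compact_imp_bounded[OF K(1)] by (auto simp: bounded_iff)
    have att: "\<exists>y\<in>K. infdist x K = dist x y" for x
      using infdist_attains_inf[OF compact_imp_closed[OF K(1)] False, of x] by metis
    have "compact_lipschitz u"
    proof (rule compact_lipschitzI)
      show "lipschitz_const (1/d) u"
        unfolding lipschitz_const_def
      proof (intro allI)
        fix x y
        have "\<bar>infdist x K - infdist y K\<bar> \<le> norm (x - y)" using infdist_triangle_abs[of x K y] by (simp add: dist_norm)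
        then have "\<bar>infdist x K / d - infdist y K / d\<bar> \<le> 1 / d * norm (x - y)"
          using d(1) by (simp add: diff_divide_distrib[symmetric] abs_divide divide_right_mono)
        then show "\<bar>u x - u y\<bar> \<le> 1 / d * norm (x - y)" unfolding u_def by linarith
      qed
      fix x :: 'a assume x: "R + d < norm x"
      obtain y where y: "y \<in> K" "infdist x K = dist x y" using att by auto
      have "d \<le> dist x y" using R[OF y(1)] x norm_triangle_ineq2[of x y] by (simp add: dist_norm)
      then show "u x = 0" using d(1) y by (simp add: u_def)
    qed
    moreover have "\<bar>indicator K x - u x\<bar> \<le> indicator (U - K) x" for x
    proof -
      have "0 \<le> infdist x K / d" using d(1) infdist_nonneg[of x K] by simp
      moreover have "u x = 1" if "x \<in> K" using that by (simp add: u_def)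
      moreover have "u x = 0" if "x \<notin> U"
      proof -
        obtain y where y: "y \<in> K" "infdist x K = dist x y" using att by auto
        then show ?thesis using d(1) d(2)[of y x] that by (simp add: u_def dist_commute)
      qed
      ultimately show ?thesis using U(2) by (auto simp: indicator_def u_def split: if_splits)
    qed
    ultimately show ?thesis by blast
  qed
  then obtain u where u: "compact_lipschitz u" "\<And>x. \<bar>indicator K x - u x\<bar> \<le> indicator (U - K) x" by blast
  have "(\<integral>\<^sup>+x. ennreal \<bar>indicator D x - u x\<bar> \<partial>lborel) \<le> (\<integral>\<^sup>+x. indicator (D - K) x + indicator (U - K) x \<partial>lborel)"
  proof (rule nn_integral_mono)
    fix x
    have "\<bar>indicator D x - u x\<bar> \<le> indicator (D - K) x + indicator (U - K) x"
      using u(2)[of x] K(2) U(2) by (cases "x \<in> K"; cases "x \<in> U"; cases "x \<in> D") auto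
    then have "ennreal \<bar>indicator D x - u x\<bar> \<le> ennreal (indicator (D - K) x + indicator (U - K) x)" by (rule ennreal_leI)
    then show "ennreal \<bar>indicator D x - u x\<bar> \<le> indicator (D - K) x + indicator (U - K) x"
      by (simp add: ennreal_indicator)
  qed
  also have "\<dots> = emeasure lborel (D - K) + emeasure lborel (U - K)"
    using D(1) b by (simp add: nn_integral_add sets.Diff)
  also have "\<dots> \<le> ennreal (\<epsilon>/2) + ennreal (\<epsilon>/2)" using m by (intro add_mono) auto
  also have "\<dots> = ennreal \<epsilon>" using \<epsilon> by (simp add: ennreal_plus[symmetric] del: ennreal_plus)
  finally show ?thesis using that u(1) by blast
qed

lemma compact_lipschitz_dense:
  fixes f :: "'a::euclidean_space \<Rightarrow> real"
  assumes "integrable lborel f"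
  shows "\<forall>\<epsilon>>0. \<exists>u. compact_lipschitz u \<and> (\<integral>\<^sup>+x. ennreal \<bar>f x - u x\<bar> \<partial>lborel) \<le> ennreal \<epsilon>"
  using assms
proof (induction rule: integrable_induct)
  case (base D c)
  show ?case
  proof (intro allI impI)
    fix \<epsilon> :: real assume \<epsilon>: "0 < \<epsilon>"
    have "0 < \<epsilon> / (\<bar>c\<bar> + 1)" using \<epsilon> by (intro divide_pos_pos) auto
    then obtain u where u: "compact_lipschitz u" "(\<integral>\<^sup>+x. ennreal \<bar>indicator D x - u x\<bar> \<partial>lborel) \<le> ennreal (\<epsilon> / (\<bar>c\<bar> + 1))"
      using compact_lipschitz_approx_indicator[of D] base by auto
    have [measurable]: "u \<in> borel_measurable borel" "D \<in> sets borel"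
      using u(1) base by (auto simp: compact_lipschitz_def intro: borel_measurable_lipschitz_const)
    have "(\<integral>\<^sup>+x. ennreal \<bar>indicator D x *\<^sub>R c - c * u x\<bar> \<partial>lborel) = (\<integral>\<^sup>+x. ennreal \<bar>c\<bar> * ennreal \<bar>indicator D x - u x\<bar> \<partial>lborel)"
      by (intro nn_integral_cong) (simp add: ennreal_mult[symmetric] abs_mult[symmetric] algebra_simps)
    also have "\<dots> = ennreal \<bar>c\<bar> * (\<integral>\<^sup>+x. ennreal \<bar>indicator D x - u x\<bar> \<partial>lborel)" by (rule nn_integral_cmult) measurable
    also have "\<dots> \<le> ennreal \<bar>c\<bar> * ennreal (\<epsilon> / (\<bar>c\<bar> + 1))" by (intro mult_left_mono u) auto
    also have "\<dots> = ennreal (\<bar>c\<bar> * (\<epsilon> / (\<bar>c\<bar> + 1)))" using \<epsilon> by (intro ennreal_mult[symmetric]) auto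
    also have "\<dots> \<le> ennreal \<epsilon>" using \<epsilon> by (intro ennreal_leI) (simp add: field_simps)
    finally show "\<exists>u. compact_lipschitz u \<and> (\<integral>\<^sup>+x. ennreal \<bar>indicator D x *\<^sub>R c - u x\<bar> \<partial>lborel) \<le> ennreal \<epsilon>"
      using compact_lipschitz_cmult[OF u(1), of c] by blast
  qed
next
  case (add f g)
  show ?case
  proof (intro allI impI)
    fix \<epsilon> :: real assume \<epsilon>: "0 < \<epsilon>"
    then have "0 < \<epsilon>/2" by simp
    from add.IH(1)[rule_format, OF this] add.IH(2)[rule_format, OF this]
    obtain u v where u: "compact_lipschitz u" "(\<integral>\<^sup>+x. ennreal \<bar>f x - u x\<bar> \<partial>lborel) \<le> ennreal (\<epsilon>/2)"
      and v: "compact_lipschitz v" "(\<integral>\<^sup>+x. ennreal \<bar>g x - v x\<bar> \<partial>lborel) \<le> ennreal (\<epsilon>/2)" by blast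
    have [measurable]: "u \<in> borel_measurable borel" "v \<in> borel_measurable borel" "f \<in> borel_measurable borel" "g \<in> borel_measurable borel"
      using u(1) v(1) add.hyps by (auto simp: compact_lipschitz_def intro: borel_measurable_lipschitz_const)
    have "(\<integral>\<^sup>+x. ennreal \<bar>f x + g x - (u x + v x)\<bar> \<partial>lborel) \<le> (\<integral>\<^sup>+x. ennreal \<bar>f x - u x\<bar> + ennreal \<bar>g x - v x\<bar> \<partial>lborel)"
      by (intro nn_integral_mono) (auto simp: ennreal_plus[symmetric] simp del: ennreal_plus intro!: ennreal_leI)
    also have "\<dots> = (\<integral>\<^sup>+x. ennreal \<bar>f x - u x\<bar> \<partial>lborel) + (\<integral>\<^sup>+x. ennreal \<bar>g x - v x\<bar> \<partial>lborel)"
      by (rule nn_integral_add) measurable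
    also have "\<dots> \<le> ennreal (\<epsilon>/2) + ennreal (\<epsilon>/2)" by (intro add_mono u v)
    also have "\<dots> = ennreal \<epsilon>" using \<epsilon> by (simp add: ennreal_plus[symmetric] del: ennreal_plus)
    finally show "\<exists>u. compact_lipschitz u \<and> (\<integral>\<^sup>+x. ennreal \<bar>f x + g x - u x\<bar> \<partial>lborel) \<le> ennreal \<epsilon>"
      using compact_lipschitz_add[OF u(1) v(1)] by blast
  qed
next
  case (lim f s)
  show ?case
  proof (intro allI impI)
    fix \<epsilon> :: real assume \<epsilon>: "0 < \<epsilon>"
    have [measurable]: "f \<in> borel_measurable borel" "s i \<in> borel_measurable borel" for i using lim.hyps by auto
    have "(\<lambda>i. \<integral>\<^sup>+x. ennreal (norm (f x - s i x)) \<partial>lborel) \<longlonglongrightarrow> 0"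
    proof (rule nn_integral_dominated_convergence_norm[where w="\<lambda>x. 2 * norm (f x)"])
      show "(\<integral>\<^sup>+x. ennreal (2 * norm (f x)) \<partial>lborel) < \<infinity>"
        using integrable_norm[OF lim.hyps(4)] by (subst nn_integral_eq_integral) auto
    qed (use lim.hyps in auto)
    then have "eventually (\<lambda>i. (\<integral>\<^sup>+x. ennreal (norm (f x - s i x)) \<partial>lborel) < ennreal (\<epsilon>/2)) sequentially"
      using \<epsilon> by (intro order_tendstoD(2)) auto
    then obtain i where i: "(\<integral>\<^sup>+x. ennreal (norm (f x - s i x)) \<partial>lborel) < ennreal (\<epsilon>/2)"
      by (auto simp: eventually_sequentially)
    have "0 < \<epsilon>/2" using \<epsilon> by simp
    from lim.IH[rule_format, OF this, of i] obtain u where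
      u: "compact_lipschitz u" "(\<integral>\<^sup>+x. ennreal \<bar>s i x - u x\<bar> \<partial>lborel) \<le> ennreal (\<epsilon>/2)" by blast
    have [measurable]: "u \<in> borel_measurable borel"
      using u(1) by (auto simp: compact_lipschitz_def intro: borel_measurable_lipschitz_const)
    have "(\<integral>\<^sup>+x. ennreal \<bar>f x - u x\<bar> \<partial>lborel) \<le> (\<integral>\<^sup>+x. ennreal (norm (f x - s i x)) + ennreal \<bar>s i x - u x\<bar> \<partial>lborel)"
      by (intro nn_integral_mono) (auto simp: ennreal_plus[symmetric] simp del: ennreal_plus intro!: ennreal_leI)
    also have "\<dots> = (\<integral>\<^sup>+x. ennreal (norm (f x - s i x)) \<partial>lborel) + (\<integral>\<^sup>+x. ennreal \<bar>s i x - u x\<bar> \<partial>lborel)"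
      by (rule nn_integral_add) measurable
    also have "\<dots> \<le> ennreal (\<epsilon>/2) + ennreal (\<epsilon>/2)" by (intro add_mono u less_imp_le i)
    also have "\<dots> = ennreal \<epsilon>" using \<epsilon> by (simp add: ennreal_plus[symmetric] del: ennreal_plus)
    finally show "\<exists>u. compact_lipschitz u \<and> (\<integral>\<^sup>+x. ennreal \<bar>f x - u x\<bar> \<partial>lborel) \<le> ennreal \<epsilon>"
      using u(1) by blast
  qed
qed

text \<open>\<open>f\<close> is replaced by a Lipschitz function before rearranging and restored
  afterwards; the second error is no larger than the first because rearrangement contracts
  \<open>L^1\<close>. Clamping to \<open>[0, A]\<close> makes the approximant a bounded density
  without increasing its distance to \<open>f\<close>.\<close>

lemma riesz_rearrangement_bounded:
  fixes f :: "'a::euclidean_space \<Rightarrow> real"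
  assumes f: "bounded_density A f"
    and k: "antimono k" "k \<in> borel_measurable borel" "\<And>r. k r \<le> ennreal N" and N: "0 \<le> N"
  shows "interaction k f \<le> interaction k (rearrangement f)"
proof -
  define G where "G = (LINT x|lborel. f x)"
  have Gf: "(\<integral>\<^sup>+x. ennreal (f x) \<partial>lborel) = ennreal G" and G: "0 \<le> G"
    using bounded_densityD(2,3)[OF f] by (auto simp: nn_integral_eq_integral G_def)
  note Gr = nn_integral_rearrangement[OF f, unfolded Gf]
  show ?thesis
  \<comment> \<open>Two approximation errors give \<open>2 * N\<close>; the approximant has mass at
    most \<open>G + s \<le> G + 1\<close>.\<close>
  proof (rule ennreal_le_of_quadratic_slack[where N="2 * N" and g="G + 1"])
    fix s :: real assume s: "0 < s" "s \<le> 1"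
    obtain u0 where u0: "compact_lipschitz u0" "(\<integral>\<^sup>+x. ennreal \<bar>f x - u0 x\<bar> \<partial>lborel) \<le> ennreal s"
      using compact_lipschitz_dense[OF bounded_densityD(2)[OF f]] s by blast
    define u where "u x = max 0 (min A (u0 x))" for x
    have cu: "compact_lipschitz u" unfolding u_def[abs_def] by (rule compact_lipschitz_clamp[OF u0(1) bounded_densityD(5)[OF f]])
    then obtain L R where L: "1 \<le> L" "lipschitz_const L u" and R: "0 < R" "\<And>x. R < norm x \<Longrightarrow> u x = 0"
      by (auto simp: compact_lipschitz_def)
    have mu[measurable]: "u \<in> borel_measurable borel" using L(2) by (rule borel_measurable_lipschitz_const)
    note [measurable] = bounded_densityD(1)[OF f]
    have ub: "0 \<le> u x" "u x \<le> A" for x using bounded_densityD(5)[OF f] by (auto simp: u_def)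
    have fu: "\<bar>f x - u x\<bar> \<le> \<bar>f x - u0 x\<bar>" for x
      using bounded_densityD(3,4)[OF f, of x] unfolding u_def by linarith
    define E where "E = (\<integral>\<^sup>+x. ennreal \<bar>f x - u x\<bar> \<partial>lborel)"
    have E: "E \<le> ennreal s"
      unfolding E_def by (rule order_trans[OF _ u0(2)]) (intro nn_integral_mono ennreal_leI fu)
    have "(\<integral>\<^sup>+x. ennreal (u x) \<partial>lborel) \<le> (\<integral>\<^sup>+x. ennreal (f x) + ennreal \<bar>f x - u x\<bar> \<partial>lborel)"
      using bounded_densityD(3)[OF f] by (intro nn_integral_mono) (auto simp: ennreal_plus[symmetric] simp del: ennreal_plus intro!: ennreal_leI)
    also have "\<dots> = ennreal G + E" by (simp add: nn_integral_add Gf E_def)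
    also have "\<dots> \<le> ennreal G + ennreal 1" using E s by (intro add_left_mono) (meson ennreal_leI order_trans)
    finally have uG: "(\<integral>\<^sup>+x. ennreal (u x) \<partial>lborel) \<le> ennreal (G + 1)" using G by simp
    have u: "bounded_density A u"
      unfolding bounded_density_def
    proof (intro conjI allI ub mu integrableI_nonneg)
      show "(\<integral>\<^sup>+x. ennreal (u x) \<partial>lborel) < \<infinity>" using uG by (rule order.strict_trans1) simp
    qed (use ub in auto)
    have "(\<integral>\<^sup>+x. ennreal \<bar>rearrangement u x - rearrangement f x\<bar> \<partial>lborel) \<le> (\<integral>\<^sup>+x. ennreal \<bar>u x - f x\<bar> \<partial>lborel)"
      by (rule rearrangement_contraction[OF u f])
    also have "\<dots> \<le> ennreal s" using E by (simp add: E_def abs_minus_commute)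
    finally have E': "(\<integral>\<^sup>+x. ennreal \<bar>rearrangement u x - rearrangement f x\<bar> \<partial>lborel) \<le> ennreal s" .
    define Q where "Q = ennreal N * (2 * ennreal (G + 1) * ennreal s + (ennreal s)^2)"
    have "interaction k f \<le> interaction k u + ennreal N * (2 * (\<integral>\<^sup>+x. ennreal (u x) \<partial>lborel) * E + E^2)"
      unfolding E_def by (rule interaction_le_add[OF mu _ k(2) bounded_densityD(3)[OF f] ub(1) _ _ k(3)]) auto
    also have "\<dots> \<le> interaction k u + Q"
      unfolding Q_def by (intro add_left_mono mult_left_mono add_mono mult_mono power_mono uG E) auto
    finally have 1: "interaction k f \<le> interaction k u + Q" .
    have 2: "interaction k u \<le> interaction k (rearrangement u)"
      by (rule riesz_rearrangement_lipschitz[OF u L(2,1) R(2,1) k N])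
    have "interaction k (rearrangement u) \<le> interaction k (rearrangement f)
       + ennreal N * (2 * ennreal G * (\<integral>\<^sup>+x. ennreal \<bar>rearrangement u x - rearrangement f x\<bar> \<partial>lborel)
         + (\<integral>\<^sup>+x. ennreal \<bar>rearrangement u x - rearrangement f x\<bar> \<partial>lborel)^2)"
      unfolding Gr[symmetric]
    proof (rule interaction_le_add[OF borel_measurable_rearrangement[OF f] _ k(2)
          rearrangement_nonneg[OF u] rearrangement_nonneg[OF f] _ _ k(3)])
      show "(\<lambda>x. \<bar>rearrangement u x - rearrangement f x\<bar>) \<in> borel_measurable borel"
        using borel_measurable_rearrangement[OF f] borel_measurable_rearrangement[OF u] by measurable
    qed auto
    also have "\<dots> \<le> interaction k (rearrangement f) + Q"
      unfolding Q_def using G by (intro add_left_mono mult_left_mono add_mono mult_mono power_mono E' ennreal_leI) auto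
    finally have 3: "interaction k (rearrangement u) \<le> interaction k (rearrangement f) + Q" .
    have "interaction k f \<le> interaction k (rearrangement f) + Q + Q"
      using 1 order_trans[OF 2 3] by (meson add_right_mono order_trans)
    also have "\<dots> = interaction k (rearrangement f) + (Q + Q)" by (simp only: add.assoc)
    also have "Q + Q = ennreal (2 * N) * (2 * ennreal (G + 1) * ennreal s + (ennreal s)^2)"
    proof -
      have "ennreal (2 * N) = ennreal N + ennreal N" using N by (simp add: ennreal_plus[symmetric] del: ennreal_plus)
      then show ?thesis unfolding Q_def by (simp only: distrib_right)
    qed
    finally show "interaction k f \<le> interaction k (rearrangement f) + ennreal (2 * N) * (2 * ennreal (G + 1) * ennreal s + (ennreal s)^2)" .
  qed (use N G in auto)
qed

text \<open>The kernels of interest may be infinite near 0, so the bounded case is applied to the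
  minimum of \<open>k\<close> with a natural number, and monotone convergence removes the
  cutoff.\<close>

theorem riesz_rearrangement:
  fixes f :: "'a::euclidean_space \<Rightarrow> real"
  assumes f: "bounded_density A f" and k: "antimono k" "k \<in> borel_measurable borel"
  shows "interaction k f \<le> interaction k (rearrangement f)"
proof -
  note [measurable] = bounded_densityD(1)[OF f] k(2)
  define kn where "kn n r = min (k r) (ennreal (real n))" for n r
  have [measurable]: "kn n \<in> borel_measurable borel" for n unfolding kn_def by measurable
  have inc: "incseq kn"
    by (auto simp: incseq_def le_fun_def kn_def min_le_iff_disj intro!: min.mono ennreal_leI)
  have sup: "(SUP n. kn n r) = k r" for r
  proof -
    have "(SUP n. kn n r) = min (k r) (SUP n. ennreal (real n))"
      unfolding kn_def min_def[symmetric] inf_min[symmetric] by (rule inf_SUP[symmetric])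
    also have "(SUP n. ennreal (real n)) = \<infinity>"
      using ennreal_SUP_of_nat_eq_top by (simp add: ennreal_of_nat_eq_real_of_nat)
    finally show ?thesis by simp
  qed
  have "interaction k f = (SUP n. interaction (kn n) f)"
  proof -
    have "interaction k f = (\<integral>\<^sup>+x. \<integral>\<^sup>+y. (SUP n. ennreal (f x * f y) * kn n (norm (x - y))) \<partial>lborel \<partial>lborel)"
      unfolding interaction_def sup[symmetric] by (simp add: SUP_mult_left_ennreal)
    also have "\<dots> = (\<integral>\<^sup>+x. (SUP n. \<integral>\<^sup>+y. ennreal (f x * f y) * kn n (norm (x - y)) \<partial>lborel) \<partial>lborel)"
      using inc by (intro nn_integral_cong nn_integral_monotone_convergence_SUP)
        (auto simp: incseq_def le_fun_def intro!: mult_left_mono)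
    also have "\<dots> = (SUP n. interaction (kn n) f)"
      unfolding interaction_def using inc
      by (intro nn_integral_monotone_convergence_SUP)
        (auto simp: incseq_def le_fun_def intro!: mult_left_mono nn_integral_mono)
    finally show ?thesis .
  qed
  also have "\<dots> \<le> interaction k (rearrangement f)"
  proof (rule SUP_least)
    fix n
    have "interaction (kn n) f \<le> interaction (kn n) (rearrangement f)"
    proof (rule riesz_rearrangement_bounded[OF f])
      show "antimono (kn n)" using k(1) unfolding antimono_def kn_def by (intro allI impI min.mono) auto
      show "kn n r \<le> ennreal (real n)" for r by (simp add: kn_def)
    qed auto
    also have "\<dots> \<le> interaction k (rearrangement f)"
      unfolding interaction_def by (intro nn_integral_mono mult_left_mono) (auto simp: kn_def)
    finally show "interaction (kn n) f \<le> interaction k (rearrangement f)" .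
  qed
  finally show ?thesis .
qed

section \<open>A quantitative bathtub principle\<close>

text \<open>Take \<open>t = s * (1 - y)\<close> with \<open>y = \<beta> / (2 * n * a)\<close>, where
  \<open>\<beta> \<le> a\<close> gives \<open>y \<le> 1\<close>. Bernoulli's inequality bounds the
  volume of the shell between \<open>t\<close> and \<open>s\<close> by
  \<open>n * y * a = \<beta> / 2\<close>, and \<open>s^2 - t^2 = s^2 * (2 * y - y^2)\<close> is at
  least \<open>s^2 * y\<close>.\<close>

lemma bathtub_radius:
  fixes s \<beta> a :: real and n :: nat and \<omega> :: real
  assumes a: "a = \<omega> * s ^ n" and pos: "0 < s" "0 < \<omega>" "0 < n" and \<beta>: "0 \<le> \<beta>" "\<beta> \<le> a"
  obtains t where "0 \<le> t" "t \<le> s" "\<omega> * s ^ n - \<omega> * t ^ n \<le> \<beta> / 2" "s^2 * \<beta> / (2 * n * a) \<le> s^2 - t^2"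
proof -
  define y where "y = \<beta> / (2 * n * a)"
  have ap: "0 < a" using pos a by simp
  have n1: "1 \<le> real n" using pos(3) by simp
  have y0: "0 \<le> y" using \<beta>(1) ap by (simp add: y_def)
  have "1 * a \<le> (2 * n) * a" using ap n1 by (intro mult_right_mono) auto
  then have "\<beta> \<le> 2 * n * a" using \<beta>(2) by simp
  then have y1: "y \<le> 1" using ap n1 by (simp add: y_def divide_le_eq)
  show ?thesis
  proof (rule that[of "s * (1 - y)"])
    show "0 \<le> s * (1 - y)" "s * (1 - y) \<le> s" using pos y0 y1 by (auto simp: mult_left_le)
    have "1 + real n * (- y) \<le> (1 + (- y)) ^ n" by (rule Bernoulli_inequality) (use y1 in simp)
    then have "a * (1 - n * y) \<le> a * (1 - y) ^ n" using ap by (intro mult_left_mono) auto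
    then have "a - a * (1 - y) ^ n \<le> n * y * a" by (simp add: algebra_simps)
    also have "n * y * a = \<beta> / 2" using ap n1 by (simp add: y_def)
    finally show "\<omega> * s ^ n - \<omega> * (s * (1 - y)) ^ n \<le> \<beta> / 2" by (simp add: a power_mult_distrib mult.assoc)
    have "s^2 * y \<le> s^2 * (2 * y - y * y)" using y0 y1 mult_left_le[of y y] by (intro mult_left_mono) auto
    also have "\<dots> = s^2 - (s * (1 - y))^2" by (simp add: power2_eq_square algebra_simps)
    finally show "s^2 * \<beta> / (2 * n * a) \<le> s^2 - (s * (1 - y))^2" by (simp add: y_def)
  qed
qed

lemma measure_Diff_Int:
  assumes "A \<in> fmeasurable M" "B \<in> fmeasurable M"
  shows "measure M (A - B) = measure M A - measure M (A \<inter> B)"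
  using measurable_measure_Diff[of A M "A \<inter> B"] assms
  by (simp add: Diff_Int_distrib fmeasurableD sets.Int Diff_Int)

text \<open>Equal volumes mean that \<open>ball 0 s - D\<close> and \<open>D - ball 0 s\<close> both
  have volume \<open>\<beta>\<close>. Trading the first for the second replaces squared norms below
  \<open>s^2\<close> by values of at least \<open>s^2\<close>, and at least half of the missing part
  lies within radius \<open>t\<close>, where \<open>s^2 - t^2\<close> or more is gained. Points
  outside the ball are counted with \<open>s^2\<close> only, so the cap \<open>C\<close> costs
  nothing.\<close>

lemma bathtub_level:
  fixes D :: "'a::euclidean_space set" and a C :: real
  assumes D[measurable]: "D \<in> sets borel" and a: "emeasure lborel D = ennreal a" "0 < a"
  defines "s \<equiv> radius_of_volume TYPE('a) a"
  defines "\<beta> \<equiv> measure lborel (ball 0 s - D)"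
  assumes C: "s^2 \<le> C"
  shows "(\<integral>\<^sup>+x. ennreal (norm x^2) * indicator (ball (0::'a) s) x \<partial>lborel) + ennreal (s^2 * \<beta>^2 / (4 * DIM('a) * a))
     \<le> (\<integral>\<^sup>+x. ennreal (min (norm x^2) C) * indicator D x \<partial>lborel)"
proof -
  let ?B = "ball (0::'a) s" and ?\<omega> = "unit_ball_vol DIM('a)"
  have s0: "0 \<le> s" and as: "?\<omega> * s ^ DIM('a) = a"
    unfolding s_def using radius_of_volume[of a, where 'a='a] a(2) by auto
  have s: "0 < s" using s0 as a(2) by (cases "s = 0") (auto simp: zero_power)
  have B[measurable]: "?B \<in> sets borel" by simp
  have eB: "emeasure lborel ?B = ennreal a" using s0 as by (simp only: emeasure_ball)
  have fm: "D \<in> fmeasurable lborel" "?B \<in> fmeasurable lborel" using a(1) eB by (auto simp: fmeasurable_def)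
  have mD: "measure lborel D = a" "measure lborel ?B = a" using a eB by (auto simp: measure_def)
  have e1: "emeasure lborel (?B - D) = ennreal \<beta>"
    unfolding \<beta>_def using fm by (intro emeasure_eq_measure2 fmeasurable_Diff) auto
  have "measure lborel (D - ?B) = measure lborel D - measure lborel (D \<inter> ?B)"
    using fm by (intro measure_Diff_Int) auto
  moreover have "\<beta> = measure lborel ?B - measure lborel (?B \<inter> D)"
    unfolding \<beta>_def using fm by (intro measure_Diff_Int) auto
  ultimately have m2: "measure lborel (D - ?B) = \<beta>" using mD by (simp add: Int_commute)
  have e2: "emeasure lborel (D - ?B) = ennreal \<beta>"
    unfolding m2[symmetric] using fm by (intro emeasure_eq_measure2 fmeasurable_Diff) auto
  have \<beta>0: "0 \<le> \<beta>" by (simp add: \<beta>_def)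
  have \<beta>1: "\<beta> \<le> a" using fm mD(2) unfolding \<beta>_def by (metis B D Diff_subset measure_mono_fmeasurable sets.Diff sets_lborel)
  obtain t where t: "0 \<le> t" "t \<le> s" "?\<omega> * s ^ DIM('a) - ?\<omega> * t ^ DIM('a) \<le> \<beta> / 2"
      "s^2 * \<beta> / (2 * DIM('a) * a) \<le> s^2 - t^2"
    using bathtub_radius[OF as[symmetric] s unit_ball_vol_DIM_pos DIM_positive \<beta>0 \<beta>1] .
  let ?T = "ball (0::'a) t"
  have T[measurable]: "?T \<in> sets borel" by simp
  have fT: "?T \<in> fmeasurable lborel" using emeasure_lborel_ball_finite[of "0::'a" t] by (simp add: fmeasurable_def)
  have mT: "measure lborel ?T = ?\<omega> * t ^ DIM('a)" using t(1) by (simp only: content_ball)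
  \<comment> \<open>The shell outside \<open>?T\<close> can hold at most \<open>\<beta> / 2\<close>
    of the missing part, so the rest lies in \<open>?T\<close>.\<close>
  have "measure lborel (?B - D) \<le> measure lborel ((?B - D) \<inter> ?T) + measure lborel (?B - ?T)"
  proof -
    have "measure lborel (?B - D) \<le> measure lborel ((?B - D) \<inter> ?T \<union> (?B - ?T))"
      using fm fT by (intro measure_mono_fmeasurable) auto
    also have "\<dots> \<le> measure lborel ((?B - D) \<inter> ?T) + measure lborel (?B - ?T)"
      by (intro measure_Un_le) auto
    finally show ?thesis .
  qed
  also have "measure lborel (?B - ?T) = a - ?\<omega> * t ^ DIM('a)"
  proof -
    have "?T \<subseteq> ?B" using t(2) by auto
    then show ?thesis using fm fT mD mT by (subst measure_Diff) (auto simp: fmeasurable_def)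
  qed
  finally have mI: "\<beta> / 2 \<le> measure lborel ((?B - D) \<inter> ?T)" using t(3) as by (simp add: \<beta>_def)
  have eI: "emeasure lborel ((?B - D) \<inter> ?T) = ennreal (measure lborel ((?B - D) \<inter> ?T))"
    using fm fT by (intro emeasure_eq_measure2 fmeasurable_Int_fmeasurable) auto
  have tt: "0 \<le> s^2 - t^2" using t(1,2) by (simp add: power_mono)
  have "s^2 * \<beta>^2 / (4 * DIM('a) * a) = s^2 * \<beta> / (2 * DIM('a) * a) * (\<beta> / 2)" by (simp add: power2_eq_square)
  also have "\<dots> \<le> (s^2 - t^2) * measure lborel ((?B - D) \<inter> ?T)"
    using t(4) mI tt \<beta>0 by (intro mult_mono) auto
  finally have K: "ennreal (s^2 * \<beta>^2 / (4 * DIM('a) * a)) \<le> ennreal (s^2 - t^2) * emeasure lborel ((?B - D) \<inter> ?T)"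
    using tt by (simp add: eI ennreal_mult[symmetric] ennreal_leI)
  have "(\<integral>\<^sup>+x. ennreal (norm x^2) * indicator ?B x \<partial>lborel) + ennreal (s^2 * \<beta>^2 / (4 * DIM('a) * a))
    \<le> (\<integral>\<^sup>+x. ennreal (norm x^2) * indicator ?B x \<partial>lborel) + (\<integral>\<^sup>+x. ennreal (s^2 - t^2) * indicator ((?B - D) \<inter> ?T) x \<partial>lborel)"
    using K by (intro add_left_mono) (simp add: nn_integral_cmult_indicator)
  also have "\<dots> = (\<integral>\<^sup>+x. ennreal (norm x^2) * indicator ?B x + ennreal (s^2 - t^2) * indicator ((?B - D) \<inter> ?T) x \<partial>lborel)"
    by (rule nn_integral_add[symmetric]) measurable
  also have "\<dots> \<le> (\<integral>\<^sup>+x. ennreal (norm x^2) * indicator (D \<inter> ?B) x + ennreal (s^2) * indicator (?B - D) x \<partial>lborel)"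
  proof (rule nn_integral_mono)
    fix x
    have 1: "norm x^2 \<le> s^2" if "x \<in> ?B" using that by (intro power_mono) auto
    have 2: "norm x^2 + (s^2 - t^2) \<le> s^2" if "x \<in> ?T" using that power_mono[of "norm x" t 2] by auto
    show "ennreal (norm x^2) * indicator ?B x + ennreal (s^2 - t^2) * indicator ((?B - D) \<inter> ?T) x
      \<le> ennreal (norm x^2) * indicator (D \<inter> ?B) x + ennreal (s^2) * indicator (?B - D) x"
      using 1 2 tt
      by (cases "x \<in> ?B"; cases "x \<in> D"; cases "x \<in> ?T")
        (auto simp: ennreal_plus[symmetric] simp del: ennreal_plus intro!: ennreal_leI)
  qed
  also have "\<dots> = (\<integral>\<^sup>+x. ennreal (norm x^2) * indicator (D \<inter> ?B) x \<partial>lborel) + ennreal (s^2) * ennreal \<beta>"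
    by (subst nn_integral_add) (simp_all add: nn_integral_cmult_indicator e1)
  also have "ennreal (s^2) * ennreal \<beta> = (\<integral>\<^sup>+x. ennreal (s^2) * indicator (D - ?B) x \<partial>lborel)"
    by (simp add: nn_integral_cmult_indicator e2)
  also have "(\<integral>\<^sup>+x. ennreal (norm x^2) * indicator (D \<inter> ?B) x \<partial>lborel) + (\<integral>\<^sup>+x. ennreal (s^2) * indicator (D - ?B) x \<partial>lborel)
    = (\<integral>\<^sup>+x. ennreal (norm x^2) * indicator (D \<inter> ?B) x + ennreal (s^2) * indicator (D - ?B) x \<partial>lborel)"
    by (rule nn_integral_add[symmetric]) measurable
  also have "\<dots> \<le> (\<integral>\<^sup>+x. ennreal (min (norm x^2) C) * indicator D x \<partial>lborel)"
  proof (rule nn_integral_mono)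
    fix x
    have 1: "norm x^2 \<le> C" if "x \<in> ?B" using that C power_mono[of "norm x" s 2] by auto
    have 2: "s^2 \<le> norm x^2" if "x \<notin> ?B" using that s by (intro power_mono) auto
    show "ennreal (norm x^2) * indicator (D \<inter> ?B) x + ennreal (s^2) * indicator (D - ?B) x \<le> ennreal (min (norm x^2) C) * indicator D x"
      using 1 2 C by (cases "x \<in> ?B"; cases "x \<in> D") (auto intro!: ennreal_leI)
  qed
  finally show ?thesis .
qed

text \<open>For \<open>h > 0\<close> this is half the volume of the symmetric difference, as the two
  sets have equal volume.\<close>

definition level_defect :: "('a::euclidean_space \<Rightarrow> real) \<Rightarrow> real \<Rightarrow> real" where
  "level_defect f h = measure lborel (ball 0 (radius_of_volume TYPE('a) (superlevel f h)) - {x. h < f x})"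

lemma level_defect_nonneg[simp]: "0 \<le> level_defect f h" by (simp add: level_defect_def)

lemma emeasure_level_defect:
  fixes f :: "'a::euclidean_space \<Rightarrow> real"
  assumes f: "bounded_density A f" and h: "0 < h"
  shows "ennreal (level_defect f h) = (\<integral>\<^sup>+x. indicator (star_levels f x) h * (1 - indicator {0<..<f x} h) \<partial>lborel)"
    "ennreal (2 * level_defect f h) = (\<integral>\<^sup>+x. ennreal \<bar>indicator {0<..<f x} h - indicator (star_levels f x) h\<bar> \<partial>lborel)"
    "level_defect f h \<le> superlevel f h"
proof -
  note [measurable] = bounded_densityD(1)[OF f]
  let ?B = "ball (0::'a) (radius_of_volume TYPE('a) (superlevel f h))" and ?D = "{x. h < f x}"
  have B: "?B = {x. ball_volume x < superlevel f h}" by (simp add: ball_volume_sublevel)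
  have eB: "emeasure lborel ?B = ennreal (superlevel f h)" by (simp add: emeasure_ball_radius_of_volume)
  have D: "?D \<in> sets borel" by measurable
  have BD: "?B - ?D \<in> sets borel" "?D - ?B \<in> sets borel" using D by (auto intro!: sets.Diff)
  have fm: "?D \<in> fmeasurable lborel" "?B \<in> fmeasurable lborel"
    using D eB emeasure_superlevel[OF f h] by (auto simp: fmeasurable_def)
  have mD: "measure lborel ?D = superlevel f h" "measure lborel ?B = superlevel f h"
    using eB by (auto simp: measure_def superlevel_def)
  have e1: "emeasure lborel (?B - ?D) = ennreal (level_defect f h)"
    unfolding level_defect_def using fm by (intro emeasure_eq_measure2 fmeasurable_Diff) auto
  have "measure lborel (?D - ?B) = measure lborel ?D - measure lborel (?D \<inter> ?B)"
    using fm by (intro measure_Diff_Int) auto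
  moreover have "level_defect f h = measure lborel ?B - measure lborel (?B \<inter> ?D)"
    unfolding level_defect_def using fm by (intro measure_Diff_Int) auto
  ultimately have m2: "measure lborel (?D - ?B) = level_defect f h" using mD by (simp add: Int_commute)
  have e2: "emeasure lborel (?D - ?B) = ennreal (level_defect f h)"
    unfolding m2[symmetric] using fm by (intro emeasure_eq_measure2 fmeasurable_Diff) auto
  have "(\<integral>\<^sup>+x. indicator (star_levels f x) h * (1 - indicator {0<..<f x} h) \<partial>lborel) = (\<integral>\<^sup>+x. indicator (?B - ?D) x \<partial>lborel)"
    unfolding B by (intro nn_integral_cong) (use h in \<open>auto simp: indicator_def star_levels_def\<close>)
  also have "\<dots> = ennreal (level_defect f h)" using D by (subst nn_integral_indicator) (auto simp: e1)
  finally show "ennreal (level_defect f h) = (\<integral>\<^sup>+x. indicator (star_levels f x) h * (1 - indicator {0<..<f x} h) \<partial>lborel)" ..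
  have "(\<integral>\<^sup>+x. ennreal \<bar>indicator {0<..<f x} h - indicator (star_levels f x) h\<bar> \<partial>lborel) = (\<integral>\<^sup>+x. indicator (?B - ?D) x + indicator (?D - ?B) x \<partial>lborel)"
    unfolding B by (intro nn_integral_cong) (use h in \<open>auto simp: indicator_def star_levels_def\<close>)
  also have "\<dots> = ennreal (level_defect f h) + ennreal (level_defect f h)"
    using BD by (subst nn_integral_add) (auto simp: e1 e2 intro!: borel_measurable_indicator)
  finally show "ennreal (2 * level_defect f h) = (\<integral>\<^sup>+x. ennreal \<bar>indicator {0<..<f x} h - indicator (star_levels f x) h\<bar> \<partial>lborel)"
    by (simp add: ennreal_plus[symmetric] del: ennreal_plus)
  have "measure lborel (?B - ?D) \<le> measure lborel ?B" using fm D by (intro measure_mono_fmeasurable) auto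
  then show "level_defect f h \<le> superlevel f h" using mD by (simp add: level_defect_def)
qed

text \<open>The gain of \<open>bathtub_level\<close> at height \<open>h\<close>; division by zero
  makes it vanish on levels of volume 0.\<close>

definition level_cost :: "('a::euclidean_space \<Rightarrow> real) \<Rightarrow> real \<Rightarrow> real" where
  "level_cost f h = (radius_of_volume TYPE('a) (superlevel f h))^2 * (level_defect f h)^2 / (4 * DIM('a) * superlevel f h)"

lemma level_cost_nonneg[simp]: "0 \<le> level_cost f h"
  by (simp add: level_cost_def)

lemma borel_measurable_radius_of_volume[measurable]: "radius_of_volume TYPE('a::euclidean_space) \<in> borel_measurable borel"
  unfolding radius_of_volume_def[abs_def]
  by (intro borel_measurable_continuous_onI continuous_intros) auto

lemma borel_measurable_star_gap:
  assumes f: "bounded_density A f"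
  shows "(\<lambda>(h, x). indicator (star_levels f x) h * (1 - indicator {0<..<f x} h) :: ennreal) \<in> borel_measurable (borel \<Otimes>\<^sub>M borel)"
proof -
  note [measurable] = bounded_densityD(1)[OF f] star_levels_measurable2[OF bounded_densityD(1)[OF f], where 'b=ennreal]
    borel_measurable_layer(2)[OF bounded_densityD(1)[OF f]]
  have "(\<lambda>p. indicator (star_levels f (fst (snd p, fst p))) (snd (snd p, fst p)) * (1 - indicator {0<..<f (fst (snd p, fst p))} (snd (snd p, fst p))) :: ennreal) \<in> borel_measurable (borel \<Otimes>\<^sub>M borel)"
    by measurable
  then show ?thesis by (simp add: case_prod_beta)
qed

lemma borel_measurable_level_defect:
  assumes f: "bounded_density A f"
  shows "(\<lambda>h. level_defect f h * indicator {0<..} h) \<in> borel_measurable borel"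
proof -
  have eq: "level_defect f h * indicator {0<..} h
    = enn2real (\<integral>\<^sup>+x. indicator (star_levels f x) h * (1 - indicator {0<..<f x} h) \<partial>lborel) * indicator {0<..} h" for h
    by (cases "0 < h") (simp_all add: emeasure_level_defect(1)[OF f, symmetric])
  show ?thesis
    unfolding eq
    using lborel.borel_measurable_nn_integral[of "\<lambda>h x. indicator (star_levels f x) h * (1 - indicator {0<..<f x} h)" borel]
      borel_measurable_star_gap[OF f] by measurable
qed

lemma borel_measurable_level_cost:
  assumes f: "bounded_density A f"
  shows "(\<lambda>h. ennreal (level_cost f h) * indicator {0<..} h) \<in> borel_measurable borel"
proof -
  note [measurable] = borel_measurable_level_defect[OF f] borel_measurable_superlevel[OF bounded_densityD(1)[OF f]]
  have "ennreal (level_cost f h) * indicator {0<..} h = ennreal ((radius_of_volume TYPE('a) (superlevel f h))^2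
      * (level_defect f h * indicator {0<..} h)^2 / (4 * DIM('a) * superlevel f h))" for h
    by (cases "0 < h") (simp_all add: level_cost_def)
  then show ?thesis by simp
qed

text \<open>\<open>bathtub_level\<close> integrated over the heights. The bound on the superlevel
  volumes keeps every radius at most \<open>R\<close>, so one cap \<open>C\<close> serves for all
  levels.\<close>

lemma moment_gap:
  fixes f :: "'a::euclidean_space \<Rightarrow> real"
  assumes f: "bounded_density A f"
    and R: "0 \<le> R" "\<And>h. 0 < h \<Longrightarrow> superlevel f h \<le> unit_ball_vol DIM('a) * R ^ DIM('a)" and C: "R^2 \<le> C"
  shows "(\<integral>\<^sup>+x. ennreal (norm x^2) * ennreal (rearrangement f x) \<partial>lborel) + (\<integral>\<^sup>+h. ennreal (level_cost f h) * indicator {0<..} h \<partial>lborel)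
    \<le> (\<integral>\<^sup>+x. ennreal (min (norm x^2) C) * ennreal (f x) \<partial>lborel)"
proof -
  note [measurable] = bounded_densityD(1)[OF f] borel_measurable_level_cost[OF f] star_levels_measurable2[OF bounded_densityD(1)[OF f], where 'b=ennreal]
  let ?q = "\<lambda>x::'a. ennreal (norm x^2)"
  let ?q' = "\<lambda>x::'a. ennreal (min (norm x^2) C)"
  have "(\<lambda>p. ?q (fst (snd p, fst p)) * indicator (star_levels f (fst (snd p, fst p))) (snd (snd p, fst p))) \<in> borel_measurable (borel \<Otimes>\<^sub>M borel)"
    by measurable
  then have "(\<lambda>(h, x). ?q x * indicator (star_levels f x) h) \<in> borel_measurable (borel \<Otimes>\<^sub>M lborel)"
    by (simp add: case_prod_beta)
  then have m: "(\<lambda>h. \<integral>\<^sup>+x. ?q x * indicator (star_levels f x) h \<partial>lborel) \<in> borel_measurable borel"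
    by (rule lborel.borel_measurable_nn_integral)
  have "(\<integral>\<^sup>+x. ?q x * ennreal (rearrangement f x) \<partial>lborel) + (\<integral>\<^sup>+h. ennreal (level_cost f h) * indicator {0<..} h \<partial>lborel)
    = (\<integral>\<^sup>+h. (\<integral>\<^sup>+x. ?q x * indicator (star_levels f x) h \<partial>lborel) + ennreal (level_cost f h) * indicator {0<..} h \<partial>lborel)"
    using m by (subst nn_integral_add) (auto simp: nn_integral_rearrangement_layers[OF f])
  also have "\<dots> \<le> (\<integral>\<^sup>+h. \<integral>\<^sup>+x. ?q' x * indicator {0<..<f x} h \<partial>lborel \<partial>lborel)"
  proof (rule nn_integral_mono)
    fix h :: real
    show "(\<integral>\<^sup>+x. ?q x * indicator (star_levels f x) h \<partial>lborel) + ennreal (level_cost f h) * indicator {0<..} h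
      \<le> (\<integral>\<^sup>+x. ?q' x * indicator {0<..<f x} h \<partial>lborel)"
    proof (cases "0 < h \<and> superlevel f h \<noteq> 0")
      case False
      then have "indicator (star_levels f x) h = (0::ennreal)" for x
        using ball_volume_nonneg[of x] by (auto simp: star_levels_def not_less[symmetric])
      then show ?thesis using False by (auto simp: level_cost_def)
    next
      case True
      then have h: "0 < h" and a: "0 < superlevel f h" using superlevel_nonneg[of f h] by linarith+
      let ?s = "radius_of_volume TYPE('a) (superlevel f h)"
      have s: "0 \<le> ?s" "unit_ball_vol DIM('a) * ?s ^ DIM('a) = superlevel f h"
        using radius_of_volume[of "superlevel f h", where 'a='a] by auto
      have "unit_ball_vol DIM('a) * ?s ^ DIM('a) \<le> unit_ball_vol DIM('a) * R ^ DIM('a)"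
        unfolding s by (rule R(2)[OF h])
      then have "?s ^ DIM('a) \<le> R ^ DIM('a)" by (rule mult_left_le_imp_le[OF _ unit_ball_vol_DIM_pos])
      then have "?s \<le> R" using power_mono_iff[OF s(1) R(1) DIM_positive[where 'a='a]] by simp
      then have sC: "?s^2 \<le> C" using s(1) C power_mono[of ?s R 2] by linarith
      have D: "{x. h < f x} \<in> sets borel" by measurable
      have 1: "(\<integral>\<^sup>+x. ?q x * indicator (star_levels f x) h \<partial>lborel) = (\<integral>\<^sup>+x. ?q x * indicator (ball 0 ?s) x \<partial>lborel)"
        by (simp add: indicator_star_levels(1)[OF h] ball_volume_sublevel)
      have 2: "(\<integral>\<^sup>+x. ?q' x * indicator {0<..<f x} h \<partial>lborel) = (\<integral>\<^sup>+x. ?q' x * indicator {x. h < f x} x \<partial>lborel)"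
        by (rule nn_integral_cong) (use h in \<open>auto simp: indicator_def\<close>)
      show ?thesis
        using bathtub_level[OF D emeasure_superlevel[OF f h] a sC] h
        unfolding 1 2 by (simp add: level_cost_def level_defect_def)
    qed
  qed
  also have "\<dots> = (\<integral>\<^sup>+x. ?q' x * ennreal (f x) \<partial>lborel)"
    by (rule nn_integral_layer_cake[OF f, symmetric]) measurable
  finally show ?thesis .
qed

lemma L1_dist_rearrangement_le:
  fixes f :: "'a::euclidean_space \<Rightarrow> real"
  assumes f: "bounded_density A f"
  shows "(\<integral>\<^sup>+x. ennreal \<bar>f x - rearrangement f x\<bar> \<partial>lborel) \<le> 2 * (\<integral>\<^sup>+h. ennreal (level_defect f h) * indicator {0<..} h \<partial>lborel)"
proof -
  note [measurable] = bounded_densityD(1)[OF f] star_levels_measurable2[OF bounded_densityD(1)[OF f], where 'b=real]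
    borel_measurable_layer(1)[OF bounded_densityD(1)[OF f]]
  let ?l = "\<lambda>x h. ennreal \<bar>indicator {0<..<f x} h - indicator (star_levels f x) h\<bar>"
  have ml: "(\<lambda>(x, h). ?l x h) \<in> borel_measurable (borel \<Otimes>\<^sub>M borel)"
    unfolding case_prod_beta by measurable
  have md: "(\<lambda>h. ennreal (level_defect f h) * indicator {0<..} h) \<in> borel_measurable borel"
  proof -
    have "ennreal (level_defect f h) * indicator {0<..} h = ennreal (level_defect f h * indicator {0<..} h)" for h
      by (cases "0 < h") simp_all
    then show ?thesis using borel_measurable_level_defect[OF f] by simp
  qed
  have "(\<integral>\<^sup>+x. ennreal \<bar>f x - rearrangement f x\<bar> \<partial>lborel) \<le> (\<integral>\<^sup>+x. \<integral>\<^sup>+h. ?l x h \<partial>lborel \<partial>lborel)"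
    by (intro nn_integral_mono abs_diff_rearrangement_le[OF f])
  also have "\<dots> = (\<integral>\<^sup>+h. \<integral>\<^sup>+x. ?l x h \<partial>lborel \<partial>lborel)"
    using ml by (intro lborel_pair.Fubini'[symmetric]) simp
  also have "\<dots> = (\<integral>\<^sup>+h. 2 * (ennreal (level_defect f h) * indicator {0<..} h) \<partial>lborel)"
  proof (rule nn_integral_cong)
    fix h :: real
    show "(\<integral>\<^sup>+x. ?l x h \<partial>lborel) = 2 * (ennreal (level_defect f h) * indicator {0<..} h)"
    proof (cases "0 < h")
      case True
      then show ?thesis unfolding emeasure_level_defect(2)[OF f True, symmetric] by (simp add: ennreal_mult)
    qed (simp add: indicator_star_levels)
  qed
  also have "\<dots> = 2 * (\<integral>\<^sup>+h. ennreal (level_defect f h) * indicator {0<..} h \<partial>lborel)"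
    using md by (subst nn_integral_cmult) auto
  finally show ?thesis .
qed

lemma nn_integral_superlevel_eq:
  assumes f: "bounded_density A f"
  shows "(\<integral>\<^sup>+h. ennreal (superlevel f h) * indicator {0<..} h \<partial>lborel) = (\<integral>\<^sup>+x. ennreal (f x) \<partial>lborel)"
proof -
  have "(\<integral>\<^sup>+x. ennreal (f x) \<partial>lborel) = (\<integral>\<^sup>+h. \<integral>\<^sup>+x. indicator {0<..<f x} h \<partial>lborel \<partial>lborel)"
    using nn_integral_layer_cake[OF f, of "\<lambda>_. 1"] by simp
  also have "\<dots> = (\<integral>\<^sup>+h. ennreal (superlevel f h) * indicator {0<..} h \<partial>lborel)"
  proof (rule nn_integral_cong)
    fix h :: real
    show "(\<integral>\<^sup>+x. indicator {0<..<f x} h \<partial>lborel) = ennreal (superlevel f h) * indicator {0<..} h"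
      by (cases "0 < h") (simp_all add: nn_integral_superlevel[OF f])
  qed
  finally show ?thesis by simp
qed

text \<open>The weight is \<open>P = s^2 / a\<close>, for which \<open>P * \<beta>^2\<close> is the
  cost up to the factor \<open>4 * n\<close>. The hypothesis \<open>H\<close> trades
  \<open>1 / P\<close> for \<open>(c + a) / \<tau>^2\<close>, whose integral over the heights can be
  computed from the mass.\<close>

lemma level_cost_tangent:
  fixes f :: "'a::euclidean_space \<Rightarrow> real"
  assumes f: "bounded_density A f" and h: "0 < h" and \<tau>: "0 < \<tau>" and l: "0 \<le> l" and c: "0 \<le> c"
    and H: "superlevel f h * \<tau>^2 \<le> (c + superlevel f h) * (radius_of_volume TYPE('a) (superlevel f h))^2"
  shows "2 * l * level_defect f h \<le> 4 * DIM('a) * level_cost f h + l^2 / \<tau>^2 * (c + superlevel f h)"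
proof (cases "superlevel f h = 0")
  case True
  then have "level_defect f h = 0" using emeasure_level_defect(3)[OF f h] level_defect_nonneg[of f h] by linarith
  then show ?thesis using c True by (simp add: level_cost_def)
next
  case False
  let ?a = "superlevel f h" and ?s = "radius_of_volume TYPE('a) (superlevel f h)" and ?\<beta> = "level_defect f h"
  have a: "0 < ?a" using False superlevel_nonneg[of f h] by linarith
  have "2 * l * ?\<beta> \<le> ?s^2 * ?\<beta>^2 / ?a + l^2 * (?a / ?s^2)" if s: "?s \<noteq> 0"
  proof -
    define P where "P = ?s^2 / ?a"
    have P: "0 < P" using a s by (simp add: P_def)
    have "0 \<le> (P * ?\<beta> - l)^2" by simp
    then have "2 * l * ?\<beta> * P \<le> (?\<beta>^2 * P + l^2 / P) * P"
      using P by (simp add: power2_eq_square algebra_simps)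
    then have "2 * l * ?\<beta> \<le> ?\<beta>^2 * P + l^2 / P" using P by simp
    then show ?thesis by (simp add: P_def mult.commute)
  qed
  moreover have s: "?s \<noteq> 0"
    using radius_of_volume(2)[of ?a, where 'a='a] a by (auto simp: zero_power)
  moreover have "?a / ?s^2 \<le> (c + ?a) / \<tau>^2" using H \<tau> s by (simp add: field_simps)
  then have "l^2 * (?a / ?s^2) \<le> l^2 / \<tau>^2 * (c + ?a)" using mult_left_mono[of "?a / ?s^2" "(c + ?a) / \<tau>^2" "l^2"] by simp
  moreover have "4 * DIM('a) * level_cost f h = ?s^2 * ?\<beta>^2 / ?a" by (simp add: level_cost_def)
  ultimately show ?thesis by linarith
qed

text \<open>With \<open>c = m / A\<close> the integral of \<open>c + superlevel f h\<close> over the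
  heights in \<open>(0, A)\<close> is \<open>2 * m\<close>. Hence \<open>2 * l * m * d\<close> is at
  most \<open>4 * n\<close> times the total cost plus \<open>2 * m * l^2 / \<tau>^2\<close>, for
  every slope \<open>l\<close>.\<close>

lemma level_cost_ge_square:
  fixes f :: "'a::euclidean_space \<Rightarrow> real"
  assumes f: "bounded_density A f" and A: "0 < A" and m: "(\<integral>\<^sup>+x. ennreal (f x) \<partial>lborel) = ennreal m" "0 < m" and \<tau>: "0 < \<tau>"
    and d: "0 \<le> d" "ennreal (m * d) \<le> (\<integral>\<^sup>+h. ennreal (level_defect f h) * indicator {0<..} h \<partial>lborel)"
    and H: "\<And>h. 0 < h \<Longrightarrow> h < A \<Longrightarrow> superlevel f h * \<tau>^2 \<le> (m / A + superlevel f h) * (radius_of_volume TYPE('a) (superlevel f h))^2"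
  shows "ennreal (m * d^2 * \<tau>^2 / (8 * DIM('a))) \<le> (\<integral>\<^sup>+h. ennreal (level_cost f h) * indicator {0<..} h \<partial>lborel)"
proof -
  let ?X = "\<integral>\<^sup>+h. ennreal (level_cost f h) * indicator {0<..} h \<partial>lborel"
  let ?n = "real DIM('a)"
  \<comment> \<open>The maximizer of \<open>2 * l * m * d - 2 * m * l^2 / \<tau>^2\<close>; the
    maximum is \<open>m * d^2 * \<tau>^2 / 2\<close>.\<close>
  define l where "l = d * \<tau>^2 / 2"
  have l: "0 \<le> l" using d by (simp add: l_def)
  have n: "0 < ?n" using DIM_positive[where 'a='a] by simp
  note [measurable] = borel_measurable_level_cost[OF f] borel_measurable_superlevel[OF bounded_densityD(1)[OF f]]
  have "ennreal (2 * l) * ennreal (m * d) \<le> ennreal (2 * l) * (\<integral>\<^sup>+h. ennreal (level_defect f h) * indicator {0<..} h \<partial>lborel)"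
    by (intro mult_left_mono d) simp
  also have "\<dots> = (\<integral>\<^sup>+h. ennreal (2 * l) * (ennreal (level_defect f h) * indicator {0<..} h) \<partial>lborel)"
  proof -
    have "ennreal (level_defect f h) * indicator {0<..} h = ennreal (level_defect f h * indicator {0<..} h)" for h
      by (cases "0 < h") simp_all
    then show ?thesis using borel_measurable_level_defect[OF f] by (subst nn_integral_cmult) auto
  qed
  also have "\<dots> \<le> (\<integral>\<^sup>+h. ennreal (4 * ?n) * (ennreal (level_cost f h) * indicator {0<..} h) +
      ennreal (l^2 / \<tau>^2) * (ennreal (m / A) * indicator {0<..<A} h + ennreal (superlevel f h) * indicator {0<..} h) \<partial>lborel)"
  proof (rule nn_integral_mono)
    fix h :: real
    consider "h \<le> 0" | "A \<le> h" "0 < h" | "0 < h" "h < A" by linarith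
    then show "ennreal (2 * l) * (ennreal (level_defect f h) * indicator {0<..} h) \<le>
      ennreal (4 * ?n) * (ennreal (level_cost f h) * indicator {0<..} h) +
      ennreal (l^2 / \<tau>^2) * (ennreal (m / A) * indicator {0<..<A} h + ennreal (superlevel f h) * indicator {0<..} h)"
    proof cases
      case 2
      then have "level_defect f h = 0"
        using emeasure_level_defect(3)[OF f 2(2)] level_defect_nonneg[of f h] superlevel_eq_0[OF f 2(1)] by linarith
      then show ?thesis by simp
    next
      case 3
      have "2 * l * level_defect f h \<le> 4 * ?n * level_cost f h + l^2 / \<tau>^2 * (m / A + superlevel f h)"
        using level_cost_tangent[OF f 3(1) \<tau> l _ H[OF 3]] m A by simp
      then have "ennreal (2 * l * level_defect f h) \<le> ennreal (4 * ?n * level_cost f h + l^2 / \<tau>^2 * (m / A + superlevel f h))"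
        by (rule ennreal_leI)
      also have "\<dots> = ennreal (4 * ?n) * ennreal (level_cost f h) + ennreal (l^2 / \<tau>^2) * (ennreal (m / A) + ennreal (superlevel f h))"
        using m A by (subst ennreal_plus) (auto simp: ennreal_mult[symmetric] ennreal_plus[symmetric] simp del: ennreal_plus)
      finally show ?thesis using 3 l by (simp add: ennreal_mult)
    qed simp
  qed
  also have "\<dots> = ennreal (4 * ?n) * ?X + ennreal (l^2 / \<tau>^2) * (ennreal (m / A) * ennreal A + ennreal m)"
    using A by (simp add: nn_integral_add nn_integral_cmult nn_integral_superlevel_eq[OF f] m(1))
  also have "ennreal (l^2 / \<tau>^2) * (ennreal (m / A) * ennreal A + ennreal m) = ennreal (l^2 / \<tau>^2 * (2 * m))"
    using A m by (simp add: ennreal_mult[symmetric] ennreal_plus[symmetric] del: ennreal_plus)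
  finally have *: "ennreal (2 * l) * ennreal (m * d) \<le> ennreal (4 * ?n) * ?X + ennreal (l^2 / \<tau>^2 * (2 * m))" .
  show ?thesis
  proof (cases ?X)
    case (real x)
    have "ennreal (2 * l * (m * d)) \<le> ennreal (4 * ?n * x + l^2 / \<tau>^2 * (2 * m))"
      using * real l m d n by (simp add: ennreal_mult ennreal_plus)
    then have "2 * l * (m * d) \<le> 4 * ?n * x + l^2 / \<tau>^2 * (2 * m)"
      using real m n by (subst (asm) ennreal_le_iff) (auto intro!: add_nonneg_nonneg)
    moreover have "2 * l * (m * d) = m * d^2 * \<tau>^2" by (simp add: l_def power2_eq_square)
    moreover have "l^2 / \<tau>^2 * (2 * m) = m * d^2 * \<tau>^2 / 2" using \<tau> by (simp add: l_def power2_eq_square field_simps)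
    ultimately have "m * d^2 * \<tau>^2 \<le> 8 * ?n * x" by linarith
    then have "m * d^2 * \<tau>^2 / (8 * ?n) \<le> x" using n by (simp add: field_simps)
    then show ?thesis using real by (simp add: ennreal_leI)
  qed simp
qed

text \<open>On the line \<open>s = a / 2\<close>, so the cost is \<open>a * \<beta>^2 / 16\<close>,
  and \<open>\<beta> \<le> a\<close> bounds it below by \<open>\<beta>^3 / 16\<close> whatever the
  size of the level. Convexity of the cube on the heights in \<open>(0, A)\<close> does the
  rest.\<close>

lemma level_cost_ge_cube:
  fixes f :: "'a::euclidean_space \<Rightarrow> real"
  assumes f: "bounded_density A f" and A: "0 < A" and m: "0 < m" and dim: "DIM('a) = 1"
    and d: "0 \<le> d" "ennreal (m * d) \<le> (\<integral>\<^sup>+h. ennreal (level_defect f h) * indicator {0<..} h \<partial>lborel)"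
  shows "ennreal (m^3 * d^3 / (16 * A^2)) \<le> (\<integral>\<^sup>+h. ennreal (level_cost f h) * indicator {0<..} h \<partial>lborel)"
proof -
  let ?X = "\<integral>\<^sup>+h. ennreal (level_cost f h) * indicator {0<..} h \<partial>lborel"
  \<comment> \<open>A lower bound for the mean of \<open>level_defect f\<close> over
    \<open>(0, A)\<close>; using the tangent to the cube at this point amounts to Jensen's
    inequality.\<close>
  define l where "l = m * d / A"
  have l: "0 \<le> l" using d A m by (simp add: l_def)
  note [measurable] = borel_measurable_level_cost[OF f]
  have pt: "3 * l^2 * level_defect f h \<le> 16 * level_cost f h + 2 * l^3" if h: "0 < h" for h
  proof -
    let ?a = "superlevel f h" and ?s = "radius_of_volume TYPE('a) (superlevel f h)" and ?\<beta> = "level_defect f h"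
    have s: "?s = ?a / 2" using radius_of_volume(2)[of ?a, where 'a='a] by (simp add: dim)
    have "?\<beta>^3 = ?\<beta>^2 * ?\<beta>" by (simp add: power3_eq_cube power2_eq_square)
    also have "\<dots> \<le> ?\<beta>^2 * ?a" by (intro mult_left_mono emeasure_level_defect(3)[OF f h]) simp
    also have "\<dots> = 16 * level_cost f h" by (simp add: level_cost_def s dim power2_eq_square)
    finally have 1: "?\<beta>^3 \<le> 16 * level_cost f h" .
    have "0 \<le> (?\<beta> - l)^2 * (?\<beta> + 2 * l)" using l by simp
    also have "(?\<beta> - l)^2 * (?\<beta> + 2 * l) = ?\<beta>^3 + 2 * l^3 - 3 * l^2 * ?\<beta>" by (simp add: power2_eq_square power3_eq_cube algebra_simps)
    finally show ?thesis using 1 by linarith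
  qed
  have "ennreal (3 * l^2) * ennreal (m * d) \<le> ennreal (3 * l^2) * (\<integral>\<^sup>+h. ennreal (level_defect f h) * indicator {0<..} h \<partial>lborel)"
    by (intro mult_left_mono d) simp
  also have "\<dots> = (\<integral>\<^sup>+h. ennreal (3 * l^2) * (ennreal (level_defect f h) * indicator {0<..} h) \<partial>lborel)"
  proof -
    have "ennreal (level_defect f h) * indicator {0<..} h = ennreal (level_defect f h * indicator {0<..} h)" for h
      by (cases "0 < h") simp_all
    then show ?thesis using borel_measurable_level_defect[OF f] by (subst nn_integral_cmult) auto
  qed
  also have "\<dots> \<le> (\<integral>\<^sup>+h. ennreal 16 * (ennreal (level_cost f h) * indicator {0<..} h) + ennreal (2 * l^3) * indicator {0<..<A} h \<partial>lborel)"
  proof (rule nn_integral_mono)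
    fix h :: real
    consider "h \<le> 0" | "A \<le> h" "0 < h" | "0 < h" "h < A" by linarith
    then show "ennreal (3 * l^2) * (ennreal (level_defect f h) * indicator {0<..} h) \<le>
      ennreal 16 * (ennreal (level_cost f h) * indicator {0<..} h) + ennreal (2 * l^3) * indicator {0<..<A} h"
    proof cases
      case 2
      then have "level_defect f h = 0"
        using emeasure_level_defect(3)[OF f 2(2)] level_defect_nonneg[of f h] superlevel_eq_0[OF f 2(1)] by linarith
      then show ?thesis by simp
    next
      case 3
      have "ennreal (3 * l^2 * level_defect f h) \<le> ennreal (16 * level_cost f h + 2 * l^3)" by (intro ennreal_leI pt 3)
      also have "\<dots> = ennreal 16 * ennreal (level_cost f h) + ennreal (2 * l^3)"
        using l by (subst ennreal_plus) (auto simp: ennreal_mult)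
      finally show ?thesis using 3 l by (simp add: ennreal_mult)
    qed simp
  qed
  also have "\<dots> = ennreal 16 * ?X + ennreal (2 * l^3) * ennreal A"
    using A by (subst nn_integral_add) (simp_all add: nn_integral_cmult nn_integral_cmult_indicator)
  finally have *: "ennreal (3 * l^2) * ennreal (m * d) \<le> ennreal 16 * ?X + ennreal (2 * l^3) * ennreal A" .
  show ?thesis
  proof (cases ?X)
    case (real x)
    have "ennreal (3 * l^2 * (m * d)) \<le> ennreal (16 * x + 2 * l^3 * A)"
      using * unfolding real(2) using real(1) l m d A by (simp only: ennreal_mult ennreal_plus mult_nonneg_nonneg zero_le_power zero_le_numeral less_imp_le add_nonneg_nonneg)
    then have "3 * l^2 * (m * d) \<le> 16 * x + 2 * l^3 * A"
      using real l A by (subst (asm) ennreal_le_iff) (auto intro!: add_nonneg_nonneg)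
    moreover have "3 * l^2 * (m * d) = 3 * (m^3 * d^3 / A^2)" "2 * l^3 * A = 2 * (m^3 * d^3 / A^2)"
      using A by (auto simp: l_def power2_eq_square power3_eq_cube field_simps)
    ultimately have "m^3 * d^3 / A^2 \<le> 16 * x" by linarith
    then have "m^3 * d^3 / (16 * A^2) \<le> x" using A by (simp add: field_simps)
    then show ?thesis using real by (simp add: ennreal_leI)
  qed simp
qed

section \<open>The quadratic kernel\<close>

text \<open>\<open>ennreal\<close> sends negative numbers to 0, so for \<open>r \<ge> 0\<close> this
  is the positive part of \<open>M^2 - r^2\<close>.\<close>

definition quad_kernel :: "real \<Rightarrow> real \<Rightarrow> ennreal" where
  "quad_kernel M r = ennreal (M^2 - (max 0 r)^2)"

lemma borel_measurable_quad_kernel[measurable]: "quad_kernel M \<in> borel_measurable borel"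
  unfolding quad_kernel_def[abs_def] by measurable

lemma quad_kernel_norm: "quad_kernel M (norm x) = ennreal (M^2 - norm x^2)"
  by (simp add: quad_kernel_def max_def)

definition potential_of :: "(real \<Rightarrow> ennreal) \<Rightarrow> ('a::euclidean_space \<Rightarrow> real) \<Rightarrow> 'a \<Rightarrow> ennreal" where
  "potential_of k f x = (\<integral>\<^sup>+y. ennreal (f y) * k (norm (x - y)) \<partial>lborel)"

lemma borel_measurable_potential_of[measurable]:
  assumes [measurable]: "f \<in> borel_measurable borel" "k \<in> borel_measurable borel"
  shows "potential_of k f \<in> borel_measurable borel"
  unfolding potential_of_def[abs_def] by measurable

lemma interaction_eq_potential:
  assumes [measurable]: "f \<in> borel_measurable borel" "k \<in> borel_measurable borel" and f: "\<And>x. 0 \<le> f x"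
  shows "interaction k f = (\<integral>\<^sup>+x. ennreal (f x) * potential_of k f x \<partial>lborel)"
  unfolding interaction_def potential_of_def
  by (subst nn_integral_cmult[symmetric]) (simp_all add: ennreal_mult f mult.assoc)

lemma nn_integral_uminus:
  assumes [measurable]: "f \<in> borel_measurable borel"
  shows "(\<integral>\<^sup>+x. f (- x) \<partial>lborel) = (\<integral>\<^sup>+x. f x \<partial>(lborel :: 'a::euclidean_space measure))"
proof -
  have "(lborel :: 'a measure) = density (distr lborel borel (\<lambda>x. 0 + (-1) *\<^sub>R x)) (\<lambda>_. ennreal (\<bar>-1\<bar> ^ DIM('a)))"
    by (rule lborel_affine) simp
  then have "(lborel :: 'a measure) = distr lborel borel uminus" by (simp add: density_1)
  then have "(\<integral>\<^sup>+x. f x \<partial>lborel) = (\<integral>\<^sup>+x. f x \<partial>distr lborel borel uminus)" by simp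
  also have "\<dots> = (\<integral>\<^sup>+x. f (- x) \<partial>lborel)" by (subst nn_integral_distr) auto
  finally show ?thesis by simp
qed

lemma rearrangement_uminus: "bounded_density A f \<Longrightarrow> rearrangement f (- x) = rearrangement f x"
  by (simp add: rearrangement_eq_measure star_levels_def ball_volume_def)

text \<open>The rearrangement is even, so \<open>|x - y|^2\<close> and \<open>|x + y|^2\<close> have
  the same integral, and the parallelogram law removes the cross term with nonnegative integrands
  only. Points of its support are at distance at most \<open>2 * R \<le> M\<close>, where the kernel
  and \<open>|x - y|^2\<close> add up to \<open>M^2\<close>.\<close>

lemma interaction_quad_rearrangement_ge:
  fixes f :: "'a::euclidean_space \<Rightarrow> real"
  assumes f: "bounded_density A f" and m: "(\<integral>\<^sup>+x. ennreal (f x) \<partial>lborel) = ennreal m" "0 \<le> m"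
    and supp: "\<And>x. R < norm x \<Longrightarrow> rearrangement f x = 0" and R: "0 \<le> R" "2 * R \<le> M"
  shows "ennreal (M^2 * m^2) \<le> interaction (quad_kernel M) (rearrangement f)
    + 2 * (ennreal m * (\<integral>\<^sup>+x. ennreal (norm x^2) * ennreal (rearrangement f x) \<partial>lborel))"
proof -
  let ?g = "rearrangement f"
  let ?I = "\<integral>\<^sup>+x. ennreal (norm x^2) * ennreal (?g x) \<partial>lborel"
  have [measurable]: "?g \<in> borel_measurable borel" by (rule borel_measurable_rearrangement[OF f])
  have g: "0 \<le> ?g x" for x by (rule rearrangement_nonneg[OF f])
  have gm: "(\<integral>\<^sup>+x. ennreal (?g x) \<partial>lborel) = ennreal m" using m by (simp add: nn_integral_rearrangement[OF f])
  define Q where "Q = (\<integral>\<^sup>+x. \<integral>\<^sup>+y. ennreal (?g x) * ennreal (?g y) * ennreal (norm (x - y)^2) \<partial>lborel \<partial>lborel)"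
  have Q': "Q = (\<integral>\<^sup>+x. \<integral>\<^sup>+y. ennreal (?g x) * ennreal (?g y) * ennreal (norm (x + y)^2) \<partial>lborel \<partial>lborel)"
    unfolding Q_def
  proof (rule nn_integral_cong)
    fix x
    have "(\<integral>\<^sup>+y. ennreal (?g x) * ennreal (?g (- y)) * ennreal (norm (x - (- y))^2) \<partial>lborel)
      = (\<integral>\<^sup>+y. ennreal (?g x) * ennreal (?g y) * ennreal (norm (x - y)^2) \<partial>lborel)"
      by (rule nn_integral_uminus) measurable
    then show "(\<integral>\<^sup>+y. ennreal (?g x) * ennreal (?g y) * ennreal (norm (x - y)^2) \<partial>lborel)
      = (\<integral>\<^sup>+y. ennreal (?g x) * ennreal (?g y) * ennreal (norm (x + y)^2) \<partial>lborel)"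
      by (simp add: rearrangement_uminus[OF f])
  qed
  have "Q + Q = (\<integral>\<^sup>+x. \<integral>\<^sup>+y. ennreal (?g x) * ennreal (?g y) * ennreal (norm (x - y)^2)
      + ennreal (?g x) * ennreal (?g y) * ennreal (norm (x + y)^2) \<partial>lborel \<partial>lborel)"
    by (subst (2) Q', subst Q_def) (simp add: nn_integral_add)
  also have "\<dots> = (\<integral>\<^sup>+x. \<integral>\<^sup>+y. 2 * (ennreal (norm x^2) * ennreal (?g x) * ennreal (?g y))
      + 2 * (ennreal (?g x) * (ennreal (norm y^2) * ennreal (?g y))) \<partial>lborel \<partial>lborel)"
  proof (intro nn_integral_cong)
    fix x y :: 'a
    have "ennreal (norm (x - y)^2) + ennreal (norm (x + y)^2) = ennreal (2 * norm x^2 + 2 * norm y^2)"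
    proof -
      have "norm (x - y)^2 + norm (x + y)^2 = 2 * norm x^2 + 2 * norm y^2"
        unfolding power2_norm_eq_inner by (simp add: inner_diff_left inner_diff_right inner_add_left inner_add_right)
      then show ?thesis by (simp add: ennreal_plus[symmetric] del: ennreal_plus)
    qed
    also have "\<dots> = 2 * ennreal (norm x^2) + 2 * ennreal (norm y^2)" by (simp add: ennreal_mult)
    finally have *: "ennreal (norm (x - y)^2) + ennreal (norm (x + y)^2) = 2 * ennreal (norm x^2) + 2 * ennreal (norm y^2)" .
    show "ennreal (?g x) * ennreal (?g y) * ennreal (norm (x - y)^2)
      + ennreal (?g x) * ennreal (?g y) * ennreal (norm (x + y)^2)
      = 2 * (ennreal (norm x^2) * ennreal (?g x) * ennreal (?g y)) + 2 * (ennreal (?g x) * (ennreal (norm y^2) * ennreal (?g y)))"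
      unfolding distrib_left[symmetric] * by (simp add: distrib_left ac_simps)
  qed
  also have "\<dots> = 2 * (?I * ennreal m) + 2 * (ennreal m * ?I)"
    by (simp add: nn_integral_add nn_integral_cmult nn_integral_multc gm)
  also have "\<dots> = 2 * (2 * (ennreal m * ?I))" by (simp only: mult_2 mult.commute[of ?I])
  finally have "2 * Q = 2 * (2 * (ennreal m * ?I))" by (simp only: mult_2)
  then have Q: "Q = 2 * (ennreal m * ?I)" by (subst (asm) ennreal_mult_cancel_left) auto
  have "ennreal (M^2 * m^2) = (\<integral>\<^sup>+x. \<integral>\<^sup>+y. ennreal (M^2) * (ennreal (?g x) * ennreal (?g y)) \<partial>lborel \<partial>lborel)"
    using m(2) by (simp add: nn_integral_cmult nn_integral_multc gm ennreal_mult power2_eq_square)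
  also have "\<dots> \<le> (\<integral>\<^sup>+x. \<integral>\<^sup>+y. ennreal (?g x * ?g y) * quad_kernel M (norm (x - y))
     + ennreal (?g x) * ennreal (?g y) * ennreal (norm (x - y)^2) \<partial>lborel \<partial>lborel)"
  proof (intro nn_integral_mono)
    fix x y :: 'a
    show "ennreal (M^2) * (ennreal (?g x) * ennreal (?g y)) \<le> ennreal (?g x * ?g y) * quad_kernel M (norm (x - y))
     + ennreal (?g x) * ennreal (?g y) * ennreal (norm (x - y)^2)"
    proof (cases "norm x \<le> R \<and> norm y \<le> R")
      case True
      then have "norm (x - y) \<le> M" using norm_triangle_ineq4[of x y] R by linarith
      then have "norm (x - y)^2 \<le> M^2" by (rule power_mono) simp
      then have "quad_kernel M (norm (x - y)) + ennreal (norm (x - y)^2) = ennreal (M^2)"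
        by (simp add: quad_kernel_norm ennreal_plus[symmetric] del: ennreal_plus)
      then have "ennreal (M^2) * (ennreal (?g x) * ennreal (?g y)) = ennreal (?g x * ?g y) * (quad_kernel M (norm (x - y)) + ennreal (norm (x - y)^2))"
        using g by (simp add: ennreal_mult mult.commute)
      then show ?thesis using g by (simp add: distrib_left ennreal_mult)
    next
      case False
      then have "ennreal (?g x) * ennreal (?g y) = 0" using supp[of x] supp[of y] by auto
      then show ?thesis by (simp del: mult_eq_0_iff)
    qed
  qed
  also have "\<dots> = interaction (quad_kernel M) ?g + Q"
    by (simp add: interaction_def Q_def nn_integral_add)
  finally show ?thesis unfolding Q .
qed

text \<open>Seen from any \<open>x\<close>, at least half of the mass lies outside
  \<open>ball x r\<close>, where the kernel is at most \<open>M^2 - r^2\<close>. This bounds the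
  potential uniformly, and integrating it against \<open>f\<close> contributes another factor
  \<open>m\<close>.\<close>

lemma interaction_quad_far_le:
  fixes f :: "'a::euclidean_space \<Rightarrow> real"
  assumes f: "bounded_density A f" and m: "(\<integral>\<^sup>+x. ennreal (f x) \<partial>lborel) = ennreal m" "0 \<le> m"
    and r: "0 \<le> r" "r \<le> M" and far: "\<And>x. (\<integral>\<^sup>+y. ennreal (f y) * indicator (ball x r) y \<partial>lborel) \<le> ennreal (m / 2)"
  shows "interaction (quad_kernel M) f \<le> ennreal (M^2 * m^2 - r^2 * m^2 / 2)"
proof -
  note [measurable] = bounded_densityD(1)[OF f]
  note f0 = bounded_densityD(3)[OF f]
  have rM: "r^2 \<le> M^2" using r by (intro power_mono)
  have pot: "potential_of (quad_kernel M) f x \<le> ennreal (M^2 * m - r^2 * m / 2)" for x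
  proof -
    have [measurable]: "ball x r \<in> sets borel" by simp
    have "potential_of (quad_kernel M) f x \<le> (\<integral>\<^sup>+y. ennreal (M^2 - r^2) * ennreal (f y) + ennreal (r^2) * (ennreal (f y) * indicator (ball x r) y) \<partial>lborel)"
      unfolding potential_of_def
    proof (rule nn_integral_mono)
      fix y
      have "quad_kernel M (norm (x - y)) \<le> ennreal (M^2 - r^2) + ennreal (r^2) * indicator (ball x r) y"
      proof (cases "y \<in> ball x r")
        case True
        then show ?thesis using rM by (simp add: quad_kernel_norm ennreal_plus[symmetric] ennreal_leI del: ennreal_plus)
      next
        case False
        then have "r^2 \<le> norm (x - y)^2" using r by (intro power_mono) (auto simp: dist_norm)
        then show ?thesis using False by (simp add: quad_kernel_norm ennreal_leI)
      qed
      then have "ennreal (f y) * quad_kernel M (norm (x - y)) \<le> ennreal (f y) * (ennreal (M^2 - r^2) + ennreal (r^2) * indicator (ball x r) y)"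
        by (rule mult_left_mono) simp
      then show "ennreal (f y) * quad_kernel M (norm (x - y)) \<le> ennreal (M^2 - r^2) * ennreal (f y) + ennreal (r^2) * (ennreal (f y) * indicator (ball x r) y)"
        by (simp add: distrib_left ac_simps)
    qed
    also have "\<dots> = ennreal (M^2 - r^2) * ennreal m + ennreal (r^2) * (\<integral>\<^sup>+y. ennreal (f y) * indicator (ball x r) y \<partial>lborel)"
      by (simp add: nn_integral_add nn_integral_cmult m(1))
    also have "\<dots> \<le> ennreal (M^2 - r^2) * ennreal m + ennreal (r^2) * ennreal (m / 2)"
      by (intro add_left_mono mult_left_mono far) simp
    also have "\<dots> = ennreal (M^2 * m - r^2 * m / 2)"
    proof -
      have "0 \<le> (M^2 - r^2) * m" "0 \<le> r^2 * (m / 2)" using m(2) rM by auto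
      then have "ennreal ((M^2 - r^2) * m) + ennreal (r^2 * (m / 2)) = ennreal ((M^2 - r^2) * m + r^2 * (m / 2))"
        by (rule ennreal_plus[symmetric])
      moreover have "(M^2 - r^2) * m + r^2 * (m / 2) = M^2 * m - r^2 * m / 2" by (simp add: algebra_simps)
      moreover have "ennreal ((M^2 - r^2) * m) = ennreal (M^2 - r^2) * ennreal m" "ennreal (r^2 * (m / 2)) = ennreal (r^2) * ennreal (m / 2)"
        using m(2) rM by (simp only: ennreal_mult diff_ge_0_iff_ge, intro ennreal_mult) auto
      ultimately show ?thesis by (simp only:)
    qed
    finally show ?thesis .
  qed
  have "interaction (quad_kernel M) f \<le> (\<integral>\<^sup>+x. ennreal (f x) * ennreal (M^2 * m - r^2 * m / 2) \<partial>lborel)"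
    by (subst interaction_eq_potential) (auto intro!: nn_integral_mono mult_left_mono pot f0)
  also have "\<dots> = ennreal m * ennreal (M^2 * m - r^2 * m / 2)" by (simp add: nn_integral_multc m(1))
  also have "\<dots> = ennreal (M^2 * m^2 - r^2 * m^2 / 2)"
    using m(2) by (simp add: ennreal_mult'[symmetric] power2_eq_square algebra_simps)
  finally show ?thesis .
qed

text \<open>The parallel axis theorem: the cross term \<open>(y - b) \<bullet> (x - b)\<close>
  integrates to zero because \<open>b\<close> is the barycentre. The bound \<open>K\<close> on the
  support makes the moments integrable.\<close>

lemma integral_sq_dist_barycenter:
  fixes g :: "'a::euclidean_space \<Rightarrow> real"
  assumes g: "integrable lborel g" "\<And>x. 0 \<le> g x" "\<And>x. norm x > K \<Longrightarrow> g x = 0"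
    and pos: "0 < (LINT x|lborel. g x)"
  defines "b \<equiv> (1 / (LINT x|lborel. g x)) *\<^sub>R (LINT x|lborel. g x *\<^sub>R x)"
  shows "integrable lborel (\<lambda>y. g y * norm (x - y)^2)"
    "(LINT y|lborel. g y * norm (x - y)^2) = (LINT y|lborel. g y) * norm (x - b)^2 + (LINT y|lborel. g y * norm (y - b)^2)"
proof -
  let ?m = "LINT x|lborel. g x"
  have [measurable]: "g \<in> borel_measurable borel" using g(1) by auto
  have int: "integrable lborel (\<lambda>y. g y * norm (x - y)^2)" for x
  proof (rule Bochner_Integration.integrable_bound)
    show "integrable lborel (\<lambda>y. (norm x + \<bar>K\<bar>)^2 * g y)" using g(1) by simp
    show "AE y in lborel. norm (g y * norm (x - y)^2) \<le> norm ((norm x + \<bar>K\<bar>)^2 * g y)"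
    proof (intro AE_I2)
      fix y
      show "norm (g y * norm (x - y)^2) \<le> norm ((norm x + \<bar>K\<bar>)^2 * g y)"
      proof (cases "norm y > K")
        case False
        then have "norm (x - y) \<le> norm x + \<bar>K\<bar>" using norm_triangle_ineq4[of x y] by linarith
        then have "norm (x - y)^2 \<le> (norm x + \<bar>K\<bar>)^2" by (rule power_mono) simp
        then show ?thesis using g(2)[of y] by (simp add: abs_mult mult.commute mult_left_mono)
      qed (simp add: g(3))
    qed
  qed measurable
  then show "integrable lborel (\<lambda>y. g y * norm (x - y)^2)" .
  have int1: "integrable lborel (\<lambda>y. g y *\<^sub>R y)"
  proof (rule Bochner_Integration.integrable_bound)
    show "integrable lborel (\<lambda>y. \<bar>K\<bar> * g y)" using g(1) by simp
    show "AE y in lborel. norm (g y *\<^sub>R y) \<le> norm (\<bar>K\<bar> * g y)"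
    proof (intro AE_I2)
      fix y
      show "norm (g y *\<^sub>R y) \<le> norm (\<bar>K\<bar> * g y)"
      proof (cases "norm y > K")
        case False
        then have "norm y \<le> \<bar>K\<bar>" by linarith
        then show ?thesis using g(2)[of y] by (simp add: abs_mult mult.commute mult_right_mono)
      qed (simp add: g(3))
    qed
  qed measurable
  have int2: "integrable lborel (\<lambda>y. g y *\<^sub>R (y - b))"
    using int1 g(1) by (simp add: scaleR_diff_right)
  have "(LINT y|lborel. g y *\<^sub>R (y - b)) = (LINT y|lborel. g y *\<^sub>R y) - ?m *\<^sub>R b"
    using int1 g(1) by (simp add: scaleR_diff_right)
  also have "\<dots> = 0" using pos by (simp add: b_def)
  finally have 0: "(LINT y|lborel. g y *\<^sub>R (y - b)) = 0" .
  have "g y * norm (x - y)^2 = (norm (x - b)^2 * g y + g y * norm (b - y)^2) - 2 * ((g y *\<^sub>R (y - b)) \<bullet> (x - b))" for y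
  proof -
    have "norm (x - y)^2 = norm (x - b)^2 + norm (b - y)^2 - 2 * ((y - b) \<bullet> (x - b))"
      unfolding power2_norm_eq_inner
      by (simp add: inner_diff_left inner_diff_right inner_commute)
    moreover have "c * (p + q - 2 * w) = (p * c + c * q) - 2 * (c * w)" for c p q w :: real
      by (simp add: algebra_simps)
    ultimately show ?thesis by (simp only: inner_scaleR_left)
  qed
  then have "(LINT y|lborel. g y * norm (x - y)^2) = (LINT y|lborel. (norm (x - b)^2 * g y + g y * norm (b - y)^2) - 2 * ((g y *\<^sub>R (y - b)) \<bullet> (x - b)))"
    by simp
  also have "\<dots> = (LINT y|lborel. norm (x - b)^2 * g y + g y * norm (b - y)^2) - (LINT y|lborel. 2 * ((g y *\<^sub>R (y - b)) \<bullet> (x - b)))"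
    using int[of b] g(1)
    by (intro Bochner_Integration.integral_diff integrable_mult_right integrable_inner_left[OF int2] Bochner_Integration.integrable_add) auto
  also have "(LINT y|lborel. 2 * ((g y *\<^sub>R (y - b)) \<bullet> (x - b))) = 2 * ((LINT y|lborel. g y *\<^sub>R (y - b)) \<bullet> (x - b))"
    using integral_inner_left[OF int2, of "x - b"] by simp
  also have "(LINT y|lborel. norm (x - b)^2 * g y + g y * norm (b - y)^2) = norm (x - b)^2 * ?m + (LINT y|lborel. g y * norm (b - y)^2)"
    using int[of b] g(1) by (subst Bochner_Integration.integral_add) auto
  finally show "(LINT y|lborel. g y * norm (x - y)^2) = (LINT y|lborel. g y) * norm (x - b)^2 + (LINT y|lborel. g y * norm (y - b)^2)"
    by (simp add: 0 norm_minus_commute mult.commute)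
qed

text \<open>
  On the ball of radius \<open>3 r\<close> around \<open>a\<close> the kernel is the untruncated quadratic, and points outside of it have
  distance at least \<open>2 r\<close> from the half of the mass inside \<open>ball a r\<close>. Here \<open>m1\<close> and \<open>m2\<close> are the masses inside
  and outside, \<open>b\<close> is the barycentre of the inner part and \<open>I\<close> its second moment about \<open>b\<close>.
\<close>

lemma interaction_quad_near_le:
  fixes f :: "'a::euclidean_space \<Rightarrow> real"
  assumes f: "bounded_density A f" and m: "(\<integral>\<^sup>+x. ennreal (f x) \<partial>lborel) = ennreal m" "0 < m"
    and r: "0 < r" "6 * r \<le> M" and near: "ennreal (m / 2) < (\<integral>\<^sup>+y. ennreal (f y) * indicator (ball a r) y \<partial>lborel)"
    and C: "0 \<le> C"
  obtains b m1 m2 I where "m / 2 \<le> m1" "0 \<le> m2" "m1 + m2 = m" "0 \<le> I"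
    "interaction (quad_kernel M) f \<le> ennreal (M^2 * m^2 - (2 * m1 * I + 2 * r^2 * m * m2))"
    "(\<integral>\<^sup>+x. ennreal (min (norm x^2) C) * ennreal (f (b + x)) \<partial>lborel) \<le> ennreal (I + C * m2)"
proof -
  note [measurable] = bounded_densityD(1)[OF f]
  note f0 = bounded_densityD(3)[OF f] and fi = bounded_densityD(2)[OF f]
  let ?B = "ball a (3 * r)"
  have [measurable]: "ball a r \<in> sets borel" "?B \<in> sets borel" by simp_all
  define g where "g x = f x * indicator ?B x" for x
  define g' where "g' x = f x * indicator (- ?B) x" for x
  have mg[measurable]: "g \<in> borel_measurable borel" "g' \<in> borel_measurable borel"
    unfolding g_def[abs_def] g'_def[abs_def] by measurable
  have gi: "integrable lborel g" "integrable lborel g'"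
    unfolding g_def[abs_def] g'_def[abs_def] using fi by (auto intro!: integrable_real_mult_indicator simp: mult.commute)
  have g0: "0 \<le> g x" "0 \<le> g' x" for x using f0 by (auto simp: g_def g'_def)
  have fg: "f x = g x + g' x" for x by (auto simp: g_def g'_def indicator_def)
  define m1 where "m1 = (LINT x|lborel. g x)"
  define m2 where "m2 = (LINT x|lborel. g' x)"
  have m12: "0 \<le> m1" "0 \<le> m2" using g0 by (auto simp: m1_def m2_def)
  have gm: "(\<integral>\<^sup>+x. ennreal (g x) \<partial>lborel) = ennreal m1" "(\<integral>\<^sup>+x. ennreal (g' x) \<partial>lborel) = ennreal m2"
    using gi g0 by (auto simp: nn_integral_eq_integral m1_def m2_def)
  have "ennreal m = (\<integral>\<^sup>+x. ennreal (g x) + ennreal (g' x) \<partial>lborel)"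
    unfolding m(1)[symmetric] using fg g0 by (simp add: ennreal_plus)
  also have "\<dots> = ennreal m1 + ennreal m2" by (simp add: nn_integral_add gm)
  finally have ms: "m1 + m2 = m" using m12 m(2) by (simp add: ennreal_plus[symmetric] del: ennreal_plus)
  have "ennreal (m / 2) \<le> (\<integral>\<^sup>+x. ennreal (g x) \<partial>lborel)"
    using near r(1) f0 by (intro order_trans[OF less_imp_le[OF near]] nn_integral_mono) (auto simp: g_def indicator_def)
  then have m1h: "m / 2 \<le> m1" using m(2) m12 by (simp add: gm)
  then have m1p: "0 < m1" using m(2) by linarith
  define b where "b = (1 / m1) *\<^sub>R (LINT x|lborel. g x *\<^sub>R x)"
  define I where "I = (LINT y|lborel. g y * norm (y - b)^2)"
  have I0: "0 \<le> I" unfolding I_def using g0 by (intro Bochner_Integration.integral_nonneg) auto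
  have gsupp: "g x = 0" if "norm x > norm a + 3 * r" for x
  proof -
    have "x \<notin> ?B" using that norm_triangle_ineq2[of x a] by (auto simp: dist_norm norm_minus_commute)
    then show ?thesis by (simp add: g_def)
  qed
  note bary = integral_sq_dist_barycenter[OF gi(1) g0(1) gsupp, folded m1_def, OF _ m1p, folded b_def, folded I_def]
  have nnb: "(\<integral>\<^sup>+y. ennreal (g y) * ennreal (norm (x - y)^2) \<partial>lborel) = ennreal (m1 * norm (x - b)^2 + I)" for x
  proof -
    have "(\<integral>\<^sup>+y. ennreal (g y) * ennreal (norm (x - y)^2) \<partial>lborel) = (\<integral>\<^sup>+y. ennreal (g y * norm (x - y)^2) \<partial>lborel)"
      using g0 by (simp add: ennreal_mult)
    also have "\<dots> = ennreal (LINT y|lborel. g y * norm (x - y)^2)"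
      using bary(1) g0 by (intro nn_integral_eq_integral) auto
    finally show ?thesis using bary(2) by simp
  qed
  have nnI: "(\<integral>\<^sup>+y. ennreal (g y) * ennreal (norm (y - b)^2) \<partial>lborel) = ennreal I"
    using nnb[of b] by (simp add: norm_minus_commute)
  let ?pot = "potential_of (quad_kernel M) f"
  have M2: "(2 * r)^2 \<le> M^2" using r by (intro power_mono) auto
  \<comment> \<open>Two points of \<open>?B\<close> are at distance at most
    \<open>6 * r \<le> M\<close>, so the kernel there is exactly \<open>M^2 - |x - y|^2\<close>; for
    \<open>y\<close> outside, the trivial bound \<open>M^2\<close> suffices.\<close>
  have in_pot: "?pot x + ennreal (m1 * norm (x - b)^2 + I) \<le> ennreal (M^2 * m)" if x: "x \<in> ?B" for x
  proof -
    have "?pot x + ennreal (m1 * norm (x - b)^2 + I)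
      = (\<integral>\<^sup>+y. ennreal (f y) * quad_kernel M (norm (x - y)) + ennreal (g y) * ennreal (norm (x - y)^2) \<partial>lborel)"
      unfolding potential_of_def nnb[symmetric] by (rule nn_integral_add[symmetric]) measurable
    also have "\<dots> \<le> (\<integral>\<^sup>+y. ennreal (M^2) * ennreal (f y) \<partial>lborel)"
    proof (rule nn_integral_mono)
      fix y
      show "ennreal (f y) * quad_kernel M (norm (x - y)) + ennreal (g y) * ennreal (norm (x - y)^2) \<le> ennreal (M^2) * ennreal (f y)"
      proof (cases "y \<in> ?B")
        case True
        have "norm (x - y) \<le> dist a x + dist a y" using dist_triangle3[of x y a] by (simp add: dist_norm)
        also have "\<dots> \<le> M" using x True r by simp
        finally have "norm (x - y)^2 \<le> M^2" by (rule power_mono) simp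
        then have "quad_kernel M (norm (x - y)) + ennreal (norm (x - y)^2) = ennreal (M^2)"
          by (simp add: quad_kernel_norm ennreal_plus[symmetric] del: ennreal_plus)
        then have "ennreal (f y) * (quad_kernel M (norm (x - y)) + ennreal (norm (x - y)^2)) = ennreal (M^2) * ennreal (f y)"
          by (simp add: mult.commute)
        then show ?thesis using True by (simp add: g_def distrib_left)
      next
        case False
        have "ennreal (f y) * quad_kernel M (norm (x - y)) \<le> ennreal (f y) * ennreal (M^2)"
          by (intro mult_left_mono) (auto simp: quad_kernel_norm intro!: ennreal_leI)
        then show ?thesis using False by (simp add: g_def mult.commute)
      qed
    qed
    also have "\<dots> = ennreal (M^2 * m)" using m by (simp add: nn_integral_cmult ennreal_mult)
    finally show ?thesis .
  qed
  \<comment> \<open>More than \<open>m / 2\<close> of the mass lies in \<open>ball a r\<close>, at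
    distance at least \<open>2 * r\<close> from \<open>x\<close>, which lowers the potential by
    \<open>(2 * r)^2 * m / 2 = 2 * r^2 * m\<close>.\<close>
  have out_pot: "?pot x + ennreal (2 * r^2 * m) \<le> ennreal (M^2 * m)" if x: "x \<notin> ?B" for x
  proof -
    have "ennreal (2 * r^2 * m) = ennreal ((2 * r)^2) * ennreal (m / 2)"
      using m by (simp add: ennreal_mult[symmetric] power2_eq_square)
    also have "\<dots> \<le> ennreal ((2 * r)^2) * (\<integral>\<^sup>+y. ennreal (f y) * indicator (ball a r) y \<partial>lborel)"
      by (intro mult_left_mono less_imp_le[OF near]) simp
    also have "\<dots> = (\<integral>\<^sup>+y. ennreal ((2 * r)^2) * (ennreal (f y) * indicator (ball a r) y) \<partial>lborel)"
      by (rule nn_integral_cmult[symmetric]) measurable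
    finally have "?pot x + ennreal (2 * r^2 * m) \<le> ?pot x + (\<integral>\<^sup>+y. ennreal ((2 * r)^2) * (ennreal (f y) * indicator (ball a r) y) \<partial>lborel)"
      by (rule add_left_mono)
    also have "\<dots> = (\<integral>\<^sup>+y. ennreal (f y) * quad_kernel M (norm (x - y)) + ennreal ((2 * r)^2) * (ennreal (f y) * indicator (ball a r) y) \<partial>lborel)"
      unfolding potential_of_def by (rule nn_integral_add[symmetric]) measurable
    also have "\<dots> \<le> (\<integral>\<^sup>+y. ennreal (M^2) * ennreal (f y) \<partial>lborel)"
    proof (rule nn_integral_mono)
      fix y
      have "quad_kernel M (norm (x - y)) + ennreal ((2 * r)^2) * indicator (ball a r) y \<le> ennreal (M^2)"
      proof (cases "y \<in> ball a r")
        case True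
        have "dist a x \<le> dist a y + norm (x - y)" using dist_triangle[of a x y] by (simp add: dist_norm norm_minus_commute)
        then have "2 * r \<le> norm (x - y)" using x True by simp
        then have "(2 * r)^2 \<le> norm (x - y)^2" using r by (intro power_mono) auto
        then have "quad_kernel M (norm (x - y)) \<le> ennreal (M^2 - (2 * r)^2)" by (simp add: quad_kernel_norm ennreal_leI)
        then have "quad_kernel M (norm (x - y)) + ennreal ((2 * r)^2) \<le> ennreal (M^2 - (2 * r)^2) + ennreal ((2 * r)^2)"
          by (rule add_right_mono)
        also have "\<dots> = ennreal (M^2)" using M2 by (subst ennreal_plus[symmetric]) auto
        finally show ?thesis using True by simp
      qed (auto simp: quad_kernel_norm intro!: ennreal_leI)
      then have "ennreal (f y) * (quad_kernel M (norm (x - y)) + ennreal ((2 * r)^2) * indicator (ball a r) y) \<le> ennreal (f y) * ennreal (M^2)"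
        by (rule mult_left_mono) simp
      then show "ennreal (f y) * quad_kernel M (norm (x - y)) + ennreal ((2 * r)^2) * (ennreal (f y) * indicator (ball a r) y) \<le> ennreal (M^2) * ennreal (f y)"
        by (simp add: distrib_left ac_simps)
    qed
    also have "\<dots> = ennreal (M^2 * m)" using m by (simp add: nn_integral_cmult ennreal_mult)
    finally show ?thesis .
  qed
  \<comment> \<open>Integrating \<open>m1 * |x - b|^2 + I\<close> against the inner part gives
    \<open>m1 * I\<close> twice, hence the term \<open>2 * m1 * I\<close>.\<close>
  have "interaction (quad_kernel M) f + ennreal (2 * m1 * I + 2 * r^2 * m * m2)
     = (\<integral>\<^sup>+x. ennreal (f x) * ?pot x \<partial>lborel)
      + ((\<integral>\<^sup>+x. ennreal m1 * (ennreal (g x) * ennreal (norm (x - b)^2)) + ennreal I * ennreal (g x) \<partial>lborel)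
      + (\<integral>\<^sup>+x. ennreal (2 * r^2 * m) * ennreal (g' x) \<partial>lborel))"
  proof -
    have "(\<integral>\<^sup>+x. ennreal m1 * (ennreal (g x) * ennreal (norm (x - b)^2)) + ennreal I * ennreal (g x) \<partial>lborel) = ennreal (2 * m1 * I)"
      using m12 I0 by (simp add: nn_integral_add nn_integral_cmult nnI gm ennreal_mult[symmetric] ennreal_plus[symmetric] del: ennreal_plus)
    moreover have "(\<integral>\<^sup>+x. ennreal (2 * r^2 * m) * ennreal (g' x) \<partial>lborel) = ennreal (2 * r^2 * m * m2)"
      using m m12 by (simp add: nn_integral_cmult gm ennreal_mult)
    moreover have "ennreal (2 * m1 * I + 2 * r^2 * m * m2) = ennreal (2 * m1 * I) + ennreal (2 * r^2 * m * m2)"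
      using m m12 I0 by (intro ennreal_plus) auto
    ultimately show ?thesis using f0 by (simp add: interaction_eq_potential)
  qed
  also have "\<dots> = (\<integral>\<^sup>+x. ennreal (f x) * ?pot x + ((ennreal m1 * (ennreal (g x) * ennreal (norm (x - b)^2)) + ennreal I * ennreal (g x))
      + ennreal (2 * r^2 * m) * ennreal (g' x)) \<partial>lborel)"
    by (simp add: nn_integral_add)
  also have "\<dots> \<le> (\<integral>\<^sup>+x. ennreal (f x) * ennreal (M^2 * m) \<partial>lborel)"
  proof (rule nn_integral_mono)
    fix x
    show "ennreal (f x) * ?pot x + ((ennreal m1 * (ennreal (g x) * ennreal (norm (x - b)^2)) + ennreal I * ennreal (g x))
      + ennreal (2 * r^2 * m) * ennreal (g' x)) \<le> ennreal (f x) * ennreal (M^2 * m)"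
    proof (cases "x \<in> ?B")
      case True
      have "ennreal (f x) * (?pot x + ennreal (m1 * norm (x - b)^2 + I)) \<le> ennreal (f x) * ennreal (M^2 * m)"
        by (rule mult_left_mono[OF in_pot[OF True]]) simp
      moreover have "ennreal (m1 * norm (x - b)^2 + I) = ennreal m1 * ennreal (norm (x - b)^2) + ennreal I"
        using m12 I0 by (simp add: ennreal_mult)
      ultimately show ?thesis using True by (simp add: g_def g'_def distrib_left ac_simps)
    next
      case False
      have "ennreal (f x) * (?pot x + ennreal (2 * r^2 * m)) \<le> ennreal (f x) * ennreal (M^2 * m)"
        by (rule mult_left_mono[OF out_pot[OF False]]) simp
      then show ?thesis using False by (simp add: g_def g'_def distrib_left ac_simps)
    qed
  qed
  also have "\<dots> = ennreal (M^2 * m^2)" using m by (simp add: nn_integral_multc ennreal_mult'[symmetric] power2_eq_square ac_simps)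
  finally have E: "interaction (quad_kernel M) f + ennreal (2 * m1 * I + 2 * r^2 * m * m2) \<le> ennreal (M^2 * m^2)" .
  have E': "interaction (quad_kernel M) f \<le> ennreal (M^2 * m^2 - (2 * m1 * I + 2 * r^2 * m * m2))"
  proof -
    have "interaction (quad_kernel M) f \<le> ennreal (M^2 * m^2) - ennreal (2 * m1 * I + 2 * r^2 * m * m2)"
      using E by (simp add: ennreal_le_minus_iff)
    then show ?thesis using m m12 I0 by (subst (asm) ennreal_minus) auto
  qed
  \<comment> \<open>The outer part may be arbitrarily far from \<open>b\<close>; the cap limits its
    contribution to \<open>C * m2\<close>.\<close>
  have "(\<integral>\<^sup>+x. ennreal (min (norm x^2) C) * ennreal (f (b + x)) \<partial>lborel) = (\<integral>\<^sup>+x. ennreal (min (norm (x - b)^2) C) * ennreal (f x) \<partial>lborel)"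
    using nn_integral_translation[of "\<lambda>x. ennreal (min (norm (x - b)^2) C) * ennreal (f x)" b] by simp
  also have "\<dots> \<le> (\<integral>\<^sup>+x. ennreal (g x) * ennreal (norm (x - b)^2) + ennreal C * ennreal (g' x) \<partial>lborel)"
  proof (rule nn_integral_mono)
    fix x
    have 1: "ennreal (min (norm (x - b)^2) C) * ennreal (f x) \<le> ennreal (norm (x - b)^2) * ennreal (f x)"
      by (intro mult_right_mono ennreal_leI) auto
    have 2: "ennreal (min (norm (x - b)^2) C) * ennreal (f x) \<le> ennreal C * ennreal (f x)"
      by (intro mult_right_mono ennreal_leI) auto
    show "ennreal (min (norm (x - b)^2) C) * ennreal (f x) \<le> ennreal (g x) * ennreal (norm (x - b)^2) + ennreal C * ennreal (g' x)"
      using 1 2 by (cases "x \<in> ?B") (simp_all add: g_def g'_def mult.commute)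
  qed
  also have "\<dots> = ennreal I + ennreal C * ennreal m2" by (simp add: nn_integral_add nn_integral_cmult nnI gm)
  also have "\<dots> = ennreal (I + C * m2)" using I0 C m12 by (simp add: ennreal_mult)
  finally show ?thesis using that m1h m12(2) ms I0 E' by blast
qed

text \<open>With \<open>i\<close> the second moment of the rearrangement, it suffices that the
  energy of \<open>f\<close> falls short of \<open>M^2 * m^2\<close> by
  \<open>2 * m * (i + y)\<close>. As \<open>i\<close> and \<open>y\<close> are at most
  \<open>R^2 * m\<close>, a loss of \<open>4 * R^2 * m^2\<close> is always enough, and mass that is
  nowhere concentrated loses \<open>(3 * R)^2 * m^2 / 2\<close>.\<close>

lemma quad_energy_gap:
  fixes f :: "'a::euclidean_space \<Rightarrow> real"
  assumes f: "bounded_density A f" and m: "(\<integral>\<^sup>+x. ennreal (f x) \<partial>lborel) = ennreal m" "0 < m"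
    and R: "0 < R" and supp: "\<And>x. R < norm x \<Longrightarrow> rearrangement f x = 0"
    and y: "0 \<le> y" "y \<le> R^2 * m"
    and gap: "\<And>b. (\<integral>\<^sup>+x. ennreal (norm x^2) * ennreal (rearrangement f x) \<partial>lborel) + ennreal y
       \<le> (\<integral>\<^sup>+x. ennreal (min (norm x^2) (4 * R^2)) * ennreal (f (b + x)) \<partial>lborel)"
  shows "interaction (quad_kernel (18 * R)) f + ennreal (2 * m * y) \<le> interaction (quad_kernel (18 * R)) (rearrangement f)"
proof -
  let ?g = "rearrangement f" and ?k = "quad_kernel (18 * R)" and ?M = "18 * R"
  have [measurable]: "?g \<in> borel_measurable borel" by (rule borel_measurable_rearrangement[OF f])
  define J where "J = (\<integral>\<^sup>+x. ennreal (norm x^2) * ennreal (?g x) \<partial>lborel)"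
  have "J \<le> (\<integral>\<^sup>+x. ennreal (R^2) * ennreal (?g x) \<partial>lborel)"
    unfolding J_def
  proof (rule nn_integral_mono)
    fix x
    show "ennreal (norm x^2) * ennreal (?g x) \<le> ennreal (R^2) * ennreal (?g x)"
    proof (cases "R < norm x")
      case False
      then show ?thesis by (intro mult_right_mono ennreal_leI power_mono) auto
    qed (simp add: supp)
  qed
  also have "\<dots> = ennreal (R^2 * m)" using m by (simp add: nn_integral_cmult nn_integral_rearrangement[OF f] ennreal_mult)
  finally have J: "J \<le> ennreal (R^2 * m)" .
  then have "J < \<infinity>" by (rule order.strict_trans1) simp
  then obtain i where i: "J = ennreal i" "0 \<le> i" by (cases J) auto
  have iR: "i \<le> R^2 * m" using J i m by (simp add: ennreal_le_iff)
  have star: "ennreal (?M^2 * m^2) \<le> interaction ?k ?g + ennreal (2 * m * i)"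
  proof -
    have "2 * (ennreal m * ennreal i) = ennreal (2 * m * i)" using m i by (simp add: ennreal_mult mult.assoc)
    then show ?thesis
      using interaction_quad_rearrangement_ge[OF f m(1) less_imp_le[OF m(2)] supp less_imp_le[OF R], of ?M] R
      unfolding J_def[symmetric] i(1) by simp
  qed
  have close: ?thesis if E: "interaction ?k f \<le> ennreal (?M^2 * m^2 - z)" and z: "2 * m * i + 2 * m * y \<le> z" for z
  proof -
    have p: "0 \<le> m * i" "0 \<le> m * y" "m * i \<le> R^2 * m^2" "m * y \<le> R^2 * m^2"
      using m i(2) y mult_left_mono[OF iR, of m] mult_left_mono[OF y(2), of m]
      by (auto simp: power2_eq_square algebra_simps)
    have q: "0 \<le> ?M^2 * m^2 - 2 * m * i - 2 * m * y"
    proof -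
      have "2 * m * i + 2 * m * y \<le> 4 * (R^2 * m^2)" using p by linarith
      also have "\<dots> \<le> 324 * (R^2 * m^2)" by (intro mult_right_mono) auto
      also have "\<dots> = ?M^2 * m^2" by (simp add: power2_eq_square)
      finally show ?thesis by linarith
    qed
    have "interaction ?k f + ennreal (2 * m * y) \<le> ennreal (?M^2 * m^2 - 2 * m * i - 2 * m * y) + ennreal (2 * m * y)"
      using E z by (intro add_right_mono order_trans[OF E] ennreal_leI) linarith
    also have "\<dots> = ennreal (?M^2 * m^2 - 2 * m * i)" using q p by (subst ennreal_plus[symmetric]) auto
    also have "\<dots> = ennreal (?M^2 * m^2) - ennreal (2 * m * i)" using p by (subst ennreal_minus) (auto simp: mult.commute)
    also have "\<dots> \<le> interaction ?k ?g" using star by (simp add: ennreal_minus_le_iff add.commute)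
    finally show ?thesis .
  qed
  show ?thesis
  proof (cases "\<forall>x. (\<integral>\<^sup>+y. ennreal (f y) * indicator (ball x (3 * R)) y \<partial>lborel) \<le> ennreal (m / 2)")
    case True
    have "interaction ?k f \<le> ennreal (?M^2 * m^2 - (3 * R)^2 * m^2 / 2)"
      using R m True by (intro interaction_quad_far_le[OF f m(1)]) auto
    moreover have "2 * m * i + 2 * m * y \<le> (3 * R)^2 * m^2 / 2"
    proof -
      have "2 * m * i + 2 * m * y \<le> 2 * m * (R^2 * m) + 2 * m * (R^2 * m)"
        using m iR y by (intro add_mono mult_left_mono) auto
      also have "\<dots> = 4 * (R^2 * m^2)" by (simp add: power2_eq_square)
      also have "\<dots> \<le> 9 / 2 * (R^2 * m^2)" by (intro mult_right_mono) auto
      also have "\<dots> = (3 * R)^2 * m^2 / 2" by (simp add: power2_eq_square)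
      finally show ?thesis .
    qed
    ultimately show ?thesis by (rule close)
  next
    case False
    then obtain a where a: "ennreal (m / 2) < (\<integral>\<^sup>+y. ennreal (f y) * indicator (ball a (3 * R)) y \<partial>lborel)" by (auto simp: not_le)
    have r: "0 < 3 * R" "6 * (3 * R) \<le> ?M" "0 \<le> 4 * R^2" using R by auto
    obtain b m1 m2 I where N: "m / 2 \<le> m1" "0 \<le> m2" "m1 + m2 = m" "0 \<le> I"
      "interaction ?k f \<le> ennreal (?M^2 * m^2 - (2 * m1 * I + 2 * (3 * R)^2 * m * m2))"
      "(\<integral>\<^sup>+x. ennreal (min (norm x^2) (4 * R^2)) * ennreal (f (b + x)) \<partial>lborel) \<le> ennreal (I + 4 * R^2 * m2)"
      by (rule interaction_quad_near_le[OF f m r(1,2) a r(3)]) (rule that; assumption)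
    have "ennreal i + ennreal y \<le> ennreal (I + 4 * R^2 * m2)"
      using order_trans[OF gap N(6)] by (simp add: J_def[symmetric] i(1))
    then have iy: "i + y \<le> I + 4 * R^2 * m2"
      using i y N R by (simp add: ennreal_plus[symmetric] del: ennreal_plus)
    have "2 * m * i + 2 * m * y \<le> 2 * m1 * I + 2 * (3 * R)^2 * m * m2"
    \<comment> \<open>If \<open>I\<close> is large, \<open>m1 \<ge> m / 2\<close> lets
      \<open>2 * m1 * I\<close> alone reach \<open>4 * R^2 * m^2\<close>. Otherwise replacing
      \<open>m\<close> by \<open>m1\<close> in front of \<open>I\<close> costs
      \<open>2 * m2 * I \<le> 8 * R^2 * m * m2\<close>; with the equally large cap term this makes
      16 times \<open>R^2 * m * m2\<close>, below the available 18.\<close>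
    proof (cases "4 * R^2 * m \<le> I")
      case True
      have "2 * m * i + 2 * m * y \<le> 2 * m * (R^2 * m) + 2 * m * (R^2 * m)"
        using m iR y by (intro add_mono mult_left_mono) auto
      also have "\<dots> = 2 * (m / 2) * (4 * R^2 * m)" by (simp add: power2_eq_square)
      also have "\<dots> \<le> 2 * m1 * I" using N m True by (intro mult_mono) auto
      also have "\<dots> \<le> 2 * m1 * I + 2 * (3 * R)^2 * m * m2" using m N by simp
      finally show ?thesis .
    next
      case False
      have "2 * m * (i + y) \<le> 2 * m * (I + 4 * R^2 * m2)" using m iy by (intro mult_left_mono) auto
      also have "\<dots> = 2 * m1 * I + 2 * m2 * I + 8 * R^2 * m * m2" using N(3) by (simp add: algebra_simps flip: N(3))
      also have "2 * m2 * I \<le> 2 * m2 * (4 * R^2 * m)" using N False by (intro mult_left_mono) auto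
      finally have "2 * m * (i + y) \<le> 2 * m1 * I + 16 * (R^2 * m * m2)" by (simp add: algebra_simps)
      also have "\<dots> \<le> 2 * m1 * I + 18 * (R^2 * m * m2)" using m N by simp
      also have "\<dots> = 2 * m1 * I + 2 * (3 * R)^2 * m * m2" by (simp add: power2_eq_square)
      finally show ?thesis by (simp add: algebra_simps)
    qed
    then show ?thesis by (rule close[OF N(5)])
  qed
qed

lemma bounded_density_translate:
  assumes f: "bounded_density A f"
  shows "bounded_density A (\<lambda>x. f (b + x))"
  unfolding bounded_density_def
proof (intro conjI allI)
  note [measurable] = bounded_densityD(1)[OF f]
  show "(\<lambda>x. f (b + x)) \<in> borel_measurable borel" by measurable
  show "integrable lborel (\<lambda>x. f (b + x))"
  proof (rule integrableI_nonneg)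
    show "(\<integral>\<^sup>+x. ennreal (f (b + x)) \<partial>lborel) < \<infinity>"
      using nn_integral_translation[of "\<lambda>x. ennreal (f x)" b] bounded_densityD(2,3)[OF f] by (simp add: nn_integral_eq_integral)
  qed (use bounded_densityD(3)[OF f] in auto)
qed (use bounded_densityD(3,4)[OF f] in auto)

lemma superlevel_translate:
  assumes f: "bounded_density A f"
  shows "superlevel (\<lambda>x. f (b + x)) = superlevel f"
proof
  fix h
  note [measurable] = bounded_densityD(1)[OF f]
  have [measurable]: "{x. h < f x} \<in> sets borel" by measurable
  have "emeasure lborel {x. h < f (b + x)} = (\<integral>\<^sup>+x. indicator {x. h < f x} (b + x) \<partial>lborel)"
  proof -
    have "{x. h < f (b + x)} \<in> sets borel" by measurable
    then have "emeasure lborel {x. h < f (b + x)} = (\<integral>\<^sup>+x. indicator {x. h < f (b + x)} x \<partial>lborel)" by simp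
    also have "\<dots> = (\<integral>\<^sup>+x. indicator {x. h < f x} (b + x) \<partial>lborel)"
      by (intro nn_integral_cong) (simp add: indicator_def)
    finally show ?thesis .
  qed
  also have "\<dots> = emeasure lborel {x. h < f x}" by (subst nn_integral_translation) auto
  finally show "superlevel (\<lambda>x. f (b + x)) h = superlevel f h" by (simp add: superlevel_def measure_def)
qed

lemma rearrangement_translate:
  assumes f: "bounded_density A f"
  shows "rearrangement (\<lambda>x. f (b + x)) = rearrangement f"
  by (rule ext) (simp add: rearrangement_eq_measure[OF f] rearrangement_eq_measure[OF bounded_density_translate[OF f]]
      star_levels_def superlevel_translate[OF f])

lemma mass_le:
  fixes f :: "'a::euclidean_space \<Rightarrow> real"
  assumes f: "bounded_density A f" and m: "(\<integral>\<^sup>+x. ennreal (f x) \<partial>lborel) = ennreal m"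
    and V: "0 \<le> V" "\<And>h. 0 < h \<Longrightarrow> superlevel f h \<le> V"
  shows "m \<le> A * V"
proof -
  have A: "0 \<le> A" by (rule bounded_densityD(5)[OF f])
  have "ennreal m = (\<integral>\<^sup>+h. ennreal (superlevel f h) * indicator {0<..} h \<partial>lborel)"
    by (simp add: nn_integral_superlevel_eq[OF f] m)
  also have "\<dots> \<le> (\<integral>\<^sup>+h. ennreal V * indicator {0..A} h \<partial>lborel)"
  proof (rule nn_integral_mono)
    fix h :: real
    show "ennreal (superlevel f h) * indicator {0<..} h \<le> ennreal V * indicator {0..A} h"
      using V(2)[of h] superlevel_eq_0[OF f, of h] by (auto simp: indicator_def not_le intro!: ennreal_leI)
  qed
  also have "\<dots> = ennreal (A * V)" using A V by (simp add: nn_integral_cmult_indicator ennreal_mult mult.commute)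
  finally show ?thesis using A V by (subst (asm) ennreal_le_iff) auto
qed

text \<open>
  The radius of the ball of volume \<open>m / A\<close>, which is that of all level sets if \<open>f\<close> is a multiple of a
  characteristic function. The condition on \<open>superlevel f h\<close> in \<open>level_cost_ge_square\<close> says that
  \<open>s\<^sup>n\<^sup>-\<^sup>2 \<le> \<tau>\<^sup>n\<^sup>-\<^sup>2 + s\<^sup>n / \<tau>\<^sup>2\<close>, which fails for \<open>n = 1\<close> and small \<open>s\<close>: this is why the cube appears there.
\<close>

definition level_scale :: "('a::euclidean_space) itself \<Rightarrow> real \<Rightarrow> real \<Rightarrow> real" where
  "level_scale _ A m = radius_of_volume TYPE('a) (m / A)"

text \<open>The barycentre found by the concentration argument is not under control, hence the cost
  is assumed for all translates; rearrangement and superlevel volumes are the same for all of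
  them.\<close>

lemma quad_gap_of_level_cost:
  fixes f :: "'a::euclidean_space \<Rightarrow> real"
  assumes f: "bounded_density A f" and m: "(\<integral>\<^sup>+x. ennreal (f x) \<partial>lborel) = ennreal m" "0 < m"
    and R: "0 < R" "\<And>h. 0 < h \<Longrightarrow> superlevel f h \<le> unit_ball_vol DIM('a) * R ^ DIM('a)"
    and y: "0 \<le> y" "y \<le> R^2 * m"
    and cost: "\<And>b. ennreal y \<le> (\<integral>\<^sup>+h. ennreal (level_cost (\<lambda>x. f (b + x)) h) * indicator {0<..} h \<partial>lborel)"
  shows "interaction (quad_kernel (18 * R)) f + ennreal (2 * m * y) \<le> interaction (quad_kernel (18 * R)) (rearrangement f)"
proof (rule quad_energy_gap[OF f m R(1) _ y])
  fix x :: 'a assume x: "R < norm x"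
  have "star_levels f x = {}"
  proof -
    have "unit_ball_vol DIM('a) * R ^ DIM('a) \<le> ball_volume x"
      unfolding ball_volume_def using x R(1) by (intro mult_left_mono power_mono) auto
    then show ?thesis using R(2) by (force simp: star_levels_def)
  qed
  then show "rearrangement f x = 0" by (simp add: rearrangement_eq_measure[OF f])
next
  fix b
  let ?f = "\<lambda>x. f (b + x)"
  have "(\<integral>\<^sup>+x. ennreal (norm x^2) * ennreal (rearrangement f x) \<partial>lborel) + ennreal y
    \<le> (\<integral>\<^sup>+x. ennreal (norm x^2) * ennreal (rearrangement f x) \<partial>lborel) + (\<integral>\<^sup>+h. ennreal (level_cost ?f h) * indicator {0<..} h \<partial>lborel)"
    by (rule add_left_mono[OF cost])
  also have "\<dots> \<le> (\<integral>\<^sup>+x. ennreal (min (norm x^2) (4 * R^2)) * ennreal (?f x) \<partial>lborel)"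
    using moment_gap[OF bounded_density_translate[OF f, of b], of R "4 * R^2"] R
    unfolding rearrangement_translate[OF f] superlevel_translate[OF f] by auto
  finally show "(\<integral>\<^sup>+x. ennreal (norm x^2) * ennreal (rearrangement f x) \<partial>lborel) + ennreal y
    \<le> (\<integral>\<^sup>+x. ennreal (min (norm x^2) (4 * R^2)) * ennreal (f (b + x)) \<partial>lborel)" .
qed

lemma level_defect_ge:
  fixes f :: "'a::euclidean_space \<Rightarrow> real"
  assumes f: "bounded_density A f" and z: "0 \<le> z" "ennreal (2 * z) \<le> (\<integral>\<^sup>+x. ennreal \<bar>f x - rearrangement f x\<bar> \<partial>lborel)"
  shows "ennreal z \<le> (\<integral>\<^sup>+h. ennreal (level_defect f h) * indicator {0<..} h \<partial>lborel)"
proof -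
  have "2 * ennreal z \<le> 2 * (\<integral>\<^sup>+h. ennreal (level_defect f h) * indicator {0<..} h \<partial>lborel)"
    using order_trans[OF z(2) L1_dist_rearrangement_le[OF f]] z(1) by (simp add: ennreal_mult)
  then show ?thesis by (subst (asm) ennreal_mult_le_mult_iff) auto
qed

text \<open>Let \<open>\<tau>\<close> be the radius of the ball of volume \<open>m / A\<close>. The
  condition of \<open>level_cost_ge_square\<close> holds for \<open>\<tau> \<le> s\<close> since
  \<open>a * \<tau>^2 \<le> a * s^2\<close>. For \<open>s < \<tau>\<close> it follows in dimension
  at least 2 from monotonicity of the power with exponent \<open>n - 2\<close>, while for levels of
  constant volume \<open>m / A\<close> this case does not occur.\<close>

lemma quad_gap_square:
  fixes f :: "'a::euclidean_space \<Rightarrow> real"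
  assumes f: "bounded_density A f" and A: "0 < A" and m: "(\<integral>\<^sup>+x. ennreal (f x) \<partial>lborel) = ennreal m" "0 < m"
    and R: "0 < R" "\<And>h. 0 < h \<Longrightarrow> superlevel f h \<le> unit_ball_vol DIM('a) * R ^ DIM('a)"
    and d: "0 \<le> d" "d \<le> 1" "\<And>b. ennreal (2 * (m * d)) \<le> (\<integral>\<^sup>+x. ennreal \<bar>f (b + x) - rearrangement f x\<bar> \<partial>lborel)"
    and shape: "2 \<le> DIM('a) \<or> (\<forall>h. 0 < h \<longrightarrow> h < A \<longrightarrow> superlevel f h = m / A)"
  shows "interaction (quad_kernel (18 * R)) f + ennreal (2 * m * (m * d^2 * (level_scale TYPE('a) A m)^2 / (8 * DIM('a))))
    \<le> interaction (quad_kernel (18 * R)) (rearrangement f)"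
proof (rule quad_gap_of_level_cost[OF f m R])
  let ?\<tau> = "level_scale TYPE('a) A m" and ?\<omega> = "unit_ball_vol DIM('a)"
  have mA: "0 < m / A" using m A by simp
  have \<tau>: "0 \<le> ?\<tau>" "?\<omega> * ?\<tau> ^ DIM('a) = m / A"
    unfolding level_scale_def using radius_of_volume[of "m / A", where 'a='a] mA by auto
  have \<tau>p: "0 < ?\<tau>" using \<tau> mA by (cases "?\<tau> = 0") (auto simp: zero_power)
  \<comment> \<open>Levels of volume at most that of a ball of radius \<open>R\<close> force
    \<open>\<tau> \<le> R\<close>, which gives the upper bound on \<open>y\<close> demanded by
    \<open>quad_gap_of_level_cost\<close>.\<close>
  have "m \<le> A * (?\<omega> * R ^ DIM('a))" using R by (intro mass_le[OF f m(1)]) auto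
  then have "?\<omega> * ?\<tau> ^ DIM('a) \<le> ?\<omega> * R ^ DIM('a)" unfolding \<tau>(2) using A by (simp add: field_simps)
  then have "?\<tau> ^ DIM('a) \<le> R ^ DIM('a)" by (rule mult_left_le_imp_le[OF _ unit_ball_vol_DIM_pos])
  then have \<tau>R: "?\<tau> \<le> R" using power_mono_iff[OF \<tau>(1) _ DIM_positive[where 'a='a], of R] R(1) by simp
  show "0 \<le> m * d^2 * ?\<tau>^2 / (8 * DIM('a))" using m by simp
  have n1: "1 \<le> real DIM('a)" using DIM_positive[where 'a='a] by linarith
  have "m * d^2 * ?\<tau>^2 / (8 * DIM('a)) \<le> m * d^2 * ?\<tau>^2 / 1"
  proof (rule divide_left_mono)
    show "1 \<le> real (8 * DIM('a))" using n1 unfolding of_nat_mult by linarith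
  qed (use m in auto)
  also have "\<dots> = m * d^2 * ?\<tau>^2" by simp
  also have "\<dots> \<le> m * 1 * R^2"
    using m d \<tau>R \<tau>(1) by (intro mult_mono power_mono power_le_one) auto
  finally show "m * d^2 * ?\<tau>^2 / (8 * DIM('a)) \<le> R^2 * m" by (simp add: mult.commute)
  fix b
  let ?f = "\<lambda>x. f (b + x)"
  have fb: "bounded_density A ?f" by (rule bounded_density_translate[OF f])
  have mb: "(\<integral>\<^sup>+x. ennreal (?f x) \<partial>lborel) = ennreal m"
    using nn_integral_translation[of "\<lambda>x. ennreal (f x)" b] bounded_densityD(1)[OF f] m(1) by simp
  have def: "ennreal (m * d) \<le> (\<integral>\<^sup>+h. ennreal (level_defect ?f h) * indicator {0<..} h \<partial>lborel)"
    using d m by (intro level_defect_ge[OF fb]) (auto simp: rearrangement_translate[OF f])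
  show "ennreal (m * d^2 * ?\<tau>^2 / (8 * DIM('a))) \<le> (\<integral>\<^sup>+h. ennreal (level_cost ?f h) * indicator {0<..} h \<partial>lborel)"
  proof (rule level_cost_ge_square[OF fb A mb m(2) \<tau>p d(1) def])
    fix h assume h: "0 < h" "h < A"
    let ?a = "superlevel f h" and ?s = "radius_of_volume TYPE('a) (superlevel f h)"
    have s: "0 \<le> ?s" "?\<omega> * ?s ^ DIM('a) = ?a" using radius_of_volume[of ?a, where 'a='a] by auto
    have "?a * ?\<tau>^2 \<le> (m / A + ?a) * ?s^2"
    proof (cases "?\<tau> \<le> ?s")
      case True
      then have "?a * ?\<tau>^2 \<le> ?a * ?s^2" using \<tau>(1) by (intro mult_left_mono power_mono) auto
      also have "\<dots> \<le> (m / A + ?a) * ?s^2" using mA by (intro mult_right_mono) auto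
      finally show ?thesis .
    next
      case False
      show ?thesis
      proof (cases "2 \<le> DIM('a)")
        case True
        then obtain j where j: "DIM('a) = j + 2" by (metis add.commute le_Suc_ex)
        have "?s ^ j \<le> ?\<tau> ^ j" using False s(1) by (intro power_mono) auto
        then have "?\<omega> * ?s^2 * ?\<tau>^2 * ?s ^ j \<le> ?\<omega> * ?s^2 * ?\<tau>^2 * ?\<tau> ^ j"
          by (intro mult_left_mono mult_nonneg_nonneg) auto
        then have "(?\<omega> * ?s ^ DIM('a)) * ?\<tau>^2 \<le> (?\<omega> * ?\<tau> ^ DIM('a)) * ?s^2"
          unfolding j power_add by (simp add: ac_simps)
        then have "?a * ?\<tau>^2 \<le> m / A * ?s^2" unfolding s \<tau> .
        also have "\<dots> \<le> (m / A + ?a) * ?s^2" by (intro mult_right_mono) auto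
        finally show ?thesis .
      next
        case False
        then have "?a = m / A" using shape h by auto
        then have "?s = ?\<tau>" by (simp add: level_scale_def)
        then show ?thesis using \<open>\<not> ?\<tau> \<le> ?s\<close> by simp
      qed
    qed
    then show "superlevel ?f h * ?\<tau>^2 \<le> (m / A + superlevel ?f h) * (radius_of_volume TYPE('a) (superlevel ?f h))^2"
      unfolding superlevel_translate[OF f] .
  qed
qed

lemma quad_gap_cube:
  fixes f :: "'a::euclidean_space \<Rightarrow> real"
  assumes f: "bounded_density A f" and A: "0 < A" and m: "(\<integral>\<^sup>+x. ennreal (f x) \<partial>lborel) = ennreal m" "0 < m"
    and R: "0 < R" "\<And>h. 0 < h \<Longrightarrow> superlevel f h \<le> unit_ball_vol DIM('a) * R ^ DIM('a)"
    and d: "0 \<le> d" "d \<le> 1" "\<And>b. ennreal (2 * (m * d)) \<le> (\<integral>\<^sup>+x. ennreal \<bar>f (b + x) - rearrangement f x\<bar> \<partial>lborel)"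
    and dim: "DIM('a) = 1"
  shows "interaction (quad_kernel (18 * R)) f + ennreal (2 * m * (m^3 * d^3 / (16 * A^2)))
    \<le> interaction (quad_kernel (18 * R)) (rearrangement f)"
proof (rule quad_gap_of_level_cost[OF f m R])
  show "0 \<le> m^3 * d^3 / (16 * A^2)" using m d by simp
  have "m \<le> A * (unit_ball_vol DIM('a) * R ^ DIM('a))" using R by (intro mass_le[OF f m(1)]) auto
  then have "m \<le> 2 * R * A" by (simp add: dim mult.commute)
  then have "m^2 \<le> (2 * R * A)^2" using m by (intro power_mono) auto
  then have "m * m^2 * d^3 \<le> m * (2 * R * A)^2 * 1" using m d by (intro mult_mono power_le_one) auto
  also have "\<dots> \<le> R^2 * m * (16 * A^2)" using m by (simp add: power_mult_distrib)
  finally have "m^3 * d^3 \<le> R^2 * m * (16 * A^2)" by (simp add: power3_eq_cube power2_eq_square mult.assoc)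
  then show "m^3 * d^3 / (16 * A^2) \<le> R^2 * m" using A by (simp add: divide_le_eq)
  fix b
  let ?f = "\<lambda>x. f (b + x)"
  have fb: "bounded_density A ?f" by (rule bounded_density_translate[OF f])
  have def: "ennreal (m * d) \<le> (\<integral>\<^sup>+h. ennreal (level_defect ?f h) * indicator {0<..} h \<partial>lborel)"
    using d m by (intro level_defect_ge[OF fb]) (auto simp: rearrangement_translate[OF f])
  show "ennreal (m^3 * d^3 / (16 * A^2)) \<le> (\<integral>\<^sup>+h. ennreal (level_cost ?f h) * indicator {0<..} h \<partial>lborel)"
    by (rule level_cost_ge_cube[OF fb A m(2) dim d(1) def])
qed

section \<open>Reduction to the quadratic kernel\<close>

text \<open>
  \<open>profile_bound w c M\<close> contains the integrated form of \<open>w' r \<le> - c r\<close> on \<open>(0, M)\<close>. The kernels below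
  take the value \<open>\<infinity>\<close> for \<open>r \<le> 0\<close> to be monotone on the whole line; for distances this concerns only
  the null set \<open>x = y\<close>.
\<close>

definition profile_bound :: "(real \<Rightarrow> real) \<Rightarrow> real \<Rightarrow> real \<Rightarrow> bool" where
  "profile_bound w c M \<longleftrightarrow> continuous_on {0<..} w \<and> (\<forall>r s. 0 < r \<longrightarrow> r \<le> s \<longrightarrow> w s \<le> w r) \<and>
     (\<forall>r s. 0 < r \<longrightarrow> r \<le> s \<longrightarrow> s \<le> M \<longrightarrow> c / 2 * (s^2 - r^2) \<le> w r - w s)"

definition truncated_kernel :: "(real \<Rightarrow> real) \<Rightarrow> real \<Rightarrow> real \<Rightarrow> ennreal" where
  "truncated_kernel w M r = (if r \<le> 0 then \<infinity> else ennreal (w r - w M))"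

definition residual_kernel :: "(real \<Rightarrow> real) \<Rightarrow> real \<Rightarrow> real \<Rightarrow> real \<Rightarrow> ennreal" where
  "residual_kernel w c M r = (if r \<le> 0 then \<infinity> else ennreal (max (w r - w M) 0 - c / 2 * max (M^2 - r^2) 0))"

lemma borel_measurable_profile:
  fixes w :: "real \<Rightarrow> real"
  assumes "continuous_on {0<..} w"
  shows "(\<lambda>r. if 0 < r then w r else (0::real)) \<in> borel_measurable borel"
proof -
  have "(\<lambda>r. indicator {0<..} r *\<^sub>R w r) \<in> borel_measurable borel"
    by (rule borel_measurable_continuous_on_indicator[OF _ assms]) simp
  moreover have "(\<lambda>r. indicator {0<..} r *\<^sub>R w r) = (\<lambda>r. if 0 < r then w r else (0::real))"
    by (auto simp: indicator_def)
  ultimately show ?thesis by simp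
qed

text \<open>On \<open>(0, M]\<close> the integrated bound in \<open>profile_bound\<close> says that
  \<open>w r + c / 2 * r^2\<close> does not increase, and beyond \<open>M\<close> both positive
  parts vanish. The same bound with \<open>s = M\<close> makes the residual nonnegative, without
  which the splitting would fail in \<open>ennreal\<close>.\<close>

lemma residual_kernel:
  assumes w: "profile_bound w c M" and M: "0 < M" and c: "0 \<le> c"
  shows "antimono (residual_kernel w c M)" "residual_kernel w c M \<in> borel_measurable borel"
    "truncated_kernel w M \<in> borel_measurable borel"
    "truncated_kernel w M r = residual_kernel w c M r + ennreal (c / 2) * quad_kernel M r"
proof -
  note dec = w[unfolded profile_bound_def, THEN conjunct2, THEN conjunct1, rule_format]
  note quad = w[unfolded profile_bound_def, THEN conjunct2, THEN conjunct2, rule_format]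
  have [measurable]: "(\<lambda>r. if 0 < r then w r else (0::real)) \<in> borel_measurable borel"
    using w by (intro borel_measurable_profile) (simp add: profile_bound_def)
  define w0 where "w0 r = (if 0 < r then w r else (0::real))" for r
  have [measurable]: "w0 \<in> borel_measurable borel" unfolding w0_def[abs_def] by measurable
  have "residual_kernel w c M = (\<lambda>r. if r \<le> 0 then \<infinity> else ennreal (max (w0 r - w M) 0 - c / 2 * max (M^2 - r^2) 0))"
    by (auto simp: residual_kernel_def w0_def)
  then show "residual_kernel w c M \<in> borel_measurable borel" by simp
  have "truncated_kernel w M = (\<lambda>r. if r \<le> 0 then \<infinity> else ennreal (w0 r - w M))"
    by (auto simp: truncated_kernel_def w0_def)
  then show "truncated_kernel w M \<in> borel_measurable borel" by simp
  have sq: "r^2 \<le> s^2" if "0 < r" "r \<le> s" for r s :: real using that by (intro power_mono) auto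
  show "antimono (residual_kernel w c M)"
  proof (rule antimonoI)
    fix r s :: real assume rs: "r \<le> s"
    consider "r \<le> 0" | "0 < r" "s \<le> M" | "0 < r" "M < s" by linarith
    then show "residual_kernel w c M s \<le> residual_kernel w c M r"
    proof cases
      case 2
      have a: "w M \<le> w s" "w M \<le> w r" "s^2 \<le> M^2" "r^2 \<le> M^2" using 2 rs by (auto intro!: dec sq)
      have "c / 2 * (s^2 - r^2) \<le> w r - w s" using 2 rs by (intro quad)
      have "max (w s - w M) 0 - c / 2 * max (M^2 - s^2) 0 \<le> max (w r - w M) 0 - c / 2 * max (M^2 - r^2) 0"
      proof -
        have "max (w s - w M) 0 = w s - w M" "max (w r - w M) 0 = w r - w M" "max (M^2 - s^2) 0 = M^2 - s^2" "max (M^2 - r^2) 0 = M^2 - r^2"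
          using a by auto
        then show ?thesis using \<open>c / 2 * (s^2 - r^2) \<le> w r - w s\<close> by (simp only:) (simp add: algebra_simps)
      qed
      then show ?thesis using 2 rs by (simp add: residual_kernel_def ennreal_leI)
    next
      case 3
      have a: "w s \<le> w M" "M^2 \<le> s^2" using 3 M by (auto intro!: dec sq)
      then show ?thesis using 3 rs by (simp add: residual_kernel_def max_def)
    qed (simp add: residual_kernel_def)
  qed
  show "truncated_kernel w M r = residual_kernel w c M r + ennreal (c / 2) * quad_kernel M r"
  proof -
    consider "r \<le> 0" | "0 < r" "r \<le> M" | "0 < r" "M < r" by linarith
    then show ?thesis
    proof cases
      case 2
      have a: "w M \<le> w r" "r^2 \<le> M^2" using 2 by (auto intro!: dec sq)
      have "c / 2 * (M^2 - r^2) \<le> w r - w M" using 2 by (intro quad) auto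
      moreover have "0 \<le> c / 2 * (M^2 - r^2)" using a c by auto
      ultimately have "ennreal (w r - w M) = ennreal (w r - w M - c / 2 * (M^2 - r^2)) + ennreal (c / 2 * (M^2 - r^2))"
        by (subst ennreal_plus[symmetric]) auto
      also have "ennreal (c / 2 * (M^2 - r^2)) = ennreal (c / 2) * ennreal (M^2 - r^2)" using a c by (intro ennreal_mult) auto
      finally show ?thesis using 2 a by (simp add: truncated_kernel_def residual_kernel_def quad_kernel_def max_def)
    next
      case 3
      have a: "w r \<le> w M" "M^2 \<le> r^2" using 3 M by (auto intro!: dec sq)
      then have "truncated_kernel w M r = 0" "residual_kernel w c M r = 0" "quad_kernel M r = 0"
        using 3 by (auto simp: truncated_kernel_def residual_kernel_def quad_kernel_def max_def ennreal_neg)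
      then show ?thesis by simp
    qed (simp add: truncated_kernel_def residual_kernel_def)
  qed
qed

lemma truncated_interaction_gap:
  fixes f :: "'a::euclidean_space \<Rightarrow> real"
  assumes f: "bounded_density A f" and w: "profile_bound w c M" and M: "0 < M" and c: "0 \<le> c" and z: "0 \<le> z"
    and gap: "interaction (quad_kernel M) f + ennreal z \<le> interaction (quad_kernel M) (rearrangement f)"
  shows "interaction (truncated_kernel w M) f + ennreal (c / 2 * z) \<le> interaction (truncated_kernel w M) (rearrangement f)"
proof -
  note k = residual_kernel[OF w M c]
  note [measurable] = k(2)
  have split: "interaction (truncated_kernel w M) g = interaction (residual_kernel w c M) g + ennreal (c / 2) * interaction (quad_kernel M) g"
    if [measurable]: "g \<in> borel_measurable borel" for g :: "'a \<Rightarrow> real"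
  proof -
    have "interaction (truncated_kernel w M) g = (\<integral>\<^sup>+x. \<integral>\<^sup>+y. ennreal (g x * g y) * residual_kernel w c M (norm (x - y))
       + ennreal (c / 2) * (ennreal (g x * g y) * quad_kernel M (norm (x - y))) \<partial>lborel \<partial>lborel)"
      unfolding interaction_def k(4) by (simp only: distrib_left ac_simps)
    also have "\<dots> = interaction (residual_kernel w c M) g + ennreal (c / 2) * interaction (quad_kernel M) g"
      unfolding interaction_def by (simp add: nn_integral_add nn_integral_cmult)
    finally show ?thesis .
  qed
  have "ennreal (c / 2 * z) = ennreal (c / 2) * ennreal z" using c z by (intro ennreal_mult) auto
  then have "interaction (truncated_kernel w M) f + ennreal (c / 2 * z)
    = interaction (residual_kernel w c M) f + ennreal (c / 2) * (interaction (quad_kernel M) f + ennreal z)"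
    by (simp only: split[OF bounded_densityD(1)[OF f]] distrib_left add.assoc)
  also have "\<dots> \<le> interaction (residual_kernel w c M) (rearrangement f) + ennreal (c / 2) * interaction (quad_kernel M) (rearrangement f)"
    by (intro add_mono riesz_rearrangement[OF f k(1,2)] mult_left_mono gap) simp
  also have "\<dots> = interaction (truncated_kernel w M) (rearrangement f)"
    by (simp only: split[OF borel_measurable_rearrangement[OF f]])
  finally show ?thesis .
qed

text \<open>
  For type \<open>ereal\<close> one has \<open>\<infinity> - \<infinity> = \<infinity>\<close>, hence nothing is to be shown if the positive part \<open>P'\<close> of the
  energy of the rearrangement is infinite.
\<close>

lemma ereal_energy_gap:
  fixes P N P' N' X X' :: ennreal and a b t :: real
  assumes gap: "X + ennreal t \<le> X'" and P: "P \<le> X + ennreal b" and PN: "P + ennreal a \<le> X + ennreal b + N"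
    and P': "X' + ennreal b + N' \<le> P' + ennreal a" and N': "N' \<le> ennreal a" and nn: "0 \<le> a" "0 \<le> b" "0 \<le> t"
  shows "ereal t \<le> (enn2ereal P' - enn2ereal N') - (enn2ereal P - enn2ereal N)"
proof -
  have "N' < \<infinity>" using N' by (rule order.strict_trans1) simp
  then obtain n' where n': "N' = ennreal n'" "0 \<le> n'" by (cases N') auto
  show ?thesis
  proof (cases P')
    case top
    then show ?thesis by (simp add: n')
  next
    case (real p')
    have "X' \<le> X' + ennreal b + N'" by (metis add.assoc add_increasing2 order_refl zero_le)
    also have "\<dots> \<le> ennreal (p' + a)" using P' real nn by simp
    finally have "X' < \<infinity>" by (rule order.strict_trans1) simp
    then obtain x' where x': "X' = ennreal x'" "0 \<le> x'" by (cases X') auto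
    have "X \<le> X'" using gap by (metis add_increasing2 order_refl order_trans zero_le)
    then have "X < \<infinity>" using x' by (auto intro: le_less_trans)
    then obtain x where x: "X = ennreal x" "0 \<le> x" by (cases X) auto
    have "P < \<infinity>" using P x nn by (auto intro: le_less_trans simp: ennreal_plus[symmetric] simp del: ennreal_plus)
    then obtain p where p: "P = ennreal p" "0 \<le> p" by (cases P) auto
    show ?thesis
    proof (cases N)
      case top
      then show ?thesis by (simp add: n' real p enn2ereal_ennreal)
    next
      case (real n)
      have 1: "x + t \<le> x'" using gap x x' nn by (simp add: ennreal_plus[symmetric] del: ennreal_plus)
      have 2: "p + a \<le> x + b + n" using PN x p real nn by (simp add: ennreal_plus[symmetric] del: ennreal_plus)
      have 3: "x' + b + n' \<le> p' + a" using P' x' n' \<open>P' = ennreal p'\<close> \<open>0 \<le> p'\<close> nn by (simp add: ennreal_plus[symmetric] del: ennreal_plus)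
      show ?thesis using 1 2 3 by (simp add: n' real p \<open>P' = ennreal p'\<close> \<open>0 \<le> p'\<close> enn2ereal_ennreal)
    qed
  qed
qed

text \<open>With \<open>v = w M\<close>, the value \<open>W\<close> is at most \<open>v\<close> plus
  the positive part of \<open>W - v\<close>, so truncation can only raise the energy of
  \<open>f\<close>. For the rearrangement, whose points are at distance at most
  \<open>2 * R \<le> M\<close>, equality holds. The constant \<open>v\<close> contributes
  \<open>v * m^2\<close> to both energies and cancels.\<close>

lemma interaction_energy_gap:
  fixes f :: "'a::euclidean_space \<Rightarrow> real" and W :: "'a \<Rightarrow> real"
  assumes f: "bounded_density A f" and m: "(\<integral>\<^sup>+x. ennreal (f x) \<partial>lborel) = ennreal m" "0 \<le> m"
    and W: "\<And>x. x \<noteq> 0 \<Longrightarrow> W x = w (norm x)" and w: "profile_bound w c M"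
    and supp: "\<And>x. R < norm x \<Longrightarrow> rearrangement f x = 0" and R: "0 < R" "2 * R \<le> M"
    and gap: "interaction (truncated_kernel w M) f + ennreal t \<le> interaction (truncated_kernel w M) (rearrangement f)" and t: "0 \<le> t"
  shows "ereal t \<le> interaction_energy W (rearrangement f) - interaction_energy W f"
proof -
  let ?g = "rearrangement f" and ?k = "truncated_kernel w M"
  have [measurable]: "(\<lambda>r. if 0 < r then w r else (0::real)) \<in> borel_measurable borel"
    using w by (intro borel_measurable_profile) (simp add: profile_bound_def)
  define w0 where "w0 r = (if 0 < r then w r else (0::real))" for r
  have [measurable]: "w0 \<in> borel_measurable borel" unfolding w0_def[abs_def] by measurable
  have "W = (\<lambda>x. if x = 0 then W 0 else w0 (norm x))" using W by (auto simp: w0_def)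
  moreover have "(\<lambda>x::'a. if x = 0 then W 0 else w0 (norm x)) \<in> borel_measurable borel" by measurable
  ultimately have [measurable]: "W \<in> borel_measurable borel" by simp
  have k_alt: "?k = (\<lambda>r. if r \<le> 0 then \<infinity> else ennreal (w0 r - w M))" by (auto simp: truncated_kernel_def w0_def)
  have [measurable]: "?k \<in> borel_measurable borel" unfolding k_alt by measurable
  have [measurable]: "f \<in> borel_measurable borel" "?g \<in> borel_measurable borel"
    using bounded_densityD(1)[OF f] borel_measurable_rearrangement[OF f] by auto
  have f0: "0 \<le> f x" and g0: "0 \<le> ?g x" for x using bounded_densityD(3)[OF f] rearrangement_nonneg[OF f] by auto
  have gm: "(\<integral>\<^sup>+x. ennreal (?g x) \<partial>lborel) = ennreal m" using m by (simp add: nn_integral_rearrangement[OF f])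
  define v where "v = w M"
  have k: "?k (norm (x - y)) = ennreal (W (x - y) - v)" if "x \<noteq> y" for x y :: 'a
    using that W[of "x - y"] by (simp add: truncated_kernel_def v_def)
  define P where "P u = (\<integral>\<^sup>+x. \<integral>\<^sup>+y. ennreal (u x * u y * W (x - y)) \<partial>lborel \<partial>lborel)" for u :: "'a \<Rightarrow> real"
  define N where "N u = (\<integral>\<^sup>+x. \<integral>\<^sup>+y. ennreal (- (u x * u y * W (x - y))) \<partial>lborel \<partial>lborel)" for u :: "'a \<Rightarrow> real"
  have E: "interaction_energy W u = enn2ereal (P u) - enn2ereal (N u)" for u
    by (simp add: interaction_energy_def P_def N_def nn_integral_completion)
  \<comment> \<open>The sign of \<open>v\<close> is unknown, so its positive and negative parts
    enter on different sides, as \<open>S v\<close> and \<open>S (- v)\<close>.\<close>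
  define S where "S c' u = (\<integral>\<^sup>+x. \<integral>\<^sup>+y. ennreal (u x * u y) * ennreal c' \<partial>lborel \<partial>lborel)" for c' and u :: "'a \<Rightarrow> real"
  have S: "S c' u = ennreal (max 0 c' * m^2)"
    if [measurable]: "u \<in> borel_measurable borel" and u: "\<And>x. 0 \<le> u x" "(\<integral>\<^sup>+x. ennreal (u x) \<partial>lborel) = ennreal m" for u c'
  proof -
    have "S c' u = ennreal c' * (ennreal m * ennreal m)"
      unfolding S_def by (simp add: ennreal_mult u nn_integral_cmult nn_integral_multc mult.commute)
    also have "ennreal c' = ennreal (max 0 c')" by (cases "0 \<le> c'") (auto simp: ennreal_neg)
    finally show ?thesis using m(2) by (simp add: ennreal_mult power2_eq_square)
  qed
  have em: "ennreal (u * W') = ennreal u * ennreal W'" "ennreal (- (u * W')) = ennreal u * ennreal (- W')" if "0 \<le> u" for u W' :: real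
    using that ennreal_mult'[of u W'] ennreal_mult'[of u "- W'"] by auto
  have mx: "ennreal s = ennreal (max 0 s)" for s by (cases "0 \<le> s") (auto simp: ennreal_neg)
  have s1: "ennreal s \<le> ennreal (s - v) + ennreal v" for s
  proof -
    have "ennreal (max 0 s) \<le> ennreal (max 0 (s - v) + max 0 v)" by (rule ennreal_leI) linarith
    then show ?thesis by (simp add: mx[symmetric] ennreal_plus)
  qed
  have s2: "ennreal s + ennreal (- v) \<le> ennreal (s - v) + ennreal v + ennreal (- s)" for s
  proof -
    have "ennreal (max 0 s + max 0 (- v)) \<le> ennreal (max 0 (s - v) + max 0 v + max 0 (- s))" by (rule ennreal_leI) linarith
    then show ?thesis by (simp add: mx[symmetric] ennreal_plus)
  qed
  have s3: "ennreal (s - v) + ennreal v + ennreal (- s) \<le> ennreal s + ennreal (- v)" if "v \<le> s" for s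
  proof -
    have "ennreal (max 0 (s - v) + max 0 v + max 0 (- s)) \<le> ennreal (max 0 s + max 0 (- v))" using that by (intro ennreal_leI) linarith
    then show ?thesis by (simp add: mx[symmetric] ennreal_plus)
  qed
  have diag: "AE y in lborel. y \<noteq> x" for x :: 'a by (rule AE_lborel_singleton)
  have P1: "P f \<le> interaction ?k f + S v f"
  proof -
    have "P f \<le> (\<integral>\<^sup>+x. \<integral>\<^sup>+y. ennreal (f x * f y) * ?k (norm (x - y)) + ennreal (f x * f y) * ennreal v \<partial>lborel \<partial>lborel)"
      unfolding P_def
    proof (rule nn_integral_mono, rule nn_integral_mono_AE)
      fix x
      show "AE y in lborel. ennreal (f x * f y * W (x - y)) \<le> ennreal (f x * f y) * ?k (norm (x - y)) + ennreal (f x * f y) * ennreal v"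
        using diag[of x]
      proof eventually_elim
        case (elim y)
        then have "x \<noteq> y" by auto
        then show ?case
          using f0 by (simp add: em k distrib_left[symmetric] mult_left_mono s1)
      qed
    qed
    also have "\<dots> = interaction ?k f + S v f" unfolding interaction_def S_def by (simp add: nn_integral_add)
    finally show ?thesis .
  qed
  have P2: "P f + S (- v) f \<le> interaction ?k f + S v f + N f"
  proof -
    have "P f + S (- v) f = (\<integral>\<^sup>+x. \<integral>\<^sup>+y. ennreal (f x * f y * W (x - y)) + ennreal (f x * f y) * ennreal (- v) \<partial>lborel \<partial>lborel)"
      unfolding P_def S_def by (simp add: nn_integral_add)
    also have "\<dots> \<le> (\<integral>\<^sup>+x. \<integral>\<^sup>+y. ennreal (f x * f y) * ?k (norm (x - y)) + ennreal (f x * f y) * ennreal v + ennreal (- (f x * f y * W (x - y))) \<partial>lborel \<partial>lborel)"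
    proof (rule nn_integral_mono, rule nn_integral_mono_AE)
      fix x
      show "AE y in lborel. ennreal (f x * f y * W (x - y)) + ennreal (f x * f y) * ennreal (- v)
        \<le> ennreal (f x * f y) * ?k (norm (x - y)) + ennreal (f x * f y) * ennreal v + ennreal (- (f x * f y * W (x - y)))"
        using diag[of x]
      proof eventually_elim
        case (elim y)
        then have "x \<noteq> y" by auto
        then show ?case
          using f0 by (simp add: em k distrib_left[symmetric] mult_left_mono s2)
      qed
    qed
    also have "\<dots> = interaction ?k f + S v f + N f" unfolding interaction_def S_def N_def by (simp add: nn_integral_add)
    finally show ?thesis .
  qed
  have Wv: "v \<le> W (x - y)" if "x \<noteq> y" "norm x \<le> R" "norm y \<le> R" for x y :: 'a
  proof -
    have "0 < norm (x - y)" using that by simp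
    moreover have "norm (x - y) \<le> M" using norm_triangle_ineq4[of x y] that R by linarith
    ultimately show ?thesis using w W[of "x - y"] that by (simp add: profile_bound_def v_def)
  qed
  have z: "?g x * ?g y = 0" if "\<not> (norm x \<le> R \<and> norm y \<le> R)" for x y using supp[of x] supp[of y] that by auto
  have P3: "interaction ?k ?g + S v ?g + N ?g \<le> P ?g + S (- v) ?g"
  proof -
    have "interaction ?k ?g + S v ?g + N ?g = (\<integral>\<^sup>+x. \<integral>\<^sup>+y. ennreal (?g x * ?g y) * ?k (norm (x - y)) + ennreal (?g x * ?g y) * ennreal v + ennreal (- (?g x * ?g y * W (x - y))) \<partial>lborel \<partial>lborel)"
      unfolding interaction_def S_def N_def by (simp add: nn_integral_add)
    also have "\<dots> \<le> (\<integral>\<^sup>+x. \<integral>\<^sup>+y. ennreal (?g x * ?g y * W (x - y)) + ennreal (?g x * ?g y) * ennreal (- v) \<partial>lborel \<partial>lborel)"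
    proof (rule nn_integral_mono, rule nn_integral_mono_AE)
      fix x
      show "AE y in lborel. ennreal (?g x * ?g y) * ?k (norm (x - y)) + ennreal (?g x * ?g y) * ennreal v + ennreal (- (?g x * ?g y * W (x - y)))
        \<le> ennreal (?g x * ?g y * W (x - y)) + ennreal (?g x * ?g y) * ennreal (- v)"
        using diag[of x]
      proof eventually_elim
        case (elim y)
        then have xy: "x \<noteq> y" by auto
        show ?case
        proof (cases "norm x \<le> R \<and> norm y \<le> R")
          case True
          then show ?thesis using g0 xy Wv[OF xy] by (simp add: em k distrib_left[symmetric] mult_left_mono s3)
        qed (simp add: z)
      qed
    qed
    also have "\<dots> = P ?g + S (- v) ?g" unfolding P_def S_def by (simp add: nn_integral_add)
    finally show ?thesis .
  qed
  have N1: "N ?g \<le> S (- v) ?g"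
    unfolding N_def S_def
  proof (rule nn_integral_mono, rule nn_integral_mono_AE)
    fix x
    show "AE y in lborel. ennreal (- (?g x * ?g y * W (x - y))) \<le> ennreal (?g x * ?g y) * ennreal (- v)"
      using diag[of x]
    proof eventually_elim
      case (elim y)
      then have xy: "x \<noteq> y" by auto
      show ?case
      proof (cases "norm x \<le> R \<and> norm y \<le> R")
        case True
        then show ?thesis using g0 xy Wv[OF xy] by (simp add: em mult_left_mono ennreal_leI)
      qed (simp add: z)
    qed
  qed
  note Sf = S[OF \<open>f \<in> borel_measurable borel\<close> f0 m(1)] and Sg = S[OF \<open>?g \<in> borel_measurable borel\<close> g0 gm]
  show ?thesis
    unfolding E
    by (rule ereal_energy_gap[OF gap P1[unfolded Sf] P2[unfolded Sf] P3[unfolded Sg] N1[unfolded Sg] _ _ t]) auto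
qed

section \<open>Borel representatives, superlevel volumes and the asymmetry\<close>

lemma AE_lborel_translation:
  assumes "AE x in (lborel :: 'a::euclidean_space measure). P x"
  shows "AE x in lborel. P (b + x)"
proof -
  from AE_E[OF assms] obtain N where N: "{x \<in> space lborel. \<not> P x} \<subseteq> N" "emeasure lborel N = 0" "N \<in> sets lborel" by metis
  have [measurable]: "N \<in> sets borel" using N(3) by simp
  have p: "{x. b + x \<in> N} \<in> sets borel" by measurable
  have "emeasure lborel {x. b + x \<in> N} = (\<integral>\<^sup>+x. indicator {x. b + x \<in> N} x \<partial>lborel)" using p by simp
  also have "\<dots> = (\<integral>\<^sup>+x. indicator N (b + x) \<partial>lborel)" by (intro nn_integral_cong) (simp add: indicator_def)
  also have "\<dots> = (\<integral>\<^sup>+x. indicator N x \<partial>lborel)" by (rule nn_integral_translation) measurable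
  also have "\<dots> = 0" using N by simp
  finally have "{x. b + x \<in> N} \<in> null_sets lborel" using p by auto
  moreover have "{x \<in> space lborel. \<not> P (b + x)} \<subseteq> {x. b + x \<in> N}" using N(1) by auto
  ultimately show ?thesis by (rule AE_I')
qed

lemma borel_measurable_lebesgue_AE:
  fixes g h :: "'a::euclidean_space \<Rightarrow> real"
  assumes g: "g \<in> borel_measurable borel" and ae: "AE x in lborel. h x = g x"
  shows "h \<in> borel_measurable lebesgue"
proof (rule measurableI)
  fix S :: "real set" assume S: "S \<in> sets borel"
  have 1: "AE x in lebesgue. x \<in> g -` S \<longleftrightarrow> x \<in> h -` S" using ae by (auto simp: AE_completion_iff)
  have 2: "g -` S \<in> sets lebesgue" using measurable_sets[OF g S] by simp
  show "h -` S \<inter> space lebesgue \<in> sets lebesgue" using completion.in_sets_AE[OF 1 2] by simp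
qed simp

lemma L1_norm_AE:
  fixes g h :: "'a::euclidean_space \<Rightarrow> real"
  assumes g: "g \<in> borel_measurable borel" and ae: "AE x in lborel. h x = g x"
  shows "L1_norm h = (LINT x|lborel. \<bar>g x\<bar>)"
proof -
  have "L1_norm h = (LINT x|lebesgue. \<bar>g x\<bar>)"
    unfolding L1_norm_def
  proof (rule integral_cong_AE)
    show "(\<lambda>x. \<bar>h x\<bar>) \<in> borel_measurable lebesgue" using borel_measurable_lebesgue_AE[OF g ae] by simp
    show "(\<lambda>x. \<bar>g x\<bar>) \<in> borel_measurable lebesgue" using g by (intro measurable_completion) simp
    show "AE x in lebesgue. \<bar>h x\<bar> = \<bar>g x\<bar>" using ae by (auto simp: AE_completion_iff)
  qed
  also have "\<dots> = (LINT x|lborel. \<bar>g x\<bar>)" using g by (intro integral_completion) simp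
  finally show ?thesis .
qed

lemma interaction_energy_AE:
  fixes g h :: "'a::euclidean_space \<Rightarrow> real"
  assumes ae: "AE x in lborel. h x = g x"
  shows "interaction_energy W h = interaction_energy W g"
proof -
  have "(\<integral>\<^sup>+x. \<integral>\<^sup>+y. F (h x) (h y) x y \<partial>lebesgue \<partial>lebesgue) = (\<integral>\<^sup>+x. \<integral>\<^sup>+y. F (g x) (g y) x y \<partial>lebesgue \<partial>lebesgue)"
    for F :: "real \<Rightarrow> real \<Rightarrow> 'a \<Rightarrow> 'a \<Rightarrow> ennreal"
  proof (rule nn_integral_cong_AE)
    have ae': "AE x in lebesgue. h x = g x" using ae by (simp add: AE_completion_iff)
    then show "AE x in lebesgue. (\<integral>\<^sup>+y. F (h x) (h y) x y \<partial>lebesgue) = (\<integral>\<^sup>+y. F (g x) (g y) x y \<partial>lebesgue)"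
    proof eventually_elim
      case (elim x)
      show ?case by (rule nn_integral_cong_AE) (use ae' in eventually_elim, simp add: elim)
    qed
  qed
  from this[of "\<lambda>a b x y. ennreal (a * b * W (x - y))"] this[of "\<lambda>a b x y. ennreal (- (a * b * W (x - y)))"]
  show ?thesis by (simp add: interaction_energy_def)
qed

text \<open>A Borel version of \<open>\<rho>\<close>, clamped between 0 and the essential supremum,
  has pointwise the bounds that \<open>\<rho>\<close> has almost everywhere. Superlevel volumes, and
  with them the rearrangement, do not notice the change.\<close>

lemma density_class_representative:
  fixes \<rho> :: "'a::euclidean_space \<Rightarrow> real"
  assumes \<rho>: "\<rho> \<in> density_class R"
  obtains f where "bounded_density (Linf_norm \<rho>) f" "AE x in lborel. \<rho> x = f x" "0 < Linf_norm \<rho>" "0 < L1_norm \<rho>"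
    "(\<integral>\<^sup>+x. ennreal (f x) \<partial>lborel) = ennreal (L1_norm \<rho>)" "rearrangement \<rho> = rearrangement f"
    "AE x in lborel. \<bar>\<rho> x\<bar> \<le> Linf_norm \<rho>"
proof -
  let ?S = "esssup lebesgue (\<lambda>x. ereal \<bar>\<rho> x\<bar>)" and ?A = "Linf_norm \<rho>"
  have int: "integrable lebesgue \<rho>" and nn: "AE x in lebesgue. 0 \<le> \<rho> x" and S: "?S < \<infinity>" and meas: "\<rho> \<in> borel_measurable lebesgue"
    and nz: "\<not> (AE x in lebesgue. \<rho> x = 0)"
    using \<rho> by (auto simp: density_class_def ess_bounded_def)
  have leS: "AE x in lebesgue. ereal \<bar>\<rho> x\<bar> \<le> ?S" by (rule esssup_AE)
  have Sr: "?S = ereal ?A"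
  \<comment> \<open>\<open>Linf_norm\<close> turns infinite values into 0, so these must be
    excluded: one by essential boundedness, the other because it would force \<open>\<rho>\<close>
    to vanish almost everywhere.\<close>
  proof (cases ?S)
    case MInf
    have "AE x in lebesgue. \<rho> x = 0" using leS by eventually_elim (simp add: MInf)
    then show ?thesis using nz by simp
  qed (use S in \<open>auto simp: Linf_norm_def\<close>)
  have le: "AE x in lebesgue. \<bar>\<rho> x\<bar> \<le> ?A" using leS unfolding Sr by simp
  have A: "0 < ?A"
  proof (rule ccontr)
    assume "\<not> 0 < ?A"
    have "AE x in lebesgue. \<rho> x = 0" using le by eventually_elim (use \<open>\<not> 0 < ?A\<close> in linarith)
    then show False using nz by simp
  qed
  obtain g where g: "g \<in> borel_measurable lborel" "AE x in lborel. \<rho> x = g x"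
    using completion_ex_borel_measurable_real[OF meas] by auto
  define f where "f x = max 0 (min ?A (g x))" for x
  have fm: "f \<in> borel_measurable borel" using g(1) unfolding f_def[abs_def] by measurable
  have fb: "0 \<le> f x" "f x \<le> ?A" for x using A by (auto simp: f_def)
  have fae: "AE x in lborel. \<rho> x = f x"
    using g(2) nn[unfolded AE_completion_iff] le[unfolded AE_completion_iff] by eventually_elim (auto simp: f_def)
  have "integrable lebesgue f"
  proof (rule integrable_cong_AE_imp[OF int])
    show "f \<in> borel_measurable lebesgue" using fm by (intro measurable_completion) simp
    show "AE x in lebesgue. \<rho> x = f x" unfolding AE_completion_iff by (rule fae)
  qed
  then have fi: "integrable lborel f" using integrable_completion[of f lborel] fm by simp
  have L1: "L1_norm \<rho> = (LINT x|lborel. f x)" using L1_norm_AE[OF fm fae] fb by simp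
  have nnf: "(\<integral>\<^sup>+x. ennreal (f x) \<partial>lborel) = ennreal (L1_norm \<rho>)" using fi fb by (simp add: nn_integral_eq_integral L1)
  have "0 \<le> L1_norm \<rho>" by (simp add: L1_norm_def)
  moreover have "L1_norm \<rho> \<noteq> 0"
  proof
    assume "L1_norm \<rho> = 0"
    then have "AE x in lborel. f x = 0" using integral_nonneg_eq_0_iff_AE[OF fi] fb by (simp add: L1)
    then have "AE x in lborel. \<rho> x = 0" using fae by eventually_elim simp
    then show False using nz by (simp add: AE_completion_iff)
  qed
  ultimately have m: "0 < L1_norm \<rho>" by simp
  have "rearrangement \<rho> = rearrangement f"
  proof (rule rearrangement_cong)
    fix h :: real
    show "emeasure lebesgue {x. h < \<rho> x} = emeasure lebesgue {x. h < f x}"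
    proof (rule emeasure_eq_AE)
      show "AE x in lebesgue. (x \<in> {x. h < \<rho> x}) = (x \<in> {x. h < f x})" using fae by (auto simp: AE_completion_iff)
      show "{x. h < \<rho> x} \<in> sets lebesgue" using measurable_sets[OF meas, of "{h<..}"] by (simp add: vimage_def)
      have "{x. h < f x} \<in> sets borel" using fm by measurable
      then show "{x. h < f x} \<in> sets lebesgue" by simp
    qed
  qed
  moreover have "bounded_density ?A f" unfolding bounded_density_def using fm fi fb by auto
  ultimately show ?thesis using that[of f] fae A m nnf le[unfolded AE_completion_iff] by simp
qed

lemma superlevel_antimono:
  assumes f: "bounded_density A f" and "0 < h" "h \<le> h'"
  shows "superlevel f h' \<le> superlevel f h"
proof -
  note [measurable] = bounded_densityD(1)[OF f]
  have "{x. h < f x} \<in> sets borel" "{x. h' < f x} \<in> sets borel" by measurable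
  then show ?thesis
    unfolding superlevel_def using emeasure_superlevel[OF f assms(2)] assms(3)
    by (intro measure_mono_fmeasurable) (auto simp: fmeasurable_def)
qed

text \<open>Otherwise, at a point with norm strictly between \<open>R\<close> and the radius of the
  symmetrized superlevel set, the rearrangement would be at least \<open>h > 0\<close>.\<close>

lemma superlevel_le_of_support:
  fixes f :: "'a::euclidean_space \<Rightarrow> real"
  assumes f: "bounded_density A f" and supp: "topological_support (rearrangement f) \<subseteq> cball 0 R" and R: "0 < R" and h: "0 < h"
  shows "superlevel f h \<le> unit_ball_vol DIM('a) * R ^ DIM('a)"
proof (rule ccontr)
  let ?a = "superlevel f h" and ?s = "radius_of_volume TYPE('a) (superlevel f h)" and ?\<omega> = "unit_ball_vol DIM('a)"
  assume "\<not> ?a \<le> ?\<omega> * R ^ DIM('a)"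
  moreover have s: "0 \<le> ?s" "?\<omega> * ?s ^ DIM('a) = ?a" using radius_of_volume[of ?a, where 'a='a] by auto
  ultimately have "?\<omega> * R ^ DIM('a) < ?\<omega> * ?s ^ DIM('a)" by simp
  then have "R ^ DIM('a) < ?s ^ DIM('a)" by (rule mult_left_less_imp_less) simp
  then have Rs: "R < ?s" using s(1) by (rule power_less_imp_less_base)
  obtain x :: 'a where x: "norm x = (R + ?s) / 2" using vector_choose_size[of "(R + ?s) / 2"] R s(1) by auto
  have "ball_volume x < ?a" using x Rs by (subst ball_volume_less_iff) auto
  then have "h \<le> rearrangement f x"
    using superlevel_antimono[OF f] by (intro rearrangement_ge[OF f]) (auto intro: less_le_trans)
  then have "x \<in> topological_support (rearrangement f)"
    unfolding topological_support_def using h by (intro closure_subset[THEN subsetD]) auto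
  then show False using supp x Rs by auto
qed

lemma asymmetry_bounds:
  fixes \<rho> :: "'a::euclidean_space \<Rightarrow> real"
  assumes f: "bounded_density A f" and ae: "AE x in lborel. \<rho> x = f x" and re: "rearrangement \<rho> = rearrangement f"
    and m: "(\<integral>\<^sup>+x. ennreal (f x) \<partial>lborel) = ennreal (L1_norm \<rho>)" "0 < L1_norm \<rho>"
  shows "0 \<le> asymmetry \<rho>" "asymmetry \<rho> \<le> 1"
    "ennreal (2 * (L1_norm \<rho> * asymmetry \<rho>)) \<le> (\<integral>\<^sup>+x. ennreal \<bar>f (b + x) - rearrangement f x\<bar> \<partial>lborel)"
proof -
  let ?m = "L1_norm \<rho>" and ?g = "rearrangement f"
  define D where "D a = (LINT x|lborel. \<bar>f (a + x) - ?g x\<bar>)" for a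
  note [measurable] = bounded_densityD(1)[OF f] borel_measurable_rearrangement[OF f]
  have L: "L1_norm (\<lambda>x. \<rho> (x + a) - rearrangement \<rho> x) = D a" for a
    unfolding D_def
  proof (rule L1_norm_AE)
    show "(\<lambda>x. f (a + x) - ?g x) \<in> borel_measurable borel" by measurable
    show "AE x in lborel. \<rho> (x + a) - rearrangement \<rho> x = f (a + x) - ?g x"
      using AE_lborel_translation[OF ae, of a] by eventually_elim (simp add: re add.commute)
  qed
  have D0: "0 \<le> D a" for a by (simp add: D_def)
  have asym: "asymmetry \<rho> = (INF a. D a / (2 * ?m))" by (simp add: asymmetry_def L)
  have bdd: "bdd_below (range (\<lambda>a. D a / (2 * ?m)))" using D0 m(2) by (intro bdd_belowI[of _ 0]) auto
  show "0 \<le> asymmetry \<rho>" unfolding asym using D0 m(2) by (intro cINF_greatest) auto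
  have le: "asymmetry \<rho> \<le> D a / (2 * ?m)" for a unfolding asym by (rule cINF_lower[OF bdd]) simp
  have fi: "integrable lborel (\<lambda>x. f (a + x))" for a using bounded_densityD(2)[OF bounded_density_translate[OF f]] .
  have gi: "integrable lborel ?g" using bounded_densityD(2)[OF bounded_density_rearrangement[OF f]] .
  have nnD: "(\<integral>\<^sup>+x. ennreal \<bar>f (a + x) - ?g x\<bar> \<partial>lborel) = ennreal (D a)" for a
    unfolding D_def using fi gi by (intro nn_integral_eq_integral) auto
  have "2 * (?m * asymmetry \<rho>) \<le> D b" using le[of b] m(2) by (simp add: field_simps)
  then show "ennreal (2 * (?m * asymmetry \<rho>)) \<le> (\<integral>\<^sup>+x. ennreal \<bar>f (b + x) - ?g x\<bar> \<partial>lborel)"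
    unfolding nnD by (rule ennreal_leI)
  \<comment> \<open>The trivial translation already shows that the asymmetry is at most 1, since
    \<open>f\<close> and its rearrangement have the same mass.\<close>
  have "ennreal (D 0) \<le> (\<integral>\<^sup>+x. ennreal (f x) + ennreal (?g x) \<partial>lborel)"
    unfolding nnD[symmetric] using bounded_densityD(3)[OF f] rearrangement_nonneg[OF f]
    by (intro nn_integral_mono) (auto simp: ennreal_plus[symmetric] abs_le_iff simp del: ennreal_plus intro!: ennreal_leI add_nonneg_nonneg)
  also have "\<dots> = ennreal ?m + ennreal ?m" by (simp add: nn_integral_add m(1) nn_integral_rearrangement[OF f])
  also have "\<dots> = ennreal (2 * ?m)" using m(2) by (simp add: ennreal_plus[symmetric] del: ennreal_plus)
  finally have "D 0 \<le> 2 * ?m" using m(2) by (subst (asm) ennreal_le_iff) auto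
  then have "D 0 / (2 * ?m) \<le> 1" using m(2) by (simp add: divide_le_eq)
  then show "asymmetry \<rho> \<le> 1" using le[of 0] by linarith
qed

section \<open>The constant and the deficit inequalities for a given profile\<close>

text \<open>The factor \<open>8 * n\<close> comes from the square estimate for the level costs, the
  power of the unit ball volume from expressing the radius of a ball of volume
  \<open>m / A\<close>.\<close>

definition gap_const :: "'a::euclidean_space itself \<Rightarrow> real" where
  "gap_const _ = 1 / (8 * DIM('a) * unit_ball_vol DIM('a) powr (2 / DIM('a)))"

lemma gap_const_pos: "0 < gap_const TYPE('a::euclidean_space)"
  unfolding gap_const_def using DIM_positive[where 'a='a] by (intro divide_pos_pos mult_pos_pos) auto

lemma level_scale_square:
  assumes "0 < m" "0 < A"
  shows "(level_scale TYPE('a::euclidean_space) A m)^2 / (8 * DIM('a))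
    = gap_const TYPE('a) * m powr (2 / DIM('a)) * A powr (- 2 / DIM('a))"
proof -
  let ?n = "real DIM('a)" and ?\<omega> = "unit_ball_vol DIM('a)"
  have p: "0 < m / A / ?\<omega>" using assms by simp
  have "(level_scale TYPE('a) A m)^2 = (m / A / ?\<omega>) powr (1 / ?n) * (m / A / ?\<omega>) powr (1 / ?n)"
    unfolding level_scale_def radius_of_volume_def power2_eq_square using p by (simp only: root_powr_inverse DIM_positive)
  also have "\<dots> = (m / A / ?\<omega>) powr (2 / ?n)" by (simp add: powr_add[symmetric])
  also have "\<dots> = m powr (2 / ?n) / A powr (2 / ?n) / ?\<omega> powr (2 / ?n)"
    using assms by (simp add: powr_divide powr_mult less_imp_le)
  finally show ?thesis by (simp add: gap_const_def powr_minus_divide)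
qed

text \<open>The factor in front of the indicator must be the essential supremum, so the
  representative takes almost everywhere only the values 0 and \<open>Linf_norm \<rho>\<close>. Its
  superlevel volume is constant on the heights in between and integrates to the mass.\<close>

lemma superlevel_multiple_of_indicator:
  fixes \<rho> :: "'a::euclidean_space \<Rightarrow> real"
  assumes \<rho>: "\<rho> \<in> density_class R" and mult: "multiple_of_indicator \<rho>"
    and f: "bounded_density (Linf_norm \<rho>) f" "AE x in lborel. \<rho> x = f x" "0 < Linf_norm \<rho>" "AE x in lborel. \<bar>\<rho> x\<bar> \<le> Linf_norm \<rho>"
    and m: "(\<integral>\<^sup>+x. ennreal (f x) \<partial>lborel) = ennreal m" "0 < m"
    and h: "0 < h" "h < Linf_norm \<rho>"
  shows "superlevel f h = m / Linf_norm \<rho>"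
proof -
  let ?A = "Linf_norm \<rho>"
  obtain a D where aD: "AE x in lborel. \<rho> x = a * indicator D x"
    using mult unfolding multiple_of_indicator_def AE_completion_iff by blast
  have nn: "AE x in lborel. 0 \<le> \<rho> x" and nz: "\<not> (AE x in lborel. \<rho> x = 0)" and meas: "\<rho> \<in> borel_measurable lebesgue"
    using \<rho> by (auto simp: density_class_def ess_bounded_def AE_completion_iff)
  have a0: "0 < a"
  proof (rule ccontr)
    assume a: "\<not> 0 < a"
    have "AE x in lborel. \<rho> x = 0"
      using aD nn by eventually_elim (use a in \<open>auto simp: indicator_def split: if_splits\<close>)
    then show False using nz by simp
  qed
  have aA: "a \<le> ?A"
  proof (rule ccontr)
    assume a: "\<not> a \<le> ?A"
    have "AE x in lborel. \<rho> x = 0"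
      using aD f(4) by eventually_elim (use a a0 in \<open>auto simp: indicator_def split: if_splits\<close>)
    then show False using nz by simp
  qed
  have "esssup lebesgue (\<lambda>x. ereal \<bar>\<rho> x\<bar>) \<le> ereal a"
  proof (rule esssup_I)
    show "(\<lambda>x. ereal \<bar>\<rho> x\<bar>) \<in> borel_measurable lebesgue" using meas by simp
    show "AE x in lebesgue. ereal \<bar>\<rho> x\<bar> \<le> ereal a"
      unfolding AE_completion_iff using aD by eventually_elim (use a0 in \<open>auto simp: indicator_def\<close>)
  qed
  then have "?A \<le> a" using f(3) by (cases "esssup lebesgue (\<lambda>x. ereal \<bar>\<rho> x\<bar>)") (auto simp: Linf_norm_def)
  then have A: "a = ?A" using aA by simp
  have two: "AE x in lborel. f x = 0 \<or> f x = ?A"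
    using aD f(2) by eventually_elim (auto simp: A indicator_def)
  note [measurable] = bounded_densityD(1)[OF f(1)]
  have const: "superlevel f h' = superlevel f h" if h': "0 < h'" "h' < ?A" for h'
    unfolding superlevel_def
  proof (rule measure_eq_AE)
    show "AE x in lborel. (x \<in> {x. h' < f x}) = (x \<in> {x. h < f x})"
      using two by eventually_elim (use h h' in auto)
  qed measurable
  have "ennreal m = (\<integral>\<^sup>+h'. ennreal (superlevel f h') * indicator {0<..} h' \<partial>lborel)"
    by (simp add: nn_integral_superlevel_eq[OF f(1)] m)
  also have "\<dots> = (\<integral>\<^sup>+h'. ennreal (superlevel f h) * indicator {0<..<?A} h' \<partial>lborel)"
  proof (rule nn_integral_cong)
    fix h' :: real
    consider "h' \<le> 0" | "?A \<le> h'" | "0 < h'" "h' < ?A" by linarith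
    then show "ennreal (superlevel f h') * indicator {0<..} h' = ennreal (superlevel f h) * indicator {0<..<?A} h'"
    proof cases
      case 2 then show ?thesis by (simp add: superlevel_eq_0[OF f(1)])
    next
      case 3 then show ?thesis by (simp add: const)
    qed simp
  qed
  also have "\<dots> = ennreal (superlevel f h * ?A)" using f(3) by (simp add: nn_integral_cmult_indicator ennreal_mult)
  finally have "m = superlevel f h * ?A" using m f(3) by (subst (asm) ennreal_inj) auto
  then show ?thesis using f(3) by simp
qed

lemma energy_deficit_bounds:
  fixes \<rho> W :: "'a::euclidean_space \<Rightarrow> real"
  assumes \<rho>: "\<rho> \<in> density_class R" and R: "0 < R" and W: "\<And>x. x \<noteq> 0 \<Longrightarrow> W x = w (norm x)"
    and w: "profile_bound w c (18 * R)" and c: "0 < c"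
  shows "2 \<le> DIM('a) \<or> multiple_of_indicator \<rho> \<Longrightarrow> energy_deficit_bound W (gap_const TYPE('a) * c) 2 \<rho>"
    "DIM('a) = 1 \<Longrightarrow> energy_deficit_bound W (gap_const TYPE('a) * c) 3 \<rho>"
proof -
  let ?A = "Linf_norm \<rho>" and ?m = "L1_norm \<rho>" and ?d = "asymmetry \<rho>" and ?n = "real DIM('a)"
  obtain f where f: "bounded_density ?A f" and ae: "AE x in lborel. \<rho> x = f x" and A: "0 < ?A" and m0: "0 < ?m"
    and m: "(\<integral>\<^sup>+x. ennreal (f x) \<partial>lborel) = ennreal ?m" and re: "rearrangement \<rho> = rearrangement f"
    and le: "AE x in lborel. \<bar>\<rho> x\<bar> \<le> ?A"
    by (rule density_class_representative[OF \<rho>])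
  have supp: "topological_support (rearrangement f) \<subseteq> cball 0 R" using \<rho> re by (simp add: density_class_def)
  have sl: "superlevel f h \<le> unit_ball_vol DIM('a) * R ^ DIM('a)" if "0 < h" for h
    by (rule superlevel_le_of_support[OF f supp R that])
  have supp0: "rearrangement f x = 0" if "R < norm x" for x
  proof (rule ccontr)
    assume "rearrangement f x \<noteq> 0"
    then have "x \<in> topological_support (rearrangement f)"
      unfolding topological_support_def by (intro closure_subset[THEN subsetD]) auto
    then show False using supp that by auto
  qed
  note d = asymmetry_bounds[OF f ae re m m0]
  have final: "ereal (c / 2 * z) \<le> interaction_energy W (rearrangement \<rho>) - interaction_energy W \<rho>"
    if z: "0 \<le> z" and gap: "interaction (quad_kernel (18 * R)) f + ennreal z \<le> interaction (quad_kernel (18 * R)) (rearrangement f)" for z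
    unfolding re interaction_energy_AE[OF ae]
    using R c z
    by (intro interaction_energy_gap[OF f m _ W w supp0 R] truncated_interaction_gap[OF f w _ _ z gap]) (auto simp: less_imp_le[OF m0])
  have powr2: "?m powr (2 + 2 / ?n) = ?m^2 * ?m powr (2 / ?n)"
    using m0 by (simp add: powr_add powr_numeral)
  {
    assume shape: "2 \<le> DIM('a) \<or> multiple_of_indicator \<rho>"
    have shape': "2 \<le> DIM('a) \<or> (\<forall>h. 0 < h \<longrightarrow> h < ?A \<longrightarrow> superlevel f h = ?m / ?A)"
      using shape superlevel_multiple_of_indicator[OF \<rho> _ f ae A le m m0] by blast
    have "c / 2 * (2 * ?m * (?m * ?d^2 * (level_scale TYPE('a) ?A ?m)^2 / (8 * DIM('a))))
      = c * ?m^2 * ?d^2 * ((level_scale TYPE('a) ?A ?m)^2 / (8 * DIM('a)))"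
      by (simp add: power2_eq_square)
    also have "\<dots> = gap_const TYPE('a) * c * ?m powr (2 + 2 / ?n) * ?A powr (- 2 / ?n) * ?d^2"
      unfolding level_scale_square[OF m0 A] powr2 by simp
    finally have eq: "c / 2 * (2 * ?m * (?m * ?d^2 * (level_scale TYPE('a) ?A ?m)^2 / (8 * DIM('a))))
      = gap_const TYPE('a) * c * ?m powr (2 + 2 / ?n) * ?A powr (- 2 / ?n) * ?d^2" .
    show "energy_deficit_bound W (gap_const TYPE('a) * c) 2 \<rho>"
      unfolding energy_deficit_bound_def eq[symmetric]
      by (rule final[OF _ quad_gap_square[OF f A m m0 R sl d shape']]) (use m0 in auto)
  }
  {
    assume dim: "DIM('a) = 1"
    \<comment> \<open>On the line the unit ball has length 2, so \<open>gap_const\<close> is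
      \<open>1 / 32\<close>, half of what the cubic estimate yields; one constant thus serves for
      both exponents.\<close>
    have "gap_const TYPE('a) * c * ?m powr (2 + 2 / ?n) * ?A powr (- 2 / ?n) * ?d^3 = c * (?m^4 * ?d^3 / ?A^2) / 32"
    proof -
      have "gap_const TYPE('a) = 1 / 32" by (simp add: gap_const_def dim powr_numeral)
      moreover have "?m powr (2 + 2 / ?n) = ?m^4" using m0 powr_realpow[of ?m 4] by (simp add: dim)
      moreover have "?A powr (- 2 / ?n) = 1 / ?A^2" using A by (simp add: dim powr_minus_divide powr_numeral)
      ultimately show ?thesis by (simp only:) simp
    qed
    also have "\<dots> \<le> c * (?m^4 * ?d^3 / ?A^2) / 16"
    proof -
      have "0 \<le> c * (?m^4 * ?d^3 / ?A^2)" using c d(1) m0 by simp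
      then show ?thesis by (intro divide_left_mono) auto
    qed
    also have "\<dots> = c / 2 * (2 * ?m * (?m^3 * ?d^3 / (16 * ?A^2)))"
      by (simp add: power3_eq_cube power4_eq_xxxx)
    finally have le: "ereal (gap_const TYPE('a) * c * ?m powr (2 + 2 / ?n) * ?A powr (- 2 / ?n) * ?d^3)
      \<le> ereal (c / 2 * (2 * ?m * (?m^3 * ?d^3 / (16 * ?A^2))))" by simp
    show "energy_deficit_bound W (gap_const TYPE('a) * c) 3 \<rho>"
      unfolding energy_deficit_bound_def
      by (rule order_trans[OF le final[OF _ quad_gap_cube[OF f A m m0 R sl d dim]]]) (use m0 d(1) in auto)
  }
qed

section \<open>Profiles of admissible and power-law potentials\<close>

lemma profile_boundI:
  fixes w w' :: "real \<Rightarrow> real"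
  assumes der: "\<And>r. 0 < r \<Longrightarrow> (w has_real_derivative w' r) (at r)" and neg: "\<And>r. 0 < r \<Longrightarrow> w' r \<le> 0"
    and bound: "\<And>r. 0 < r \<Longrightarrow> r \<le> M \<Longrightarrow> w' r \<le> - c * r"
  shows "profile_bound w c M"
  unfolding profile_bound_def
proof (intro conjI allI impI)
  show "continuous_on {0<..} w"
    using der by (intro continuous_at_imp_continuous_on) (auto intro: DERIV_isCont)
  show "w s \<le> w r" if "0 < r" "r \<le> s" for r s
  proof (rule DERIV_nonpos_imp_nonincreasing[OF that(2)])
    fix x assume "r \<le> x" "x \<le> s"
    then have "0 < x" using that by simp
    then show "\<exists>y. (w has_real_derivative y) (at x) \<and> y \<le> 0" using der neg by blast
  qed
  show "c / 2 * (s^2 - r^2) \<le> w r - w s" if rs: "0 < r" "r \<le> s" "s \<le> M" for r s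
  proof -
    have "w s + c / 2 * s^2 \<le> w r + c / 2 * r^2"
    proof (rule DERIV_nonpos_imp_nonincreasing[OF rs(2)])
      fix x assume x: "r \<le> x" "x \<le> s"
      have "((\<lambda>x. w x + c / 2 * x^2) has_real_derivative w' x + c * x) (at x)"
        using der[of x] rs x by (auto intro!: derivative_eq_intros)
      moreover have "w' x + c * x \<le> 0" using bound[of x] rs x by auto
      ultimately show "\<exists>y. ((\<lambda>x. w x + c / 2 * x^2) has_real_derivative y) (at x) \<and> y \<le> 0" by blast
    qed
    then show ?thesis by (simp add: algebra_simps)
  qed
qed

text \<open>The assumed slope bound reaches only up to radius 1. Beyond it, continuity of the
  derivative, inherited from \<open>W\<close> along a ray, and its strict negativity give a negative
  maximum on a compact interval; dividing this maximum by the right end point turns it into a linear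
  bound, at the price of a smaller \<open>c\<close>.\<close>

lemma admissible_profile:
  fixes W :: "'a::euclidean_space \<Rightarrow> real"
  assumes adm: "admissible_potential W" and M: "0 < M"
  obtains w c where "\<And>x. x \<noteq> 0 \<Longrightarrow> W x = w (norm x)" "0 < c" "profile_bound w c M"
proof -
  obtain w c1 where W: "\<And>x. x \<noteq> 0 \<Longrightarrow> W x = w (norm x)" and neg: "\<And>r. 0 < r \<Longrightarrow> deriv w r < 0"
    and c1: "0 < c1" "\<And>r. r \<in> {0<..<1} \<Longrightarrow> deriv w r \<le> - c1 * r"
    using adm unfolding admissible_potential_def by blast
  obtain W' :: "'a \<Rightarrow> 'a \<Rightarrow>\<^sub>L real" where W': "\<And>x. x \<noteq> 0 \<Longrightarrow> (W has_derivative blinfun_apply (W' x)) (at x)" and W'c: "continuous_on (- {0}) W'"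
    using adm unfolding admissible_potential_def C1_on_def by auto
  obtain e :: 'a where e: "norm e = 1" using vector_choose_size[of 1] by auto
  define w' where "w' r = blinfun_apply (W' (r *\<^sub>R e)) e" for r
  have e0: "r *\<^sub>R e \<noteq> 0" if "0 < r" for r using e that by auto
  have der: "(w has_real_derivative w' r) (at r)" if r: "0 < r" for r
  proof -
    have 1: "((\<lambda>r. W (r *\<^sub>R e)) has_derivative (\<lambda>h. blinfun_apply (W' (r *\<^sub>R e)) (h *\<^sub>R e))) (at r)"
      by (rule has_derivative_compose[of "\<lambda>r. r *\<^sub>R e" "\<lambda>h. h *\<^sub>R e" r UNIV W "blinfun_apply (W' (r *\<^sub>R e))"])
        (use W'[OF e0[OF r]] in \<open>auto intro!: derivative_eq_intros\<close>)
    have "((\<lambda>r. W (r *\<^sub>R e)) has_real_derivative w' r) (at r)"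
    proof -
      have "(\<lambda>h. blinfun_apply (W' (r *\<^sub>R e)) (h *\<^sub>R e)) = (*) (w' r)"
        by (simp add: fun_eq_iff w'_def blinfun.scaleR_right)
      then show ?thesis using 1 by (simp only: has_field_derivative_def)
    qed
    then show ?thesis
      by (rule has_field_derivative_transform_within_open[of _ _ _ "{0<..}"]) (use r e e0 W in auto)
  qed
  have dw: "deriv w r = w' r" if "0 < r" for r using DERIV_imp_deriv[OF der[OF that]] .
  \<comment> \<open>At least 1, so that \<open>{1/2..M'}\<close> is nonempty and covers all radii
    from 1 to \<open>M\<close>.\<close>
  define M' where "M' = max M 1"
  have cont: "continuous_on {1/2..M'} w'"
    unfolding w'_def[abs_def]
    by (intro continuous_intros continuous_on_compose2[OF W'c]) (use e in auto)
  have ne: "{1/2..M'} \<noteq> {}" by (auto simp: M'_def)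
  obtain r0 where r0: "r0 \<in> {1/2..M'}" "\<And>r. r \<in> {1/2..M'} \<Longrightarrow> w' r \<le> w' r0"
    using continuous_attains_sup[OF compact_Icc ne cont] by blast
  have d: "w' r0 < 0" using neg[of r0] dw[of r0] r0(1) by auto
  define c where "c = min c1 (- w' r0 / M')"
  have M'p: "0 < M'" by (simp add: M'_def)
  have c: "0 < c" using c1 d M'p by (simp add: c_def divide_neg_pos)
  have "profile_bound w c M"
  proof (rule profile_boundI[where w'=w'])
    show "(w has_real_derivative w' r) (at r)" if "0 < r" for r by (rule der[OF that])
    show "w' r \<le> 0" if "0 < r" for r using neg[OF that] dw[OF that] by simp
    fix r assume r: "0 < r" "r \<le> M"
    show "w' r \<le> - c * r"
    proof (cases "r < 1")
      case True
      then have "w' r \<le> - c1 * r" using c1(2)[of r] r dw by simp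
      also have "\<dots> \<le> - c * r" using r by (intro mult_right_mono) (auto simp: c_def)
      finally show ?thesis .
    next
      case False
      then have "w' r \<le> w' r0" using r by (intro r0(2)) (auto simp: M'_def)
      also have "\<dots> = - ((- w' r0 / M') * M')" using M'p by simp
      also have "\<dots> \<le> - (c * r)"
      proof -
        have "c * r \<le> (- w' r0 / M') * M'" using r c by (intro mult_mono) (auto simp: c_def M'_def)
        then show ?thesis by simp
      qed
      finally show ?thesis by simp
    qed
  qed
  then show ?thesis using that W c by blast
qed

text \<open>The factor \<open>1 / k\<close> gives all these profiles, the logarithm included, the
  slope \<open>- (r powr (k - 2)) * r\<close>. As \<open>k \<le> 2\<close>, the power
  \<open>r powr (k - 2)\<close> is smallest at \<open>r = M\<close>.\<close>

lemma power_profile: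
  assumes k: "k \<le> 2" and M: "0 < M" and c: "c \<le> M powr (k - 2)"
  shows "profile_bound (\<lambda>r. if k = 0 then - ln r else - (r powr k) / k) c M"
proof (rule profile_boundI[where w'="\<lambda>r. - (r powr (k - 1))"])
  fix r :: real assume r: "0 < r"
  show "((\<lambda>r. if k = 0 then - ln r else - (r powr k) / k) has_real_derivative - (r powr (k - 1))) (at r)"
  proof (cases "k = 0")
    case True
    then show ?thesis using r by (auto intro!: derivative_eq_intros simp: powr_minus_divide)
  next
    case False
    then show ?thesis using r by (auto intro!: derivative_eq_intros)
  qed
  show "- (r powr (k - 1)) \<le> 0" by simp
  assume rM: "r \<le> M"
  have "c * r \<le> M powr (k - 2) * r" using c r by (intro mult_right_mono) auto
  also have "\<dots> \<le> r powr (k - 2) * r" using r rM k by (intro mult_right_mono powr_mono2') auto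
  also have "\<dots> = r powr (k - 1)"
  proof -
    have "r powr (k - 1) = r powr (k - 2) * r powr 1" unfolding powr_add[symmetric] by simp
    then show ?thesis using r by simp
  qed
  finally show "- (r powr (k - 1)) \<le> - c * r" by simp
qed

theorem theorem1p1:
  shows
    "(\<forall>W :: 'a::euclidean_space \<Rightarrow> real. admissible_potential W \<longrightarrow>
        (DIM('a) \<ge> 2 \<longrightarrow>
          (\<forall>R>0. \<exists>c>0. \<forall>\<rho>\<in>density_class R. energy_deficit_bound W c 2 \<rho>)) \<and>
        (DIM('a) = 1 \<longrightarrow>
          (\<forall>R>0. \<exists>c>0. \<forall>\<rho>\<in>density_class R.
             (multiple_of_indicator \<rho> \<longrightarrow> energy_deficit_bound W c 2 \<rho>) \<and>
             energy_deficit_bound W c 3 \<rho>))) \<and>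
     (\<exists>c>0. \<forall>k\<in>{- real DIM('a)<..2}. \<forall>R>0. \<forall>\<rho>\<in>density_class R.
        (DIM('a) \<ge> 2 \<longrightarrow>
          energy_deficit_bound (power_potential k :: 'a \<Rightarrow> real) (c * R powr (k - 2)) 2 \<rho>) \<and>
        (DIM('a) = 1 \<longrightarrow>
          (multiple_of_indicator \<rho> \<longrightarrow>
             energy_deficit_bound (power_potential k :: 'a \<Rightarrow> real) (c * R powr (k - 2)) 2 \<rho>) \<and>
          energy_deficit_bound (power_potential k :: 'a \<Rightarrow> real) (c * R powr (k - 2)) 3 \<rho>))"
proof (intro conjI allI impI)
  fix W :: "'a \<Rightarrow> real" and R :: real
  assume W: "admissible_potential W" and R: "0 < R"
  then have "0 < 18 * R" by simp
  then obtain w c where w: "\<And>x. x \<noteq> 0 \<Longrightarrow> W x = w (norm x)" and c: "0 < c" and b: "profile_bound w c (18 * R)"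
    using admissible_profile[OF W] by metis
  have gc: "0 < gap_const TYPE('a) * c" using gap_const_pos[where 'a='a] c by simp
  note B = energy_deficit_bounds[OF _ R w b c]
  show "\<exists>c>0. \<forall>\<rho>\<in>density_class R. energy_deficit_bound W c 2 \<rho>" if "DIM('a) \<ge> 2"
    using gc B(1) that by blast
  show "\<exists>c>0. \<forall>\<rho>\<in>density_class R. (multiple_of_indicator \<rho> \<longrightarrow> energy_deficit_bound W c 2 \<rho>) \<and> energy_deficit_bound W c 3 \<rho>"
    if "DIM('a) = 1"
    using gc B that by blast
next
  \<comment> \<open>The profile bound up to \<open>18 * R\<close> holds with
    \<open>(18 * R) powr (k - 2)\<close>. Since \<open>k > - n\<close>, the factor
    \<open>18 powr (k - 2)\<close> is at least \<open>18 powr (- (n + 2))\<close>, which makes the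
    constant independent of \<open>k\<close>.\<close>
  let ?c = "gap_const TYPE('a) * 18 powr (- (real DIM('a) + 2))"
  have "0 < ?c" using gap_const_pos[where 'a='a] by simp
  moreover have "(DIM('a) \<ge> 2 \<longrightarrow> energy_deficit_bound (power_potential k :: 'a \<Rightarrow> real) (?c * R powr (k - 2)) 2 \<rho>) \<and>
        (DIM('a) = 1 \<longrightarrow>
          (multiple_of_indicator \<rho> \<longrightarrow>
             energy_deficit_bound (power_potential k :: 'a \<Rightarrow> real) (?c * R powr (k - 2)) 2 \<rho>) \<and>
          energy_deficit_bound (power_potential k :: 'a \<Rightarrow> real) (?c * R powr (k - 2)) 3 \<rho>)"
    if k: "k \<in> {- real DIM('a)<..2}" and R: "0 < R" and \<rho>: "\<rho> \<in> density_class R" for k R and \<rho> :: "'a \<Rightarrow> real"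
  proof -
    let ?C = "18 powr (- (real DIM('a) + 2)) * R powr (k - 2)"
    have C: "0 < ?C" using R by simp
    have "18 powr (- (real DIM('a) + 2)) \<le> (18::real) powr (k - 2)" using k by (intro powr_mono) auto
    then have "?C \<le> 18 powr (k - 2) * R powr (k - 2)" by (intro mult_right_mono) auto
    also have "\<dots> = (18 * R) powr (k - 2)" using R by (simp add: powr_mult)
    finally have b: "profile_bound (\<lambda>r. if k = 0 then - ln r else - (r powr k) / k) ?C (18 * R)"
      using k R by (intro power_profile) auto
    have W: "power_potential k x = (if k = 0 then - ln (norm x) else - (norm x powr k) / k)" for x :: 'a
      by (rule power_potential_def)
    show ?thesis unfolding mult.assoc using energy_deficit_bounds[OF \<rho> R W b C] by blast
  qed
  ultimately show "\<exists>c>0. \<forall>k\<in>{- real DIM('a)<..2}. \<forall>R>0. \<forall>\<rho>\<in>density_class R.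
        (DIM('a) \<ge> 2 \<longrightarrow>
          energy_deficit_bound (power_potential k :: 'a \<Rightarrow> real) (c * R powr (k - 2)) 2 \<rho>) \<and>
        (DIM('a) = 1 \<longrightarrow>
          (multiple_of_indicator \<rho> \<longrightarrow>
             energy_deficit_bound (power_potential k :: 'a \<Rightarrow> real) (c * R powr (k - 2)) 2 \<rho>) \<and>
          energy_deficit_bound (power_potential k :: 'a \<Rightarrow> real) (c * R powr (k - 2)) 3 \<rho>)"
    by blast
qed

end
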